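(* Let $T\colon X\to Y$, $A=T^*T$, Gaussian white noise $\xi$, $\zeta=T^*\xi$, and the data $z^\delta=Ax^\dagger+\delta\zeta$ be as in the context, and assume $\mathrm{Tr}[A]<\infty$. Let $x_0\in X$, $\alpha_0>0$, $0<q<1$, $\tau>1$, $\eta>0$. Let $\psi\colon[0,\|A\|]\to[0,\infty)$ be continuous and non-decreasing with $\psi(0)=0$, and let $(g_\alpha)_{\alpha>0}$ be a regularization (see the context) with qualification $\psi$, i.e. there is $\gamma<\infty$ with $|r_\alpha(t)|\psi(t)\le\gamma\psi(\alpha)$ for all $0\le t\le\|A\|$ and $0<\alpha\le\|A\|$. Let $H_\psi:=\{x\in X: x=\psi(A)v\text{ for some }\|v\|\le1\}$. Fix $c_1>1$, $0<c_2<1$, $0<t_0<\|A\|$. For $\delta>0$ let $\alpha_{RG}$ be chosen by the statistical RG-rule (see the context) with $\kappa=\sqrt{8|\log(1/\delta)|/\mathcal N(\alpha_0)}$. Then there is a constant $C$, independent of $\delta$, such that $$\sup_{x^\dagger}\left(\mathbb E\left[\|x^\dagger-x^\delta_{\alpha_{RG}}\|^2\right]\right)^{1/2}\le C\,\psi\left(\Theta_{\varrho_{\mathcal N}\psi}^{-1}\left(\delta(1+\sqrt{|\log(1/\delta)|})\right)\right)$$ for all $\delta>0$ such that $\delta(1+\sqrt{|\log(1/\delta)|})$ lies in the range of $\Theta_{\varrho_{\mathcal N}\psi}(t):=\Theta_{\varrho_{\mathcal N}}(t)\psi(t)$, $0<t\le\|A\|$. Here the supremum is over all $x^\dagger\in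 X$ with $x^\dagger-x_0\in H_\psi$ that satisfy $$\int_0^\alpha d\|E_t(x^\dagger-x_0)\|^2\le c_1^2\int_{c_2\alpha}^\infty r_\alpha^2(t)\,d\|E_t(x^\dagger-x_0)\|^2\qquad\text{for all }0<\alpha\le t_0 .$$
   Context: **Model.** $X,Y$ are Hilbert spaces, $T\colon X\to Y$ is a nonzero compact linear operator, $A:=T^*T$, $\delta>0$ is the noise level, $x^\dagger\in X$ is the unknown solution. Gaussian white noise: $\xi=(\xi(y))_{y\in Y}$ is a stochastic process on a complete probability space $(\Omega,\mathcal F,\mathbb P)$ such that each $\xi(y)\in L_2(\Omega,\mathcal F,\mathbb P)$ is a centered Gaussian random variable and $\mathbb E[\xi(y)\xi(y')]=\langle y,y'\rangle$ for all $y,y'\in Y$. One writes $\langle\xi,y\rangle=\xi(y)$. Then $\zeta:=T^*\xi$, i.e. $\langle\zeta,w\rangle=\xi(Tw)$ for $w\in X$, has covariance $\mathbb E[\langle\zeta,w\rangle\langle\zeta,w'\rangle]=\langle w,Aw'\rangle$; when $\mathrm{Tr}[A]<\infty$ it is (almost surely) a Gaussian random element of $X$. The data are $z^\delta:=Ax^\dagger+\delta\zeta$. **Effective dimension.** $\mathcal N(\lambda):=\mathrm{Tr}[(A+\lambda I)^{-1}A]$, $\varrho_{\mathcal N}(t):=1/\sqrt{t\,\mathcal N(t)}$, $\Theta_{\varrho_{\mathcal N}}(t):=t\,\varrho_{\mathcal N}(t)$ for $\lambda,t>0$. The function $\Theta_{\varrho_{\mathcal N}}$ is continuous and strictly increasing,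 so for a positive value $s$ in the range of $\Theta_{\varrho_{\mathcal N}\psi}$, $\Theta_{\varrho_{\mathcal N}\psi}^{-1}(s)$ denotes the unique root $\alpha$ of $\Theta_{\varrho_{\mathcal N}}(\alpha)\psi(\alpha)=s$. **Regularization.** A family of functions $g_\alpha\colon[0,\|A\|]\to\mathbb R$, $\alpha>0$, piecewise continuous in $\alpha$, with residual functions $r_\alpha(t):=1-t\,g_\alpha(t)$, such that: (i) for each $0<t\le\|A\|$, $|r_\alpha(t)|\to0$ as $\alpha\to0$; (ii) there is $\gamma_*\ge1$ with $\sup_{0\le t\le\|A\|}\alpha|g_\alpha(t)|\le\gamma_*$ for all $\alpha>0$; (iii) $r_\alpha(t)\le r_\beta(t)$ for $0<\alpha\le\beta$; (iv) $0\le r_\alpha(t)\le1$ for $\alpha>0$. With the initial guess $x_0\in X$ put $x_\alpha^\delta:=x_0-g_\alpha(A)(Ax_0-z^\delta)$. **Statistical RG-rule.** $\Delta_q:=\{q^k\alpha_0: k=0,1,2,\dots\}$ and $s_\alpha(t):=\alpha/(t+\alpha)$. Given $\tau>1$, $\eta>0$, $\kappa\ge0$, $\alpha_{RG}$ is the largest $\alpha\in\Delta_q$ for which either $$\|s_\alpha(A)(Ax_\alpha^\delta-z^\delta)\|\le\tau(1+\kappa)\frac{\delta}{\varrho_{\mathcal N}(\alpha)}\quad\text{or}\quad\Theta_{\varrho_{\mathcal N}}(\alpha)\le\eta(1+\kappa)\delta .$$ **Spectral integrals.** $(E_t)$ is the spectral resolution of $A$; integrals $\int_a^b f(t)\,d\|E_tw\|^2$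 are integrals over $[a,b)$ with respect to the spectral measure $B\mapsto\|1_B(A)w\|^2$ (so $\int_0^\alpha d\|E_tw\|^2=\|1_{[0,\alpha)}(A)w\|^2$). *)

theory Defs
  imports "HOL-Probability.Probability"
begin

section \<open>Operators on real Hilbert spaces\<close>

text \<open>Hilbert spaces are types of sort \<open>{real_inner, complete_space}\<close>; separability is not assumed.\<close>

definition compact_op :: "('a::real_normed_vector \<Rightarrow> 'b::real_normed_vector) \<Rightarrow> bool" where
  "compact_op T \<longleftrightarrow> bounded_linear T \<and> compact (closure (T ` cball 0 1))"

definition orthonormal_basis :: "'a::real_inner set \<Rightarrow> bool" where
  "orthonormal_basis E \<longleftrightarrow>
     pairwise orthogonal E \<and> (\<forall>e\<in>E. norm e = 1) \<and> closure (span E) = UNIV"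

text \<open>The trace of a positive operator, with values in \<open>[0, \<infinity>]\<close>. For positive operators on a Hilbert
  space the sum does not depend on the orthonormal basis.\<close>

definition op_trace :: "('a::real_inner \<Rightarrow> 'a) \<Rightarrow> ennreal" where
  "op_trace B = (\<Sum>\<^sub>\<infinity> e\<in>(SOME E. orthonormal_basis E). ennreal (e \<bullet> B e))"

definition eigenspace :: "('a::real_inner \<Rightarrow> 'a) \<Rightarrow> real \<Rightarrow> 'a set" where
  "eigenspace A l = {v. A v = l *\<^sub>R v}"

definition eigenvalues :: "('a::real_inner \<Rightarrow> 'a) \<Rightarrow> real set" where
  "eigenvalues A = {l. eigenspace A l \<noteq> {0}}"

text \<open>\<^const>\<open>closest_point\<close> requires the Heine-Borel property, so it does not apply here.\<close>

definition orth_proj :: "'a::real_inner set \<Rightarrow> 'a \<Rightarrow> 'a" where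
  "orth_proj S x = (THE p. p \<in> S \<and> (\<forall>s\<in>S. orthogonal (x - p) s))"

text \<open>The operator \<open>f(A)\<close> for a compact self-adjoint operator \<open>A\<close>, whose spectral resolution consists
  of the orthogonal projections onto the eigenspaces (the kernel included, if it is nontrivial). The
  sum converges unconditionally if \<open>f\<close> is bounded on the eigenvalues; only the values of \<open>f\<close>
  at eigenvalues matter.\<close>

definition op_fun :: "('a::real_inner \<Rightarrow> 'a) \<Rightarrow> (real \<Rightarrow> real) \<Rightarrow> 'a \<Rightarrow> 'a" where
  "op_fun A f x = (\<Sum>\<^sub>\<infinity> l\<in>eigenvalues A. f l *\<^sub>R orth_proj (eigenspace A l) x)"

text \<open>The measure \<open>B \<mapsto> \<parallel>1\<^sub>B(A) w\<parallel>\<^sup>2\<close>. As \<open>A\<close> has pure point spectrum, it is defined on all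
  subsets of the real line, so that every function is measurable.\<close>

definition spectral_measure :: "('a::real_inner \<Rightarrow> 'a) \<Rightarrow> 'a \<Rightarrow> real measure" where
  "spectral_measure A w =
     measure_of UNIV UNIV (\<lambda>B. ennreal ((norm (op_fun A (indicator B) w))\<^sup>2))"

section \<open>Effective dimension\<close>

definition eff_dim :: "('a::real_inner \<Rightarrow> 'a) \<Rightarrow> real \<Rightarrow> real" where
  "eff_dim A l = enn2real (op_trace (inv (\<lambda>x. A x + l *\<^sub>R x) \<circ> A))"

definition rho_eff :: "('a::real_inner \<Rightarrow> 'a) \<Rightarrow> real \<Rightarrow> real" where
  "rho_eff A t = 1 / sqrt (t * eff_dim A t)"

definition Theta :: "('a::real_inner \<Rightarrow> 'a) \<Rightarrow> real \<Rightarrow> real" where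
  "Theta A t = t * rho_eff A t"

definition Theta_psi :: "('a::real_inner \<Rightarrow> 'a) \<Rightarrow> (real \<Rightarrow> real) \<Rightarrow> real \<Rightarrow> real" where
  "Theta_psi A \<psi> t = Theta A t * \<psi> t"

definition Theta_psi_inv :: "('a::real_inner \<Rightarrow> 'a) \<Rightarrow> (real \<Rightarrow> real) \<Rightarrow> real \<Rightarrow> real" where
  "Theta_psi_inv A \<psi> s = (THE \<alpha>. 0 < \<alpha> \<and> \<alpha> \<le> onorm A \<and> Theta_psi A \<psi> \<alpha> = s)"

section \<open>Gaussian white noise\<close>

text \<open>The degenerate case of variance zero is included; it is needed at index \<open>0\<close>.\<close>

definition centered_gaussian :: "'w measure \<Rightarrow> ('w \<Rightarrow> real) \<Rightarrow> bool" where
  "centered_gaussian M X \<longleftrightarrow>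
     X \<in> borel_measurable M \<and>
     ((AE \<omega> in M. X \<omega> = 0) \<or>
      (\<exists>\<sigma>>0. distributed M lborel X (\<lambda>x. ennreal (normal_density 0 \<sigma> x))))"

definition white_noise :: "'w measure \<Rightarrow> ('b::real_inner \<Rightarrow> 'w \<Rightarrow> real) \<Rightarrow> bool" where
  "white_noise M \<xi> \<longleftrightarrow>
     (\<forall>y. centered_gaussian M (\<xi> y) \<and> integrable M (\<lambda>\<omega>. (\<xi> y \<omega>)\<^sup>2)) \<and>
     (\<forall>y y'. (\<integral>\<omega>. \<xi> y \<omega> * \<xi> y' \<omega> \<partial>M) = y \<bullet> y')"

text \<open>\<open>\<zeta>\<close> is a version of \<open>T\<^sup>*\<xi>\<close> as a random element of the Hilbert space. Random elements are
  almost surely separably valued (which is vacuous in a separable space); with this, \<open>\<zeta>\<close> is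
  determined by \<open>T\<close> and \<open>\<xi>\<close> up to a null set.\<close>

definition adjoint_noise ::
    "'w measure \<Rightarrow> ('a::real_inner \<Rightarrow> 'b::real_inner) \<Rightarrow> ('b \<Rightarrow> 'w \<Rightarrow> real) \<Rightarrow> ('w \<Rightarrow> 'a) \<Rightarrow> bool" where
  "adjoint_noise M T \<xi> \<zeta> \<longleftrightarrow>
     \<zeta> \<in> borel_measurable M \<and>
     (\<exists>S. countable S \<and> (AE \<omega> in M. \<zeta> \<omega> \<in> closure S)) \<and>
     (\<forall>w. AE \<omega> in M. \<zeta> \<omega> \<bullet> w = \<xi> (T w) \<omega>)"

definition noisy_data :: "('a::real_inner \<Rightarrow> 'a) \<Rightarrow> ('w \<Rightarrow> 'a) \<Rightarrow> real \<Rightarrow> 'a \<Rightarrow> 'w \<Rightarrow> 'a" where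
  "noisy_data A \<zeta> \<delta> x \<omega> = A x + \<delta> *\<^sub>R \<zeta> \<omega>"

section \<open>Regularization\<close>

text \<open>Piecewise continuity on \<open>(0, \<infinity>)\<close>: on every compact subinterval there are finitely many
  discontinuities, all of them of the first kind. Discontinuities may accumulate at \<open>0\<close>.\<close>

definition piecewise_continuous_pos :: "(real \<Rightarrow> real) \<Rightarrow> bool" where
  "piecewise_continuous_pos f \<longleftrightarrow>
     (\<forall>a b. 0 < a \<and> a < b \<longrightarrow>
       (\<exists>S. finite S \<and> S \<subseteq> {a..b} \<and> continuous_on ({a..b} - S) f \<and>
            (\<forall>s\<in>S. (\<exists>l. (f \<longlongrightarrow> l) (at_left s)) \<and> (\<exists>l. (f \<longlongrightarrow> l) (at_right s)))))"

definition residual :: "(real \<Rightarrow> real \<Rightarrow> real) \<Rightarrow> real \<Rightarrow> real \<Rightarrow> real" where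
  "residual g \<alpha> t = 1 - t * g \<alpha> t"

text \<open>Here \<open>a\<close> stands for \<open>\<parallel>A\<parallel>\<close>; values of \<open>g \<alpha>\<close> outside \<open>[0, a]\<close> are irrelevant.\<close>

definition regularization :: "real \<Rightarrow> (real \<Rightarrow> real \<Rightarrow> real) \<Rightarrow> bool" where
  "regularization a g \<longleftrightarrow>
     (\<forall>t\<in>{0..a}. piecewise_continuous_pos (\<lambda>\<alpha>. g \<alpha> t)) \<and>
     (\<forall>t\<in>{0<..a}. ((\<lambda>\<alpha>. \<bar>residual g \<alpha> t\<bar>) \<longlongrightarrow> 0) (at_right 0)) \<and>
     (\<exists>\<gamma>\<ge>1. \<forall>\<alpha>>0. \<forall>t\<in>{0..a}. \<alpha> * \<bar>g \<alpha> t\<bar> \<le> \<gamma>) \<and>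
     (\<forall>\<alpha> \<beta>. \<forall>t\<in>{0..a}. 0 < \<alpha> \<and> \<alpha> \<le> \<beta> \<longrightarrow> residual g \<alpha> t \<le> residual g \<beta> t) \<and>
     (\<forall>\<alpha>>0. \<forall>t\<in>{0..a}. 0 \<le> residual g \<alpha> t \<and> residual g \<alpha> t \<le> 1)"

definition qualification :: "real \<Rightarrow> (real \<Rightarrow> real \<Rightarrow> real) \<Rightarrow> (real \<Rightarrow> real) \<Rightarrow> bool" where
  "qualification a g \<psi> \<longleftrightarrow>
     (\<exists>\<gamma>. \<forall>t\<in>{0..a}. \<forall>\<alpha>\<in>{0<..a}. \<bar>residual g \<alpha> t\<bar> * \<psi> t \<le> \<gamma> * \<psi> \<alpha>)"

definition reg_solution ::
    "('a::real_inner \<Rightarrow> 'a) \<Rightarrow> (real \<Rightarrow> real \<Rightarrow> real) \<Rightarrow> 'a \<Rightarrow> 'a \<Rightarrow> real \<Rightarrow> 'a" where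
  "reg_solution A g x0 z \<alpha> = x0 - op_fun A (g \<alpha>) (A x0 - z)"

definition rg_grid :: "real \<Rightarrow> real \<Rightarrow> real set" where
  "rg_grid q \<alpha>0 = range (\<lambda>k::nat. q ^ k * \<alpha>0)"

definition rg_stop ::
    "('a::real_inner \<Rightarrow> 'a) \<Rightarrow> (real \<Rightarrow> real \<Rightarrow> real) \<Rightarrow> 'a \<Rightarrow> real \<Rightarrow> real \<Rightarrow> real \<Rightarrow> real \<Rightarrow> 'a \<Rightarrow> real \<Rightarrow> bool"
  where
  "rg_stop A g x0 \<tau> \<eta> \<kappa> \<delta> z \<alpha> \<longleftrightarrow>
     norm (op_fun A (\<lambda>t. \<alpha> / (t + \<alpha>)) (A (reg_solution A g x0 z \<alpha>) - z))
       \<le> \<tau> * (1 + \<kappa>) * (\<delta> / rho_eff A \<alpha>) \<or>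
     Theta A \<alpha> \<le> \<eta> * (1 + \<kappa>) * \<delta>"

definition rg_alpha ::
    "('a::real_inner \<Rightarrow> 'a) \<Rightarrow> (real \<Rightarrow> real \<Rightarrow> real) \<Rightarrow> 'a \<Rightarrow> real \<Rightarrow> real \<Rightarrow> real \<Rightarrow> real \<Rightarrow> real \<Rightarrow> real
      \<Rightarrow> 'a \<Rightarrow> real" where
  "rg_alpha A g x0 q \<alpha>0 \<tau> \<eta> \<kappa> \<delta> z =
     (GREATEST \<alpha>. \<alpha> \<in> rg_grid q \<alpha>0 \<and> rg_stop A g x0 \<tau> \<eta> \<kappa> \<delta> z \<alpha>)"

definition rg_kappa :: "('a::real_inner \<Rightarrow> 'a) \<Rightarrow> real \<Rightarrow> real \<Rightarrow> real" where
  "rg_kappa A \<alpha>0 \<delta> = sqrt (8 * \<bar>ln (1 / \<delta>)\<bar> / eff_dim A \<alpha>0)"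

section \<open>Solution classes and root mean square error\<close>

definition source_set :: "('a::real_inner \<Rightarrow> 'a) \<Rightarrow> (real \<Rightarrow> real) \<Rightarrow> 'a set" where
  "source_set A \<psi> = {x. \<exists>v. norm v \<le> 1 \<and> x = op_fun A \<psi> v}"

definition tail_condition ::
    "('a::real_inner \<Rightarrow> 'a) \<Rightarrow> (real \<Rightarrow> real \<Rightarrow> real) \<Rightarrow> real \<Rightarrow> real \<Rightarrow> real \<Rightarrow> 'a \<Rightarrow> bool" where
  "tail_condition A g c1 c2 t0 w \<longleftrightarrow>
     (\<forall>\<alpha>\<in>{0<..t0}.
        measure (spectral_measure A w) {0..<\<alpha>}
          \<le> c1\<^sup>2 * (\<integral>t\<in>{c2 * \<alpha>..}. (residual g \<alpha> t)\<^sup>2 \<partial>spectral_measure A w))"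

text \<open>\<open>(\<E>\<parallel>F\<parallel>\<^sup>2)\<^sup>1\<^sup>/\<^sup>2\<close> with values in \<open>[0, \<infinity>]\<close>, so that a bound includes finiteness of the
  second moment and a supremum is unproblematic.\<close>

definition rms_norm :: "'w measure \<Rightarrow> ('w \<Rightarrow> 'a::real_normed_vector) \<Rightarrow> ennreal" where
  "rms_norm M F =
     (let e = \<integral>\<^sup>+\<omega>. ennreal ((norm (F \<omega>))\<^sup>2) \<partial>M
      in if e = \<infinity> then \<infinity> else ennreal (sqrt (enn2real e)))"

end

theory Submission
  imports Defs
begin

text \<open>All operators \<open>f(A)\<close> are diagonal in an orthonormal eigenbasis of \<open>A\<close>, so that norm estimates reduce to
  comparing functions on the spectrum. Write \<open>\<alpha>\<^sub>*\<close> for the balancing parameter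
  \<open>\<Theta>(\<alpha>\<^sub>*) \<psi>(\<alpha>\<^sub>*) = \<delta> (1 + \<surd>L)\<close> with \<open>L = \<bar>ln (1 / \<delta>)\<bar>\<close>, and call a grid point \<open>\<alpha>\<close> good if
  \<open>\<parallel>s\<^sub>\<alpha>(A) \<zeta>\<parallel>\<close> and \<open>\<surd>\<alpha> \<parallel>(A + \<alpha>)\<^sup>-\<^sup>1\<^sup>/\<^sup>2 \<zeta>\<parallel>\<close> are at most a multiple of \<open>(1 + \<kappa>) \<surd>(\<alpha> \<N>(\<alpha>))\<close>.
  On good grid points the rule is deterministic. As it did not stop at \<open>\<alpha>\<^sub>R\<^sub>G / q\<close>, the qualification gives
  \<open>\<Theta>(\<alpha>\<^sub>R\<^sub>G) \<ge> c \<Theta>(\<alpha>\<^sub>*)\<close>, which bounds the noise by \<open>C \<psi>(\<alpha>\<^sub>*)\<close>. The bias is at most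
  \<open>C \<psi>(\<alpha>\<^sub>*)\<close> by the qualification if \<open>\<alpha>\<^sub>R\<^sub>G \<le> \<alpha>\<^sub>*\<close>, and by the stopping inequality and the tail condition otherwise.

  The bad event has probability \<open>O((1 + L) \<delta>\<^sup>8)\<close>: the rule makes \<open>O(1 + L)\<close> steps, and at each of them
  the Laplace transform of the Gaussian quadratic form gives \<open>exp (- \<kappa>\<^sup>2 \<N>(\<alpha>)) \<le> exp (- 8 L)\<close>. There
  the error is at most \<open>Z = C (1 + \<parallel>\<zeta>\<parallel>) / \<delta>\<close>, and \<open>Z\<^sup>2 \<le> \<delta>\<^sup>6 Z\<^sup>4 + \<delta>\<^sup>-\<^sup>6\<close> shows that the contribution to
  the mean square error is \<open>O((1 + L) \<delta>\<^sup>2)\<close>, which is \<open>O(\<psi>(\<alpha>\<^sub>*)\<^sup>2)\<close>.\<close>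

section \<open>Hilbert space geometry\<close>

text \<open>The parameter selected by the rule depends on the noise, so bounds at one fixed
  parameter do not apply to it; the noise must be controlled at all parameters that can be reached.
  Two features of the rule make such a union bound affordable. Its second alternative forces
  stopping once alpha <= N(alpha0) eta^2 delta^2. And kappa is built with N(alpha0), the smallest
  effective dimension on the grid, so that kappa^2 N(alpha) >= 8 L at every grid point. The 8 is
  what the crude bound costs: delta^8 against the weight delta^-6 leaves delta^2, and delta^6 Z^4 is
  of the same order. The logarithm is harmless because delta^2 (1 + L) is at most the square of the
  balanced value delta (1 + sqrt L). The error is not shown to be measurable in the noise; it is
  majorized pointwise by measurable functions, and these are integrated. Bases may be uncountable,
  so series are unordered sums; the finite trace leaves countably many positive eigenvalues, as the
  limit theorems of integration require.\<close>

lemma orth_proj_exists: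
  fixes S :: "'a::{real_inner, complete_space} set"
  assumes "subspace S" "closed S"
  shows "\<exists>p\<in>S. \<forall>s\<in>S. orthogonal (x - p) s"
proof -
  define d where "d = infdist x S"
  have ne: "S \<noteq> {}" using assms(1) subspace_0 by auto
  have d0: "0 \<le> d" by (simp add: d_def infdist_nonneg)
  have dle: "d \<le> dist x y" if "y \<in> S" for y using that by (simp add: d_def infdist_le)
  have "\<exists>y\<in>S. (dist x y)\<^sup>2 < d\<^sup>2 + 1 / Suc n" for n
  proof (rule ccontr)
    assume neg: "\<not> ?thesis"
    have "sqrt (d\<^sup>2 + 1 / Suc n) \<le> dist x y" if "y \<in> S" for y
      using neg that by (intro real_le_lsqrt) (auto simp: not_less)
    then have "sqrt (d\<^sup>2 + 1 / Suc n) \<le> d"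
      unfolding d_def infdist_def using ne by (auto intro!: cINF_greatest)
    then have "d\<^sup>2 + 1 / Suc n \<le> d\<^sup>2"
      using d0 real_sqrt_le_iff[of _ "d\<^sup>2"] by (metis abs_of_nonneg real_sqrt_abs)
    then show False by simp
  qed
  then obtain y where yS: "\<And>n. y n \<in> S" and yd: "\<And>n. (dist x (y n))\<^sup>2 < d\<^sup>2 + 1 / Suc n"
    by metis
  \<comment> \<open>Parallelogram law: the midpoint of \<open>y m\<close> and \<open>y n\<close>
    lies in \<open>S\<close>, hence at distance at least \<open>d\<close> from
    \<open>x\<close>.\<close>
  have dy: "(dist (y m) (y n))\<^sup>2 \<le> 2 / Suc m + 2 / Suc n" for m n
  proof -
    have "(1/2) *\<^sub>R (y m + y n) \<in> S" using assms(1) yS by (simp add: subspace_add subspace_scale)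
    then have "d\<^sup>2 \<le> (dist x ((1/2) *\<^sub>R (y m + y n)))\<^sup>2" using dle d0 by (simp add: power_mono)
    then have "4 * d\<^sup>2 \<le> 4 * ((x - (1/2) *\<^sub>R (y m + y n)) \<bullet> (x - (1/2) *\<^sub>R (y m + y n)))"
      by (simp add: dist_norm power2_norm_eq_inner)
    then have "(dist (y m) (y n))\<^sup>2 \<le> 2 * (dist x (y m))\<^sup>2 + 2 * (dist x (y n))\<^sup>2 - 4 * d\<^sup>2"
      by (simp add: dist_norm power2_norm_eq_inner inner_simps inner_commute algebra_simps)
    moreover have "2 / real (Suc k) = 2 * (1 / real (Suc k))" for k by simp
    ultimately show ?thesis using yd[of m] yd[of n] by (smt (verit))
  qed
  have "Cauchy y"
  proof (rule metric_CauchyI)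
    fix e :: real assume "0 < e"
    then obtain K where K: "4 / e\<^sup>2 < real K" using reals_Archimedean2 by blast
    have "dist (y m) (y n) < e" if "m \<ge> K" "n \<ge> K" for m n
    proof -
      have K0: "0 < real K" using K \<open>0 < e\<close> by (smt (verit) divide_pos_pos zero_less_power)
      have "2 / Suc m \<le> 2 / real K" "2 / Suc n \<le> 2 / real K"
        using that K0 by (auto intro!: divide_left_mono)
      then have "(dist (y m) (y n))\<^sup>2 \<le> 4 / real K" using dy[of m n] by simp
      also have "\<dots> < e\<^sup>2" using K K0 \<open>0 < e\<close> by (simp add: field_simps)
      finally show ?thesis using \<open>0 < e\<close> by (simp add: power2_less_imp_less)
    qed
    then show "\<exists>M. \<forall>m\<ge>M. \<forall>n\<ge>M. dist (y m) (y n) < e" by blast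
  qed
  then obtain p where p: "y \<longlonglongrightarrow> p" using Cauchy_convergent convergent_def by blast
  have pS: "p \<in> S" using closed_sequentially[OF assms(2) _ p] yS by auto
  have "(\<lambda>n. (dist x (y n))\<^sup>2) \<longlonglongrightarrow> (dist x p)\<^sup>2" by (intro tendsto_intros p)
  moreover have "(\<lambda>n. d\<^sup>2 + 1 / Suc n) \<longlonglongrightarrow> d\<^sup>2 + 0"
    by (intro tendsto_intros LIMSEQ_Suc[OF lim_1_over_n])
  ultimately have pd: "(dist x p)\<^sup>2 \<le> d\<^sup>2"
    using yd by (intro LIMSEQ_le[where Y="\<lambda>n. d\<^sup>2 + 1 / Suc n"]) (auto intro: less_imp_le)
  have "orthogonal (x - p) s" if s: "s \<in> S" for s
  proof (cases "s = 0")
    case False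
    \<comment> \<open>\<open>c\<close> minimizes the distance from \<open>x\<close> to the line
      through \<open>p\<close> with direction \<open>s\<close>; a nonzero inner product would yield
      a distance below \<open>d\<close>.\<close>
    define c where "c = ((x - p) \<bullet> s) / (s \<bullet> s)"
    have "p + c *\<^sub>R s \<in> S" using pS s assms(1) by (simp add: subspace_add subspace_scale)
    then have "d\<^sup>2 \<le> (dist x (p + c *\<^sub>R s))\<^sup>2" using dle d0 by (simp add: power_mono)
    also have "\<dots> = (dist x p)\<^sup>2 - 2 * c * ((x - p) \<bullet> s) + c\<^sup>2 * (s \<bullet> s)"
      unfolding dist_norm power2_norm_eq_inner
      by (simp add: inner_simps inner_commute algebra_simps power2_eq_square)
    also have "\<dots> = (dist x p)\<^sup>2 - ((x - p) \<bullet> s)\<^sup>2 / (s \<bullet> s)"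
      using False by (simp add: c_def power2_eq_square field_simps)
    finally have "((x - p) \<bullet> s)\<^sup>2 / (s \<bullet> s) \<le> 0" using pd by simp
    then have "((x - p) \<bullet> s)\<^sup>2 \<le> 0"
      using False by (metis divide_le_0_iff inner_gt_zero_iff not_le)
    then show ?thesis by (simp add: orthogonal_def)
  qed (simp add: orthogonal_def)
  then show ?thesis using pS by blast
qed

lemma orth_proj_eqI:
  fixes p :: "'a::real_inner"
  assumes "subspace S" "p \<in> S" "\<And>s. s \<in> S \<Longrightarrow> (x - p) \<bullet> s = 0"
  shows "orth_proj S x = p"
  unfolding orth_proj_def
proof (rule the_equality)
  fix p' assume p': "p' \<in> S \<and> (\<forall>s\<in>S. orthogonal (x - p') s)"
  have "p' - p \<in> S" using assms p' by (simp add: subspace_diff)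
  then have "(x - p) \<bullet> (p' - p) = 0" "(x - p') \<bullet> (p' - p) = 0"
    using assms(3) p' by (auto simp: orthogonal_def)
  then have "(p' - p) \<bullet> (p' - p) = 0" by (simp add: inner_simps)
  then show "p' = p" by simp
qed (use assms in \<open>auto simp: orthogonal_def\<close>)

lemma orth_proj:
  fixes S :: "'a::{real_inner, complete_space} set"
  assumes "subspace S" "closed S"
  shows "orth_proj S x \<in> S" and "s \<in> S \<Longrightarrow> orth_proj S x \<bullet> s = x \<bullet> s"
proof -
  obtain p where p: "p \<in> S" "\<And>s. s \<in> S \<Longrightarrow> (x - p) \<bullet> s = 0"
    using orth_proj_exists[OF assms, of x] unfolding orthogonal_def by blast
  then have eq: "orth_proj S x = p" by (intro orth_proj_eqI[OF assms(1)])
  show "orth_proj S x \<in> S" using p eq by simp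
  show "s \<in> S \<Longrightarrow> orth_proj S x \<bullet> s = x \<bullet> s" using p(2)[of s] eq by (simp add: inner_simps)
qed

lemma exists_orthogonal_to_closed_subspace:
  fixes S :: "'a::{real_inner, complete_space} set"
  assumes "subspace S" "closed S" "S \<noteq> UNIV"
  shows "\<exists>v. v \<noteq> 0 \<and> (\<forall>s\<in>S. v \<bullet> s = 0)"
proof -
  obtain x where "x \<notin> S" using assms(3) by blast
  moreover obtain p where "p \<in> S" "\<forall>s\<in>S. (x - p) \<bullet> s = 0"
    using orth_proj_exists[OF assms(1,2), of x] unfolding orthogonal_def by blast
  ultimately show ?thesis by (intro exI[of _ "x - p"]) auto
qed

text \<open>The kernel is closed, and \<open>f\<close> is fixed by its value at one vector
  orthogonal to it; rescaling that vector gives the representer.\<close>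

lemma riesz_representation:
  fixes f :: "'a::{real_inner, complete_space} \<Rightarrow> real"
  assumes "bounded_linear f"
  shows "\<exists>z. \<forall>x. f x = x \<bullet> z"
proof (cases "f = (\<lambda>_. 0)")
  case False
  interpret bounded_linear f by fact
  define S where "S = {x. f x = 0}"
  have "subspace S" by (auto simp: S_def subspace_def zero add scale)
  moreover have "closed S"
    unfolding S_def by (intro closed_Collect_eq continuous_on continuous_on_const continuous_on_id)
  moreover have "S \<noteq> UNIV" using False by (auto simp: S_def)
  ultimately obtain v where v: "v \<noteq> 0" "\<And>s. f s = 0 \<Longrightarrow> v \<bullet> s = 0"
    using exists_orthogonal_to_closed_subspace[of S] by (auto simp: S_def)
  have fv: "f v \<noteq> 0" using v by (metis inner_eq_zero_iff)
  have "f x = x \<bullet> ((f v / (v \<bullet> v)) *\<^sub>R v)" for x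
  proof -
    have "f (x - (f x / f v) *\<^sub>R v) = 0" using fv by (simp add: diff scale)
    then have "v \<bullet> (x - (f x / f v) *\<^sub>R v) = 0" by (rule v)
    then show ?thesis using fv v(1) by (simp add: inner_simps inner_commute field_simps)
  qed
  then show ?thesis by blast
qed (auto intro: exI[of _ 0])

text \<open>\<open>adjoint\<close> is defined by choice, so its identity holds only once a witness
  exists; the Riesz representers of \<open>T x \<bullet> y\<close>, one for each \<open>y\<close>,
  provide it.\<close>

lemma inner_adjoint:
  fixes T :: "'a::{real_inner, complete_space} \<Rightarrow> 'b::real_inner"
  assumes "bounded_linear T"
  shows "T x \<bullet> y = x \<bullet> adjoint T y"
proof -
  have "\<exists>z. \<forall>x. T x \<bullet> y = x \<bullet> z" for y
    using riesz_representation[of "\<lambda>x. T x \<bullet> y"] assms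
      bounded_linear_compose[OF bounded_linear_inner_left assms] by blast
  then obtain f' where f': "\<forall>x y. T x \<bullet> y = x \<bullet> f' y" by metis
  then have "\<forall>x y. T x \<bullet> y = x \<bullet> adjoint T y"
    unfolding adjoint_def by (rule someI[where P="\<lambda>f'. \<forall>x y. T x \<bullet> y = x \<bullet> f' y"])
  then show ?thesis by blast
qed

section \<open>Orthogonal series\<close>

lemma norm_sum_orthogonal:
  fixes v :: "'i \<Rightarrow> 'a::real_inner"
  assumes "finite F" "\<And>i j. i \<in> F \<Longrightarrow> j \<in> F \<Longrightarrow> i \<noteq> j \<Longrightarrow> v i \<bullet> v j = 0"
  shows "(norm (sum v F))\<^sup>2 = (\<Sum>i\<in>F. (norm (v i))\<^sup>2)"
  using assms
proof (induction F rule: finite_induct)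
  case (insert i F)
  have "v i \<bullet> sum v F = 0" unfolding inner_sum_right using insert by (intro sum.neutral) auto
  then have "(norm (v i + sum v F))\<^sup>2 = (norm (v i))\<^sup>2 + (norm (sum v F))\<^sup>2"
    by (simp add: power2_norm_eq_inner inner_simps inner_commute)
  then show ?case using insert by auto
qed simp

text \<open>By Pythagoras, a finite sum over indices outside a large finite set \<open>G\<close> has
  as squared norm a tail of a convergent series of reals, so the net of finite sums is Cauchy. Such
  a series need not converge absolutely.\<close>

lemma orthogonal_summable_on:
  fixes v :: "'i \<Rightarrow> 'a::{real_inner, complete_space}"
  assumes orth: "\<And>i j. i \<in> I \<Longrightarrow> j \<in> I \<Longrightarrow> i \<noteq> j \<Longrightarrow> v i \<bullet> v j = 0"
    and summ: "(\<lambda>i. (norm (v i))\<^sup>2) summable_on I"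
  shows "v summable_on I"
proof -
  define n where "n i = (norm (v i))\<^sup>2" for i
  obtain S where S: "(n has_sum S) I" using summ unfolding n_def summable_on_def by blast
  have n0: "n i \<ge> 0" for i by (simp add: n_def)
  have "\<exists>P. eventually P (finite_subsets_at_top I) \<and>
              (\<forall>F F'. P F \<and> P F' \<longrightarrow> dist (sum v F) (sum v F') < e)" if "e > 0" for e
  proof -
    define d where "d = (e/2)\<^sup>2"
    have "d > 0" using that by (simp add: d_def)
    then obtain G where G: "finite G" "G \<subseteq> I" "dist (sum n G) S \<le> d / 2"
      using has_sum_finite_approximation[OF S, of "d/2"] by auto
    define P where "P F \<longleftrightarrow> finite F \<and> F \<subseteq> I \<and> G \<subseteq> F" for F
    have small: "norm (sum v H) < e / 2" if H: "finite H" "H \<subseteq> I" "H \<inter> G = {}" for H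
    proof -
      have "sum n (H \<union> G) \<le> S"
        by (rule finite_sum_le_has_sum[OF S]) (use H G n0 in auto)
      moreover have "sum n (H \<union> G) = sum n H + sum n G"
        using H G by (simp add: sum.union_disjoint)
      ultimately have "sum n H < d" using G(3) \<open>d > 0\<close> unfolding dist_real_def by linarith
      moreover have "(norm (sum v H))\<^sup>2 = sum n H"
        unfolding n_def using H by (intro norm_sum_orthogonal) (auto intro!: orth)
      ultimately have "(norm (sum v H))\<^sup>2 < (e / 2)\<^sup>2" unfolding d_def by simp
      then show ?thesis by (rule power2_less_imp_less) (use \<open>e > 0\<close> in simp)
    qed
    have "dist (sum v F) (sum v F') < e" if "P F" "P F'" for F F'
    proof -
      have F: "sum v F = sum v (F \<inter> F') + sum v (F - F')"
        using that unfolding P_def by (intro sum.Int_Diff) simp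
      have F': "sum v F' = sum v (F \<inter> F') + sum v (F' - F)"
        using that unfolding P_def by (subst Int_commute, intro sum.Int_Diff) simp
      have "dist (sum v F) (sum v F') \<le> norm (sum v (F - F')) + norm (sum v (F' - F))"
        unfolding dist_norm F F' add_diff_cancel_left by (rule norm_triangle_ineq4)
      also have "\<dots> < e / 2 + e / 2"
        using that by (intro add_strict_mono small) (auto simp: P_def)
      finally show ?thesis by simp
    qed
    moreover have "eventually P (finite_subsets_at_top I)"
      unfolding eventually_finite_subsets_at_top P_def using G by blast
    ultimately show ?thesis by blast
  qed
  then have "cauchy_filter (filtermap (sum v) (finite_subsets_at_top I))"
    by (simp add: cauchy_filter_metric_filtermap)
  then obtain L where "(sum v \<longlongrightarrow> L) (finite_subsets_at_top I)"
    using complete_uniform[where S="UNIV::'a set"] complete_UNIV by (force simp add: filterlim_def)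
  then show ?thesis unfolding summable_on_def has_sum_def by blast
qed

lemma bessel_finite:
  fixes x :: "'a::real_inner"
  assumes "finite F" "pairwise orthogonal F" "\<And>e. e \<in> F \<Longrightarrow> norm e = 1"
  shows "(norm (x - (\<Sum>e\<in>F. (x \<bullet> e) *\<^sub>R e)))\<^sup>2 = (norm x)\<^sup>2 - (\<Sum>e\<in>F. (x \<bullet> e)\<^sup>2)"
proof -
  define p where "p = (\<Sum>e\<in>F. (x \<bullet> e) *\<^sub>R e)"
  have "(norm p)\<^sup>2 = (\<Sum>e\<in>F. (norm ((x \<bullet> e) *\<^sub>R e))\<^sup>2)"
    unfolding p_def using assms by (intro norm_sum_orthogonal) (auto simp: pairwise_def orthogonal_def)
  also have "\<dots> = (\<Sum>e\<in>F. (x \<bullet> e)\<^sup>2)" using assms by (intro sum.cong) (auto simp: power_mult_distrib)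
  finally have "(norm p)\<^sup>2 = (\<Sum>e\<in>F. (x \<bullet> e)\<^sup>2)" .
  moreover have "x \<bullet> p = (\<Sum>e\<in>F. (x \<bullet> e)\<^sup>2)"
    by (simp add: p_def inner_sum_right power2_eq_square)
  moreover have "(norm (x - p))\<^sup>2 = (norm x)\<^sup>2 - 2 * (x \<bullet> p) + (norm p)\<^sup>2"
    by (simp add: power2_norm_eq_inner inner_simps inner_commute)
  ultimately show ?thesis by (simp add: p_def)
qed

lemma bessel_inequality:
  fixes x :: "'a::real_inner"
  assumes "finite F" "pairwise orthogonal F" "\<And>e. e \<in> F \<Longrightarrow> norm e = 1"
  shows "(\<Sum>e\<in>F. (x \<bullet> e)\<^sup>2) \<le> (norm x)\<^sup>2"
  using bessel_finite[OF assms, of x] by (smt (verit) zero_le_power2)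

text \<open>Bessel gives one inequality. For the other, density of the span provides an
  \<open>s\<close> near \<open>x\<close> built from finitely many basis vectors, and the orthogonal
  projection onto their span is at least as near.\<close>

lemma parseval:
  fixes x :: "'a::real_inner"
  assumes E: "orthonormal_basis E"
  shows "((\<lambda>e. (x \<bullet> e)\<^sup>2) has_sum (norm x)\<^sup>2) E"
proof -
  have E': "pairwise orthogonal E" "\<And>e. e \<in> E \<Longrightarrow> norm e = 1" "closure (span E) = UNIV"
    using E by (auto simp: orthonormal_basis_def)
  have bes: "(\<Sum>e\<in>F. (x \<bullet> e)\<^sup>2) \<le> (norm x)\<^sup>2" if "finite F" "F \<subseteq> E" for F
    using that E' by (intro bessel_inequality) (auto intro: pairwise_subset)
  have "(\<lambda>e. (x \<bullet> e)\<^sup>2) summable_on E"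
    by (rule nonneg_bounded_partial_sums_imp_summable_on[where C="(norm x)\<^sup>2"])
       (use bes in \<open>auto intro!: eventually_finite_subsets_at_top_weakI\<close>)
  then obtain S where S: "((\<lambda>e. (x \<bullet> e)\<^sup>2) has_sum S) E" unfolding summable_on_def by blast
  have "S \<le> (norm x)\<^sup>2" by (rule has_sum_le_finite_sums[OF S]) (use bes in auto)
  moreover have "(norm x)\<^sup>2 \<le> S"
  proof (rule field_le_epsilon)
    fix e :: real assume "0 < e"
    have "x \<in> closure (span E)" using E' by simp
    then obtain s where s: "s \<in> span E" "dist s x < sqrt e"
      using \<open>0 < e\<close> closure_approachable[of x "span E"] real_sqrt_gt_0_iff by blast
    from s(1) obtain F r where F: "finite F" "F \<subseteq> E" and s_eq: "s = (\<Sum>a\<in>F. r a *\<^sub>R a)"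
      unfolding span_explicit by blast
    then have sF: "s \<in> span F" unfolding s_eq by (intro span_sum span_scale span_base)
    have F': "pairwise orthogonal F" "\<And>e. e \<in> F \<Longrightarrow> norm e = 1" using F E' pairwise_subset by auto
    define y where "y = x - (\<Sum>e\<in>F. (x \<bullet> e) *\<^sub>R e)"
    have yF: "y \<bullet> f = 0" if "f \<in> F" for f
    proof -
      have "(\<Sum>e\<in>F. (x \<bullet> e) *\<^sub>R e) \<bullet> f = (\<Sum>e\<in>F. if e = f then x \<bullet> f else 0)"
        unfolding inner_sum_left
        using F' that by (intro sum.cong) (auto simp: pairwise_def orthogonal_def dot_square_norm)
      then show ?thesis using that F by (simp add: y_def inner_simps)
    qed
    have "y \<bullet> t = 0" if "t \<in> span F" for t
      using that yF by (induction rule: span_induct_alt) (auto simp: inner_simps)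
    moreover have "x - y - s \<in> span F"
    proof -
      have "(\<Sum>e\<in>F. (x \<bullet> e) *\<^sub>R e) - s \<in> span F"
        by (intro span_diff span_sum span_scale span_base sF)
      then show ?thesis by (simp add: y_def)
    qed
    ultimately have 0: "y \<bullet> (x - y - s) = 0" by blast
    have "(norm (x - s))\<^sup>2 = (norm (y + (x - y - s)))\<^sup>2" by simp
    also have "\<dots> = (norm y)\<^sup>2 + (norm (x - y - s))\<^sup>2"
      using 0 by (simp only: power2_norm_eq_inner inner_add_left inner_add_right) (simp add: inner_commute)
    finally have "(norm y)\<^sup>2 \<le> (norm (x - s))\<^sup>2" by simp
    also have "\<dots> < e"
      using s(2) \<open>0 < e\<close> power_strict_mono[of "norm (x - s)" "sqrt e" 2]
      by (simp add: dist_norm norm_minus_commute)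
    finally have "(norm x)\<^sup>2 - (\<Sum>e\<in>F. (x \<bullet> e)\<^sup>2) < e"
      using bessel_finite[OF F(1) F', of x] by (simp add: y_def)
    moreover have "(\<Sum>e\<in>F. (x \<bullet> e)\<^sup>2) \<le> S" by (rule finite_sum_le_has_sum[OF S]) (use F in auto)
    ultimately show "(norm x)\<^sup>2 \<le> S + e" by simp
  qed
  ultimately show ?thesis using S by simp
qed

text \<open>Polarization of \<open>parseval\<close>.\<close>

lemma parseval_inner:
  fixes x y :: "'a::real_inner"
  assumes E: "orthonormal_basis E"
  shows "((\<lambda>e. (x \<bullet> e) * (y \<bullet> e)) has_sum (x \<bullet> y)) E"
proof -
  have "((\<lambda>e. (1/4) * (((x + y) \<bullet> e)\<^sup>2 - ((x - y) \<bullet> e)\<^sup>2)) has_sum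
     (1/4) * ((norm (x + y))\<^sup>2 - (norm (x - y))\<^sup>2)) E"
    using has_sum_add[OF parseval[OF E, of "x + y"] has_sum_uminusI[OF parseval[OF E, of "x - y"]]]
    by (intro has_sum_cmult_right) (simp add: has_sum_uminus)
  moreover have "(1/4) * ((norm (x + y))\<^sup>2 - (norm (x - y))\<^sup>2) = x \<bullet> y"
    by (simp add: power2_norm_eq_inner inner_simps inner_commute)
  moreover have "(1/4) * (((x + y) \<bullet> e)\<^sup>2 - ((x - y) \<bullet> e)\<^sup>2) = (x \<bullet> e) * (y \<bullet> e)" for e
    by (simp add: inner_simps power2_eq_square algebra_simps)
  ultimately show ?thesis by simp
qed

lemma orthonormal_basis_eqI:
  fixes x y :: "'a::real_inner"
  assumes E: "orthonormal_basis E" and eq: "\<And>e. e \<in> E \<Longrightarrow> x \<bullet> e = y \<bullet> e"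
  shows "x = y"
proof -
  have "((\<lambda>e. ((x - y) \<bullet> e)\<^sup>2) has_sum (norm (x - y))\<^sup>2) E" by (rule parseval[OF E])
  moreover have "((\<lambda>e. ((x - y) \<bullet> e)\<^sup>2) has_sum 0) E"
    by (rule has_sum_0) (use eq in \<open>auto simp: inner_simps\<close>)
  ultimately have "(norm (x - y))\<^sup>2 = 0" by (rule has_sum_unique)
  then show ?thesis by simp
qed

lemma norm_le_coordinatewise:
  fixes x y :: "'a::real_inner"
  assumes E: "orthonormal_basis E" and C: "0 \<le> C" "\<And>e. e \<in> E \<Longrightarrow> \<bar>x \<bullet> e\<bar> \<le> C * \<bar>y \<bullet> e\<bar>"
  shows "norm x \<le> C * norm y"
proof -
  have "(norm x)\<^sup>2 \<le> C\<^sup>2 * (norm y)\<^sup>2"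
  proof (rule has_sum_mono[OF parseval[OF E] has_sum_cmult_right[OF parseval[OF E]]])
    fix e assume "e \<in> E"
    then have "\<bar>x \<bullet> e\<bar>\<^sup>2 \<le> (C * \<bar>y \<bullet> e\<bar>)\<^sup>2" by (intro power_mono C) auto
    then show "(x \<bullet> e)\<^sup>2 \<le> C\<^sup>2 * (y \<bullet> e)\<^sup>2" by (simp add: power_mult_distrib)
  qed
  then have "(norm x)\<^sup>2 \<le> (C * norm y)\<^sup>2" by (simp add: power_mult_distrib)
  then show ?thesis using C(1) by (auto intro: power2_le_imp_le)
qed

section \<open>Diagonalization of \<open>T\<^sup>*T\<close>\<close>

lemma inner_adjoint_comp:
  fixes T :: "'a::{real_inner, complete_space} \<Rightarrow> 'b::real_inner"
  assumes "bounded_linear T"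
  shows "(adjoint T \<circ> T) x \<bullet> y = T x \<bullet> T y"
  using inner_adjoint[OF assms, of y "T x"] by (simp add: inner_commute)

lemma bounded_linear_adjoint:
  fixes T :: "'a::{real_inner, complete_space} \<Rightarrow> 'b::real_inner"
  assumes T: "bounded_linear T"
  shows "bounded_linear (adjoint T)"
proof -
  interpret T: bounded_linear T by fact
  note adj = inner_adjoint[OF T, symmetric]
  obtain K where K: "K > 0" "\<And>x. norm (T x) \<le> norm x * K" using T.pos_bounded by blast
  show ?thesis
  proof (rule bounded_linear_intro)
    show "adjoint T (y + z) = adjoint T y + adjoint T z" for y z
      by (rule vector_eq_ldot[THEN iffD1]) (simp add: adj inner_simps)
    show "adjoint T (r *\<^sub>R y) = r *\<^sub>R adjoint T y" for r y
      by (rule vector_eq_ldot[THEN iffD1]) (simp add: adj inner_simps)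
    show "norm (adjoint T y) \<le> norm y * K" for y
    proof (cases "adjoint T y = 0")
      case False
      have "norm (adjoint T y) * norm (adjoint T y) = T (adjoint T y) \<bullet> y"
        by (metis inner_adjoint[OF T] power2_norm_eq_inner power2_eq_square)
      also have "\<dots> \<le> norm (T (adjoint T y)) * norm y" by (rule norm_cauchy_schwarz)
      also have "\<dots> \<le> norm (adjoint T y) * K * norm y" by (intro mult_right_mono K) simp
      finally show ?thesis using False by (simp add: mult.assoc mult.commute)
    qed (use K(1) in simp)
  qed
qed

text \<open>Maximize \<open>norm (T v)\<close> on the unit sphere of \<open>V\<close>. Compactness
  makes only \<open>T (x n)\<close> converge along a subsequence; that \<open>x n\<close> converges
  follows from A x - m x -> 0 and m > 0. The subspace \<open>V\<close> is meant for the orthogonal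
  complement of eigenvectors already found.\<close>

lemma exists_eigenvector:
  fixes T :: "'a::{real_inner, complete_space} \<Rightarrow> 'b::{real_inner, complete_space}"
  assumes T: "compact_op T" and A: "A = adjoint T \<circ> T"
    and V: "subspace V" "closed V" "\<And>v. v \<in> V \<Longrightarrow> A v \<in> V" and v0: "v0 \<in> V" "v0 \<noteq> 0"
  shows "\<exists>e\<in>V. norm e = 1 \<and> A e = (e \<bullet> A e) *\<^sub>R e"
proof -
  have Tbl: "bounded_linear T" and Tc: "compact (closure (T ` cball 0 1))"
    using T by (auto simp: compact_op_def)
  interpret T: bounded_linear T by fact
  interpret T': bounded_linear "adjoint T" using bounded_linear_adjoint[OF Tbl] .
  have AT: "A x \<bullet> y = T x \<bullet> T y" for x y unfolding A by (rule inner_adjoint_comp[OF Tbl])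
  obtain K where K: "K > 0" "\<And>x. norm (T x) \<le> norm x * K" using T.pos_bounded by blast
  define Q where "Q = (\<lambda>v. (norm (T v))\<^sup>2) ` {v\<in>V. norm v = 1}"
  define m where "m = Sup Q"
  define u where "u = (1 / norm v0) *\<^sub>R v0"
  have u: "u \<in> V" "norm u = 1" using v0 V(1) by (auto simp: u_def subspace_scale)
  have "q \<le> K\<^sup>2" if "q \<in> Q" for q
  proof -
    from that obtain v where "norm v = 1" "q = (norm (T v))\<^sup>2" by (auto simp: Q_def)
    then show ?thesis using K(2)[of v] by (simp add: power_mono)
  qed
  then have bdd: "bdd_above Q" by (rule bdd_aboveI)
  have ne: "Q \<noteq> {}" using u by (auto simp: Q_def)
  have le_m1: "(norm (T v))\<^sup>2 \<le> m" if "v \<in> V" "norm v = 1" for v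
    unfolding m_def by (rule cSup_upper[OF _ bdd]) (use that in \<open>auto simp: Q_def\<close>)
  have m0: "0 \<le> m" using le_m1[OF u] by (meson order_trans zero_le_power2)
  have le_m: "(norm (T v))\<^sup>2 \<le> m * (norm v)\<^sup>2" if "v \<in> V" for v
  proof (cases "v = 0")
    case False
    have "(norm (T ((1 / norm v) *\<^sub>R v)))\<^sup>2 \<le> m"
      using that False V(1) by (intro le_m1) (auto simp: subspace_scale)
    then show ?thesis using False by (simp add: T.scaleR power_divide field_simps)
  qed (simp add: T.zero)
  show ?thesis
  proof (cases "m = 0")
    case True
    then have "T u = 0" using le_m1[OF u] by simp
    then have "A u = 0" by (simp add: A T'.zero)
    then show ?thesis using u by (intro bexI[of _ u]) auto
  next
    case False
    then have mpos: "0 < m" using m0 by simp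
    have "\<exists>v\<in>V. norm v = 1 \<and> m - 1 / Suc n < (norm (T v))\<^sup>2" for n
      using less_cSup_iff[OF ne bdd, of "m - 1 / Suc n"] by (auto simp: m_def Q_def)
    then obtain x where x: "\<And>n. x n \<in> V" "\<And>n. norm (x n) = 1"
      "\<And>n. m - 1 / Suc n < (norm (T (x n)))\<^sup>2" by metis
    have "\<forall>n. T (x n) \<in> closure (T ` cball 0 1)"
    proof
      fix n
      have "T (x n) \<in> T ` cball 0 1" by (rule imageI) (simp add: x(2))
      then show "T (x n) \<in> closure (T ` cball 0 1)" by (rule subsetD[OF closure_subset])
    qed
    with compact_imp_seq_compact[OF Tc] obtain y r where "y \<in> closure (T ` cball 0 1)"
      and r: "strict_mono r" "((\<lambda>n. T (x n)) \<circ> r) \<longlonglongrightarrow> y"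
      by (rule seq_compactE[where f="\<lambda>n. T (x n)"])
    \<comment> \<open>Cauchy-Schwarz for \<open>T v\<close> and \<open>T (A v)\<close>, with
      \<open>le_m\<close> at \<open>A v\<close>, which lies in \<open>V\<close> by invariance,
      bounds the squared norm of \<open>A v\<close> by m times that of \<open>T v\<close>; expanding
      the square leaves m times the defect of the maximizing sequence.\<close>
    have near: "(norm (A (x n) - m *\<^sub>R x n))\<^sup>2 \<le> m / Suc n" for n
    proof -
      let ?v = "x n"
      have "(norm (A ?v))\<^sup>2 \<le> m * (norm (T ?v))\<^sup>2"
      proof (cases "A ?v = 0")
        case False
        have "((norm (A ?v))\<^sup>2)\<^sup>2 = (T ?v \<bullet> T (A ?v))\<^sup>2"
          by (simp add: power2_norm_eq_inner AT)
        also have "\<dots> \<le> (norm (T ?v))\<^sup>2 * (norm (T (A ?v)))\<^sup>2"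
          by (metis Cauchy_Schwarz_ineq power2_norm_eq_inner)
        also have "\<dots> \<le> (norm (T ?v))\<^sup>2 * (m * (norm (A ?v))\<^sup>2)"
          by (intro mult_left_mono le_m V x) auto
        finally show ?thesis using False by (simp add: power2_eq_square mult_ac)
      qed (use m0 in simp)
      moreover have "(norm (A ?v - m *\<^sub>R ?v))\<^sup>2 = (norm (A ?v))\<^sup>2 - 2 * m * (A ?v \<bullet> ?v) + m\<^sup>2 * (norm ?v)\<^sup>2"
        unfolding power2_norm_eq_inner by (simp add: inner_simps inner_commute power2_eq_square algebra_simps)
      moreover have "A ?v \<bullet> ?v = (norm (T ?v))\<^sup>2" by (simp add: AT power2_norm_eq_inner)
      ultimately have "(norm (A ?v - m *\<^sub>R ?v))\<^sup>2 \<le> m * (m - (norm (T ?v))\<^sup>2)"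
        by (simp add: x(2) power2_eq_square algebra_simps)
      also have "\<dots> \<le> m * (1 / Suc n)" using x(3)[of n] m0 by (intro mult_left_mono) auto
      finally show ?thesis by simp
    qed
    have lim0: "(\<lambda>n. m / Suc n) \<longlonglongrightarrow> 0"
      using tendsto_mult_right_zero[OF LIMSEQ_Suc[OF lim_1_over_n], of m] by simp
    have "(\<lambda>n. (norm (A (x n) - m *\<^sub>R x n))\<^sup>2) \<longlonglongrightarrow> 0"
      by (rule tendsto_sandwich[of "\<lambda>_. 0" _ _ "\<lambda>n. m / Suc n", OF _ _ tendsto_const lim0])
         (simp_all add: near del: of_nat_Suc)
    then have "(\<lambda>n. sqrt ((norm (A (x n) - m *\<^sub>R x n))\<^sup>2)) \<longlonglongrightarrow> sqrt 0" by (rule tendsto_real_sqrt)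
    then have "(\<lambda>n. A (x n) - m *\<^sub>R x n) \<longlonglongrightarrow> 0" by (simp add: tendsto_norm_zero_iff)
    then have l1: "(\<lambda>n. A (x (r n)) - m *\<^sub>R x (r n)) \<longlonglongrightarrow> 0"
      using LIMSEQ_subseq_LIMSEQ[OF _ r(1)] unfolding o_def by blast
    have l2: "(\<lambda>n. A (x (r n))) \<longlonglongrightarrow> adjoint T y"
      using T'.tendsto[OF r(2)[unfolded o_def]] by (simp add: A)
    define e where "e = (1 / m) *\<^sub>R adjoint T y"
    have "(\<lambda>n. (1 / m) *\<^sub>R (A (x (r n)) - (A (x (r n)) - m *\<^sub>R x (r n)))) \<longlonglongrightarrow> (1 / m) *\<^sub>R (adjoint T y - 0)"
      by (intro tendsto_intros l1 l2)
    then have lx: "(\<lambda>n. x (r n)) \<longlonglongrightarrow> e" using mpos by (simp add: e_def)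
    have eV: "e \<in> V" by (rule closed_sequentially[OF V(2) _ lx]) (rule x(1))
    have "(\<lambda>n. norm (x (r n))) \<longlonglongrightarrow> norm e" by (rule tendsto_norm[OF lx])
    then have ne: "norm e = 1" by (simp add: x(2) LIMSEQ_const_iff)
    have "(\<lambda>n. A (x (r n))) \<longlonglongrightarrow> A e" unfolding A o_def by (rule T'.tendsto[OF T.tendsto[OF lx]])
    then have "A e = adjoint T y" using l2 by (rule LIMSEQ_unique)
    then have Ae: "A e = m *\<^sub>R e" using mpos by (simp add: e_def)
    have "e \<bullet> A e = m" by (simp add: Ae ne flip: power2_norm_eq_inner)
    then show ?thesis using eV ne Ae by (intro bexI[of _ e]) simp_all
  qed
qed

lemma subspace_closure:
  fixes S :: "'a::real_normed_vector set"
  assumes "subspace S"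
  shows "subspace (closure S)"
  unfolding subspace_def
proof (intro conjI ballI allI)
  show "0 \<in> closure S" by (rule subsetD[OF closure_subset subspace_0[OF assms]])
next
  fix x y assume "x \<in> closure S" "y \<in> closure S"
  then obtain f g where "\<forall>n. f n \<in> S" "f \<longlonglongrightarrow> x" "\<forall>n. g n \<in> S" "g \<longlonglongrightarrow> y"
    unfolding closure_sequential by blast
  then have "\<forall>n. f n + g n \<in> S" "(\<lambda>n. f n + g n) \<longlonglongrightarrow> x + y"
    using assms by (auto intro: subspace_add tendsto_add)
  then show "x + y \<in> closure S" unfolding closure_sequential by (intro exI[of _ "\<lambda>n. f n + g n"] conjI)
next
  fix c x assume "x \<in> closure S"
  then obtain f where "\<forall>n. f n \<in> S" "f \<longlonglongrightarrow> x" unfolding closure_sequential by blast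
  then have "\<forall>n. c *\<^sub>R f n \<in> S" "(\<lambda>n. c *\<^sub>R f n) \<longlonglongrightarrow> c *\<^sub>R x"
    using assms by (auto intro: subspace_scale tendsto_scaleR)
  then show "c *\<^sub>R x \<in> closure S" unfolding closure_sequential by (intro exI[of _ "\<lambda>n. c *\<^sub>R f n"] conjI)
qed

text \<open>Zorn's lemma for orthonormal sets of eigenvectors. If the span of a maximal set were not
  dense, its orthogonal complement would be a nonzero closed subspace, invariant because
  \<open>A\<close> is symmetric, and would contain a further eigenvector.\<close>

lemma exists_eigenbasis:
  fixes T :: "'a::{real_inner, complete_space} \<Rightarrow> 'b::{real_inner, complete_space}"
  assumes T: "compact_op T" and A: "A = adjoint T \<circ> T"
  shows "\<exists>E. orthonormal_basis E \<and> (\<forall>e\<in>E. A e = (e \<bullet> A e) *\<^sub>R e)"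
proof -
  have Tbl: "bounded_linear T" using T by (auto simp: compact_op_def)
  have sym: "A x \<bullet> y = x \<bullet> A y" for x y
    using inner_adjoint_comp[OF Tbl, of x y] inner_adjoint_comp[OF Tbl, of y x]
    by (simp add: A inner_commute)
  define \<C> where "\<C> = {F. pairwise orthogonal F \<and> (\<forall>e\<in>F. norm e = 1 \<and> A e = (e \<bullet> A e) *\<^sub>R e)}"
  have "\<exists>E\<in>\<C>. \<forall>X\<in>\<C>. E \<subseteq> X \<longrightarrow> X = E"
  proof (rule Zorn_Lemma, intro ballI)
    fix C assume C: "C \<in> chains \<C>"
    then have "pairwise orthogonal (\<Union>C)"
      by (intro pairwise_chain_Union) (auto simp: chains_def \<C>_def)
    moreover have "\<forall>e\<in>\<Union>C. norm e = 1 \<and> A e = (e \<bullet> A e) *\<^sub>R e"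
      using chainsD2[OF C] unfolding \<C>_def by blast
    ultimately show "\<Union>C \<in> \<C>" unfolding \<C>_def by blast
  qed
  then obtain E where E: "E \<in> \<C>" and max: "\<And>X. X \<in> \<C> \<Longrightarrow> E \<subseteq> X \<Longrightarrow> X = E" by blast
  have E': "pairwise orthogonal E" "\<And>e. e \<in> E \<Longrightarrow> norm e = 1" "\<And>e. e \<in> E \<Longrightarrow> A e = (e \<bullet> A e) *\<^sub>R e"
    using E by (auto simp: \<C>_def)
  have "closure (span E) = UNIV"
  proof (rule ccontr)
    assume "closure (span E) \<noteq> UNIV"
    then obtain v0 where v0: "v0 \<noteq> 0" "\<And>s. s \<in> closure (span E) \<Longrightarrow> v0 \<bullet> s = 0"
      using exists_orthogonal_to_closed_subspace[of "closure (span E)"] subspace_closure[OF subspace_span] by auto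
    define V where "V = (\<Inter>e\<in>E. {v. v \<bullet> e = 0})"
    have "subspace V" by (auto simp: V_def subspace_def inner_simps)
    moreover have "closed V" unfolding V_def
      by (intro closed_INT ballI closed_Collect_eq continuous_intros)
    moreover have "A v \<in> V" if "v \<in> V" for v
    proof -
      have "A v \<bullet> e = 0" if "e \<in> E" for e
        using \<open>v \<in> V\<close> that sym[of v e] E'(3)[OF that] by (metis (mono_tags, lifting) INT_D V_def inner_scaleR_right mem_Collect_eq mult_zero_right)
      then show ?thesis by (simp add: V_def)
    qed
    moreover have "v0 \<in> V"
      using v0(2)[OF subsetD[OF closure_subset span_base]] by (simp add: V_def)
    ultimately obtain e where e: "e \<in> V" "norm e = 1" "A e = (e \<bullet> A e) *\<^sub>R e"
      using exists_eigenvector[OF T A] v0(1) by blast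
    have "e \<notin> E" using e by (auto simp: V_def)
    moreover have "insert e E \<in> \<C>"
      using e E' by (auto simp: \<C>_def V_def pairwise_insert orthogonal_def inner_commute)
    ultimately show False using max[of "insert e E"] by blast
  qed
  then show ?thesis using E' unfolding orthonormal_basis_def by blast
qed

section \<open>Functional calculus in an eigenbasis\<close>

locale diagonal_operator =
  fixes A :: "'a::{real_inner, complete_space} \<Rightarrow> 'a" and E :: "'a set"
  assumes bounded_linear_A: "bounded_linear A"
    and A_sym: "A x \<bullet> y = x \<bullet> A y"
    and A_nonneg: "0 \<le> x \<bullet> A x"
    and basis: "orthonormal_basis E"
    and eigenbasis: "e \<in> E \<Longrightarrow> A e = (e \<bullet> A e) *\<^sub>R e"
begin

sublocale A: bounded_linear A by (rule bounded_linear_A)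

definition lam :: "'a \<Rightarrow> real" where "lam e = e \<bullet> A e"

lemma lam_nonneg: "0 \<le> lam e" by (simp add: lam_def A_nonneg)

lemma norm_basis: "e \<in> E \<Longrightarrow> norm e = 1" using basis by (auto simp: orthonormal_basis_def)

lemma basis_nonzero: "e \<in> E \<Longrightarrow> e \<noteq> 0" using norm_basis by force

lemma inner_basis: "e \<in> E \<Longrightarrow> e' \<in> E \<Longrightarrow> e \<bullet> e' = (if e = e' then 1 else 0)"
  using basis by (auto simp: orthonormal_basis_def pairwise_def orthogonal_def dot_square_norm)

lemma A_basis: "e \<in> E \<Longrightarrow> A e = lam e *\<^sub>R e" unfolding lam_def by (rule eigenbasis)

lemma A_inner: "e \<in> E \<Longrightarrow> A x \<bullet> e = lam e * (x \<bullet> e)"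
  by (simp add: A_sym A_basis)

lemma lam_le: "e \<in> E \<Longrightarrow> lam e \<le> onorm A"
  using onorm[OF bounded_linear_A, of e] norm_cauchy_schwarz[of e "A e"] by (simp add: lam_def norm_basis)

lemma eqI: "(\<And>e. e \<in> E \<Longrightarrow> x \<bullet> e = y \<bullet> e) \<Longrightarrow> x = y"
  by (rule orthonormal_basis_eqI[OF basis])

lemma eigenvalues_eq: "eigenvalues A = lam ` E"
proof (intro set_eqI iffI)
  fix l assume "l \<in> eigenvalues A"
  then obtain v where v: "A v = l *\<^sub>R v" "v \<noteq> 0"
    by (auto simp: eigenvalues_def eigenspace_def A.zero)
  then obtain e where e: "e \<in> E" "v \<bullet> e \<noteq> 0" using eqI[of v 0] by auto
  then have "lam e = l" using A_inner[of e v] v by simp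
  then show "l \<in> lam ` E" using e by blast
next
  fix l assume "l \<in> lam ` E"
  then obtain e where "e \<in> E" "l = lam e" by blast
  then have "e \<in> eigenspace A l" "e \<noteq> 0" by (auto simp: eigenspace_def A_basis basis_nonzero)
  then show "l \<in> eigenvalues A" by (auto simp: eigenvalues_def)
qed

lemma eigenspace: "subspace (eigenspace A l)" "closed (eigenspace A l)"
proof -
  show "subspace (eigenspace A l)"
    by (auto simp: eigenspace_def subspace_def A.zero A.add A.scale algebra_simps)
  show "closed (eigenspace A l)" unfolding eigenspace_def
    by (intro closed_Collect_eq A.continuous_on continuous_intros)
qed

lemma eigenspace_orthogonal:
  assumes "x \<in> eigenspace A l" "y \<in> eigenspace A k" "l \<noteq> k"
  shows "x \<bullet> y = 0"
  using assms A_sym[of x y] by (auto simp: eigenspace_def)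

text \<open>The bound is asked at the eigenvalues only, because \<open>g \<alpha>\<close> is
  arbitrary off the interval that contains them.\<close>

definition spec_bounded :: "(real \<Rightarrow> real) \<Rightarrow> real \<Rightarrow> bool" where
  "spec_bounded f B \<longleftrightarrow> (\<forall>e\<in>E. \<bar>f (lam e)\<bar> \<le> B)"

lemma spec_boundedI: "(\<And>t. 0 \<le> t \<Longrightarrow> t \<le> onorm A \<Longrightarrow> \<bar>f t\<bar> \<le> B) \<Longrightarrow> spec_bounded f B"
  by (auto simp: spec_bounded_def lam_nonneg lam_le)

lemma spec_boundedD: "spec_bounded f B \<Longrightarrow> e \<in> E \<Longrightarrow> \<bar>f (lam e)\<bar> \<le> B"
  by (auto simp: spec_bounded_def)

text \<open>Projections onto distinct eigenspaces are mutually orthogonal and satisfy Bessel's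
  inequality, so their bounded multiples are square summable.\<close>

lemma op_fun_has_sum:
  assumes f: "spec_bounded f B"
  shows "((\<lambda>l. f l *\<^sub>R orth_proj (eigenspace A l) x) has_sum op_fun A f x) (eigenvalues A)"
proof -
  define P where "P l = orth_proj (eigenspace A l) x" for l
  have P: "P l \<in> eigenspace A l" for l unfolding P_def by (rule orth_proj(1)[OF eigenspace])
  have Px: "x \<bullet> P l = (norm (P l))\<^sup>2" for l
    using orth_proj(2)[OF eigenspace P[of l]] by (simp add: power2_norm_eq_inner P_def)
  have PP: "P l \<bullet> P k = 0" if "l \<noteq> k" for l k using eigenspace_orthogonal[OF P P that] .
  have "(\<Sum>l\<in>L. (norm (P l))\<^sup>2) \<le> (norm x)\<^sup>2" if "finite L" for L
  proof -
    have "(norm (sum P L))\<^sup>2 = (\<Sum>l\<in>L. (norm (P l))\<^sup>2)"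
      by (rule norm_sum_orthogonal[OF that]) (rule PP)
    moreover have "\<dots> = x \<bullet> sum P L" by (simp add: inner_sum_right Px)
    moreover have "\<dots> \<le> norm x * norm (sum P L)" by (rule norm_cauchy_schwarz)
    ultimately have "norm (sum P L) \<le> norm x"
      by (metis mult_right_le_imp_le norm_ge_zero order_le_less power2_eq_square)
    then show ?thesis using \<open>(norm (sum P L))\<^sup>2 = _\<close> by (metis norm_ge_zero power_mono)
  qed
  then have "(\<lambda>l. (norm (P l))\<^sup>2) summable_on eigenvalues A"
    by (intro nonneg_bounded_partial_sums_imp_summable_on[where C="(norm x)\<^sup>2"])
       (auto intro!: eventually_finite_subsets_at_top_weakI)
  then have "(\<lambda>l. B\<^sup>2 * (norm (P l))\<^sup>2) summable_on eigenvalues A"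
    by (rule summable_on_cmult_right)
  then have "(\<lambda>l. (norm (f l *\<^sub>R P l))\<^sup>2) summable_on eigenvalues A"
  proof (rule summable_on_comparison_test)
    fix l assume "l \<in> eigenvalues A"
    then have "\<bar>f l\<bar> \<le> B" using f by (auto simp: eigenvalues_eq spec_boundedD)
    then have "\<bar>f l\<bar>\<^sup>2 \<le> B\<^sup>2" by (intro power_mono) auto
    then show "(norm (f l *\<^sub>R P l))\<^sup>2 \<le> B\<^sup>2 * (norm (P l))\<^sup>2"
      by (simp add: power_mult_distrib mult_right_mono)
  qed simp
  then have "(\<lambda>l. f l *\<^sub>R P l) summable_on eigenvalues A"
    by (rule orthogonal_summable_on[rotated]) (simp add: PP)
  then show ?thesis unfolding op_fun_def P_def by simp
qed

text \<open>Only the eigenspace that contains \<open>e\<close> contributes. This turns the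
  basis-free series of \<open>op_fun\<close> into multiplication of coordinates.\<close>

lemma op_fun_inner:
  assumes f: "spec_bounded f B" and e: "e \<in> E"
  shows "op_fun A f x \<bullet> e = f (lam e) * (x \<bullet> e)"
proof -
  define P where "P l = orth_proj (eigenspace A l) x" for l
  have ev: "e \<in> eigenspace A (lam e)" using e by (simp add: eigenspace_def A_basis)
  have 1: "P (lam e) \<bullet> e = x \<bullet> e"
    unfolding P_def by (rule orth_proj(2)[OF eigenspace ev])
  have 0: "P l \<bullet> e = 0" if "l \<noteq> lam e" for l
    using eigenspace_orthogonal[OF _ ev that] orth_proj(1)[OF eigenspace] unfolding P_def by blast
  have "((\<lambda>l. (f l *\<^sub>R P l) \<bullet> e) has_sum op_fun A f x \<bullet> e) (eigenvalues A)"
    unfolding P_def by (rule has_sum_bounded_linear[OF bounded_linear_inner_left op_fun_has_sum[OF f]])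
  moreover have "((\<lambda>l. (f l *\<^sub>R P l) \<bullet> e) has_sum f (lam e) * (x \<bullet> e)) (eigenvalues A)"
    by (rule has_sum_finite_neutralI[where B="{lam e}"]) (use e 0 1 in \<open>auto simp: eigenvalues_eq\<close>)
  ultimately show ?thesis by (rule has_sum_unique)
qed

lemma op_fun_norm_has_sum:
  assumes f: "spec_bounded f B"
  shows "((\<lambda>e. (f (lam e))\<^sup>2 * (x \<bullet> e)\<^sup>2) has_sum (norm (op_fun A f x))\<^sup>2) E"
proof -
  have "((\<lambda>e. (op_fun A f x \<bullet> e)\<^sup>2) has_sum (norm (op_fun A f x))\<^sup>2) E" by (rule parseval[OF basis])
  also have "?this \<longleftrightarrow> ?thesis"
    by (intro has_sum_cong) (simp add: op_fun_inner[OF f] power_mult_distrib)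
  finally show ?thesis .
qed

lemma norm_le_coord:
  assumes "0 \<le> C" "\<And>e. e \<in> E \<Longrightarrow> \<bar>x \<bullet> e\<bar> \<le> C * \<bar>y \<bullet> e\<bar>"
  shows "norm x \<le> C * norm y"
  by (rule norm_le_coordinatewise[OF basis assms])

lemma op_fun_diff:
  assumes f: "spec_bounded f B"
  shows "op_fun A f x - op_fun A f y = op_fun A f (x - y)"
  by (rule eqI) (simp add: inner_simps op_fun_inner[OF f] algebra_simps)

lemma norm_op_fun_le:
  assumes f: "spec_bounded f B" and B: "0 \<le> B"
  shows "norm (op_fun A f x) \<le> B * norm x"
  by (rule norm_le_coord[OF B]) (simp add: op_fun_inner[OF f] abs_mult mult_right_mono spec_boundedD[OF f])

lemma continuous_op_fun:
  assumes f: "spec_bounded f B"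
  shows "continuous_on UNIV (op_fun A f)"
proof (rule continuous_onI)
  fix x e assume "(0::real) < e"
  \<comment> \<open>\<open>B\<close> may be zero, or negative if the basis is empty; the enlarged
    bound is positive and can be divided by.\<close>
  have f': "spec_bounded f (\<bar>B\<bar> + 1)" using f by (force simp: spec_bounded_def)
  have "dist (op_fun A f x') (op_fun A f x) \<le> (\<bar>B\<bar> + 1) * dist x' x" for x'
    unfolding dist_norm op_fun_diff[OF f] by (rule norm_op_fun_le[OF f']) auto
  moreover have "(\<bar>B\<bar> + 1) * d < e" if "d < e / (\<bar>B\<bar> + 1)" for d
    using that by (simp add: pos_less_divide_eq mult.commute)
  ultimately show "\<exists>d>0. \<forall>x'\<in>UNIV. dist x' x < d \<longrightarrow> dist (op_fun A f x') (op_fun A f x) \<le> e"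
    using \<open>0 < e\<close> by (intro exI[of _ "e / (\<bar>B\<bar> + 1)"]) (auto, smt (verit))
qed

end

section \<open>Trace, effective dimension and spectral measure\<close>

text \<open>Tonelli's theorem for unordered sums of a nonnegative double family.\<close>

lemma has_sum_interchange:
  fixes M :: "'i \<Rightarrow> 'j \<Rightarrow> real"
  assumes nn: "\<And>i j. i \<in> I \<Longrightarrow> j \<in> J \<Longrightarrow> 0 \<le> M i j"
    and r: "\<And>i. i \<in> I \<Longrightarrow> (M i has_sum r i) J"
    and c: "\<And>j. j \<in> J \<Longrightarrow> ((\<lambda>i. M i j) has_sum c j) I"
    and S: "(r has_sum S) I"
  shows "(c has_sum S) J"
proof -
  have "case_prod M summable_on (I \<times> J)"
    by (rule summable_on_SigmaI[where g=r])
       (use nn r S in \<open>auto simp: summable_on_def\<close>)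
  then have "(case_prod M has_sum S) (I \<times> J)"
    by (intro has_sum_SigmaI[OF _ S]) (use r in auto)
  then have "((\<lambda>(j, i). M i j) has_sum S) (J \<times> I)" by (simp add: has_sum_swap[of _ I J])
  then show ?thesis by (rule has_sum_SigmaD) (use c in auto)
qed

lemma infsum_ennreal_eq:
  fixes f :: "'i \<Rightarrow> real"
  assumes "(f has_sum S) I" "\<And>i. i \<in> I \<Longrightarrow> 0 \<le> f i"
  shows "(\<Sum>\<^sub>\<infinity>i\<in>I. ennreal (f i)) = ennreal S"
proof -
  have S: "f summable_on I" "infsum f I = S" using assms(1) by (auto simp: has_sum_iff)
  have "(\<Sum>\<^sub>\<infinity>i\<in>I. ennreal (f i)) = (SUP F\<in>{F. finite F \<and> F \<subseteq> I}. \<Sum>i\<in>F. ennreal (f i))"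
    by (rule nonneg_infsum_complete) simp
  also have "\<dots> = (SUP F\<in>{F. finite F \<and> F \<subseteq> I}. ennreal (sum f F))"
    using assms(2) by (intro SUP_cong refl sum_ennreal) auto
  also have "\<dots> = ennreal S"
    using infsum_nonneg_is_SUPREMUM_ennreal[OF S(1) assms(2)] S(2) by simp
  finally show ?thesis .
qed

lemma summable_on_if_infsum_ennreal_finite:
  fixes f :: "'i \<Rightarrow> real"
  assumes "(\<Sum>\<^sub>\<infinity>i\<in>I. ennreal (f i)) < \<infinity>" "\<And>i. i \<in> I \<Longrightarrow> 0 \<le> f i"
  shows "f summable_on I"
proof -
  define C where "C = enn2real (\<Sum>\<^sub>\<infinity>i\<in>I. ennreal (f i))"
  have C: "(\<Sum>\<^sub>\<infinity>i\<in>I. ennreal (f i)) = ennreal C"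
    using assms(1) by (simp add: C_def)
  have "sum f F \<le> C" if "finite F" "F \<subseteq> I" for F
  proof -
    have "ennreal (sum f F) = (\<Sum>i\<in>F. ennreal (f i))"
      using that assms(2) by (intro sum_ennreal[symmetric]) auto
    also have "\<dots> \<le> (\<Sum>\<^sub>\<infinity>i\<in>I. ennreal (f i))"
      using that by (subst nonneg_infsum_complete) (auto intro!: SUP_upper)
    finally show ?thesis unfolding C by (simp add: C_def)
  qed
  then show ?thesis
    by (intro nonneg_bounded_partial_sums_imp_summable_on[where C=C])
       (use assms(2) in \<open>auto intro!: eventually_finite_subsets_at_top_weakI\<close>)
qed

lemma nn_integral_count_space_has_sum:
  fixes f :: "'i \<Rightarrow> real"
  assumes "(f has_sum S) I" "\<And>i. i \<in> I \<Longrightarrow> 0 \<le> f i"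
  shows "(\<integral>\<^sup>+i. ennreal (f i) \<partial>count_space I) = ennreal S"
proof -
  have summ: "f summable_on I" and S: "infsum f I = S" using assms(1) by (auto simp: has_sum_iff)
  have abs: "(\<lambda>i. norm (f i)) summable_on I"
    using summ by (rule summable_on_iff_abs_summable_on_real[THEN iffD1])
  then have int: "integrable (count_space I) f"
    by (simp only: abs_summable_equivalent abs_summable_on_def)
  have "integral\<^sup>L (count_space I) f = S"
    using infsetsum_infsum[of f I] abs S by (simp only: abs_summable_equivalent infsetsum_def)
  then show ?thesis
    using nn_integral_eq_integral[OF int] assms(2) by (simp add: AE_count_space)
qed

text \<open>\<open>op_trace\<close> uses a chosen basis unrelated to \<open>E\<close>. Summing
  \<open>\<mu> e * (e' \<bullet> e)\<^sup>2\<close> over \<open>e'\<close> gives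
  \<open>\<mu> e\<close> by Parseval, summing it over \<open>e\<close> gives
  \<open>e' \<bullet> B e'\<close>. One direction of the equivalence computes traces, the other
  extracts summability from a finite trace.\<close>

lemma (in diagonal_operator) trace_transfer:
  assumes B: "\<And>x e. e \<in> E \<Longrightarrow> B x \<bullet> e = \<mu> e * (x \<bullet> e)" and \<mu>: "\<And>e. e \<in> E \<Longrightarrow> 0 \<le> \<mu> e"
    and E': "orthonormal_basis E'"
  shows "(\<mu> has_sum S) E \<longleftrightarrow> ((\<lambda>e. e \<bullet> B e) has_sum S) E'"
proof -
  have nE': "norm e = 1" if "e \<in> E'" for e using that E' by (auto simp: orthonormal_basis_def)
  have row: "((\<lambda>e'. \<mu> e * (e' \<bullet> e)\<^sup>2) has_sum \<mu> e) E'" if "e \<in> E" for e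
    using has_sum_cmult_right[OF parseval[OF E', of e], of "\<mu> e"] norm_basis[OF that]
    by (simp add: inner_commute)
  have col: "((\<lambda>e. \<mu> e * (e' \<bullet> e)\<^sup>2) has_sum e' \<bullet> B e') E" if "e' \<in> E'" for e'
  proof -
    have "((\<lambda>e. (e' \<bullet> e) * (B e' \<bullet> e)) has_sum e' \<bullet> B e') E" by (rule parseval_inner[OF basis])
    also have "?this \<longleftrightarrow> ?thesis"
      by (intro has_sum_cong) (simp add: B power2_eq_square)
    finally show ?thesis .
  qed
  show ?thesis
    using has_sum_interchange[where M="\<lambda>e e'. \<mu> e * (e' \<bullet> e)\<^sup>2" and I=E and J=E', OF _ row col]
      has_sum_interchange[where M="\<lambda>e' e. \<mu> e * (e' \<bullet> e)\<^sup>2" and I=E' and J=E, OF _ col row] \<mu>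
    by (meson mult_nonneg_nonneg zero_le_power2)
qed

lemma (in diagonal_operator)
  assumes B: "\<And>x e. e \<in> E \<Longrightarrow> B x \<bullet> e = \<mu> e * (x \<bullet> e)" and \<mu>: "\<And>e. e \<in> E \<Longrightarrow> 0 \<le> \<mu> e"
  shows op_trace_eq: "(\<mu> has_sum S) E \<Longrightarrow> op_trace B = ennreal S"
    and op_trace_finite_imp_summable: "op_trace B < \<infinity> \<Longrightarrow> \<mu> summable_on E"
proof -
  define E' where "E' = (SOME E'::'a set. orthonormal_basis E')"
  have E': "orthonormal_basis E'" unfolding E'_def by (rule someI[of _ E]) (rule basis)
  have nn: "0 \<le> x \<bullet> B x" for x
  proof -
    have "((\<lambda>e. (x \<bullet> e) * (B x \<bullet> e)) has_sum x \<bullet> B x) E" by (rule parseval_inner[OF basis])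
    then show ?thesis
      by (rule has_sum_nonneg) (simp add: B \<mu> mult.left_commute flip: power2_eq_square)
  qed
  have iff: "(\<mu> has_sum S) E \<longleftrightarrow> ((\<lambda>e. e \<bullet> B e) has_sum S) E'" for S
    by (rule trace_transfer) (use B \<mu> E' in auto)
  have tr: "op_trace B = (\<Sum>\<^sub>\<infinity>e\<in>E'. ennreal (e \<bullet> B e))"
    by (simp add: op_trace_def E'_def)
  show "op_trace B = ennreal S" if "(\<mu> has_sum S) E"
    unfolding tr by (rule infsum_ennreal_eq) (use that iff nn in auto)
  assume "op_trace B < \<infinity>"
  then have "(\<lambda>e. e \<bullet> B e) summable_on E'"
    unfolding tr by (rule summable_on_if_infsum_ennreal_finite) (rule nn)
  then show "\<mu> summable_on E" by (auto simp: summable_on_def iff)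
qed

locale trace_class_operator = diagonal_operator +
  assumes trace_finite: "op_trace A < \<infinity>" and A_nonzero: "A \<noteq> (\<lambda>x. 0)"
begin

lemma summable_lam: "lam summable_on E"
  by (rule op_trace_finite_imp_summable[OF _ _ trace_finite]) (auto simp: A_inner lam_nonneg)

lemma onorm_pos: "0 < onorm A"
proof -
  have "\<not> (\<forall>x. A x = 0)" using A_nonzero by blast
  then show ?thesis by (metis onorm_pos_lt[OF bounded_linear_A])
qed

lemma exists_lam_pos: "\<exists>e\<in>E. 0 < lam e"
proof (rule ccontr)
  assume "\<not> ?thesis"
  then have "lam e = 0" if "e \<in> E" for e using that lam_nonneg[of e] by force
  then have "A x = 0" for x by (intro eqI) (simp add: A_inner)
  then show False using A_nonzero by blast
qed

text \<open>\<open>inv\<close> is a choice of preimages. Its value at \<open>A x\<close> is pinned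
  down by injectivity of the shifted operator and the explicit preimage
  \<open>op_fun A f x\<close>.\<close>

lemma inv_shift_inner:
  assumes t: "0 < t" and e: "e \<in> E"
  shows "(inv (\<lambda>x. A x + t *\<^sub>R x) \<circ> A) x \<bullet> e = lam e / (lam e + t) * (x \<bullet> e)"
proof -
  define f where "f = (\<lambda>s. s / (s + t))"
  have f: "spec_bounded f 1" unfolding f_def using t by (intro spec_boundedI) auto
  have "inj (\<lambda>x. A x + t *\<^sub>R x)"
  proof (rule injI)
    fix x y assume eq: "A x + t *\<^sub>R x = A y + t *\<^sub>R y"
    show "x = y"
    proof (rule eqI)
      fix e assume e: "e \<in> E"
      have "(A x + t *\<^sub>R x) \<bullet> e = (A y + t *\<^sub>R y) \<bullet> e" by (simp only: eq)
      then have "(lam e + t) * (x \<bullet> e) = (lam e + t) * (y \<bullet> e)"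
        by (simp add: inner_simps A_inner[OF e] distrib_right)
      moreover have "lam e + t \<noteq> 0" using t lam_nonneg[of e] by linarith
      ultimately show "x \<bullet> e = y \<bullet> e" by simp
    qed
  qed
  moreover have "A (op_fun A f x) + t *\<^sub>R op_fun A f x = A x"
  proof (rule eqI)
    fix e assume e: "e \<in> E"
    have "0 < lam e + t" using t lam_nonneg[of e] by linarith
    then have "lam e * f (lam e) + t * f (lam e) = lam e"
      unfolding f_def by (metis distrib_right less_irrefl nonzero_mult_div_cancel_left times_divide_eq_right)
    then show "(A (op_fun A f x) + t *\<^sub>R op_fun A f x) \<bullet> e = A x \<bullet> e"
      using e by (simp add: inner_simps A_inner op_fun_inner[OF f e] flip: mult.assoc distrib_right)
  qed
  ultimately have "inv (\<lambda>x. A x + t *\<^sub>R x) (A x) = op_fun A f x" by (rule inv_f_eq)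
  then show ?thesis using op_fun_inner[OF f e] by (simp add: f_def)
qed

text \<open>Each term is at most \<open>lam e / t\<close>, so the finite trace of \<open>A\<close>
  makes this trace finite and \<open>enn2real\<close> in \<open>eff_dim\<close> loses
  nothing.\<close>

lemma eff_dim_has_sum:
  assumes t: "0 < t"
  shows "((\<lambda>e. lam e / (lam e + t)) has_sum eff_dim A t) E"
proof -
  have "(\<lambda>e. lam e / (lam e + t)) summable_on E"
  proof (rule summable_on_comparison_test)
    show "(\<lambda>e. lam e * (1 / t)) summable_on E" by (intro summable_on_cmult_left summable_lam)
    show "lam e / (lam e + t) \<le> lam e * (1 / t)" "0 \<le> lam e / (lam e + t)" for e
      using t lam_nonneg[of e] by (auto intro!: divide_left_mono mult_pos_pos)
  qed
  then obtain S where S: "((\<lambda>e. lam e / (lam e + t)) has_sum S) E" by (auto simp: summable_on_def)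
  have "op_trace (inv (\<lambda>x. A x + t *\<^sub>R x) \<circ> A) = ennreal S"
    by (rule op_trace_eq[OF inv_shift_inner[OF t] _ S]) (use t lam_nonneg in auto)
  moreover have "0 \<le> S" by (rule has_sum_nonneg[OF S]) (use t lam_nonneg in auto)
  ultimately show ?thesis using S by (simp add: eff_dim_def)
qed

lemma eff_dim_pos:
  assumes t: "0 < t"
  shows "0 < eff_dim A t"
proof -
  obtain e where e: "e \<in> E" "0 < lam e" using exists_lam_pos by blast
  have "(\<Sum>e\<in>{e}. lam e / (lam e + t)) \<le> eff_dim A t"
    by (rule finite_sum_le_has_sum[OF eff_dim_has_sum[OF t]]) (use t e lam_nonneg in auto)
  moreover have "0 < lam e / (lam e + t)" using e t by simp
  ultimately show ?thesis by simp
qed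

lemma eff_dim_antimono: "0 < s \<Longrightarrow> s \<le> t \<Longrightarrow> eff_dim A t \<le> eff_dim A s"
  by (rule has_sum_mono[OF eff_dim_has_sum eff_dim_has_sum])
     (use lam_nonneg in \<open>auto intro!: divide_left_mono mult_pos_pos add_nonneg_pos\<close>)

text \<open>Termwise, since t / (lam + t) grows with t. This limits how fast \<open>Theta\<close>
  can fall between neighbouring grid points.\<close>

lemma mult_eff_dim_mono:
  assumes "0 < s" "s \<le> t"
  shows "s * eff_dim A s \<le> t * eff_dim A t"
proof (rule has_sum_mono[OF has_sum_cmult_right[OF eff_dim_has_sum] has_sum_cmult_right[OF eff_dim_has_sum]])
  fix e
  have "s * (lam e + t) \<le> t * (lam e + s)"
    using assms lam_nonneg[of e] by (simp add: distrib_left mult_right_mono mult.commute)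
  then have "s / (lam e + s) \<le> t / (lam e + t)"
    using assms lam_nonneg[of e] by (simp add: divide_simps add_nonneg_pos)
  then have "lam e * (s / (lam e + s)) \<le> lam e * (t / (lam e + t))"
    by (rule mult_left_mono) (rule lam_nonneg)
  then show "s * (lam e / (lam e + s)) \<le> t * (lam e / (lam e + t))" by (simp add: mult.commute)
qed (use assms in auto)

lemma countable_pos: "countable {e\<in>E. 0 < lam e}"
proof -
  have "countable {e\<in>E. lam e \<noteq> 0}" by (rule summable_countable_real[OF summable_lam])
  then show ?thesis by (rule countable_subset[rotated]) auto
qed

end

section \<open>The spectral measure as an image measure\<close>

context diagonal_operator
begin

lemma indicator_spec_bounded: "spec_bounded (indicator B) 1"
  by (auto simp: spec_bounded_def indicator_def)

text \<open>\<open>measure_of\<close> returns the given set function only if that function is a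
  measure. Countable additivity comes from this form: the counting measure on the basis, weighted by
  squared coordinates and pushed forward along the eigenvalues.\<close>

definition spectral_distr :: "'a \<Rightarrow> real measure" where
  "spectral_distr w = distr (density (count_space E) (\<lambda>e. ennreal ((w \<bullet> e)\<^sup>2))) (count_space UNIV) lam"

lemma emeasure_spectral_distr:
  "emeasure (spectral_distr w) B = ennreal ((norm (op_fun A (indicator B) w))\<^sup>2)"
proof -
  have "emeasure (spectral_distr w) B = emeasure (density (count_space E) (\<lambda>e. ennreal ((w \<bullet> e)\<^sup>2))) (lam -` B \<inter> E)"
    unfolding spectral_distr_def by (subst emeasure_distr) auto
  also have "\<dots> = (\<integral>\<^sup>+e. ennreal ((w \<bullet> e)\<^sup>2) * indicator (lam -` B \<inter> E) e \<partial>count_space E)"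
    by (subst emeasure_density) auto
  also have "\<dots> = (\<integral>\<^sup>+e. ennreal ((indicator B (lam e))\<^sup>2 * (w \<bullet> e)\<^sup>2) \<partial>count_space E)"
    by (intro nn_integral_cong) (auto simp: indicator_def)
  also have "\<dots> = ennreal ((norm (op_fun A (indicator B) w))\<^sup>2)"
    by (rule nn_integral_count_space_has_sum[OF op_fun_norm_has_sum[OF indicator_spec_bounded]]) auto
  finally show ?thesis .
qed

lemma spectral_measure_eq: "spectral_measure A w = spectral_distr w"
proof -
  have "spectral_measure A w =
      measure_of (space (spectral_distr w)) (sets (spectral_distr w)) (emeasure (spectral_distr w))"
  proof -
    have "emeasure (spectral_distr w) = (\<lambda>B. ennreal ((norm (op_fun A (indicator B) w))\<^sup>2))"
      by (rule ext) (rule emeasure_spectral_distr)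
    moreover have "space (spectral_distr w) = UNIV" "sets (spectral_distr w) = UNIV"
      by (simp_all add: spectral_distr_def)
    ultimately show ?thesis by (simp only: spectral_measure_def)
  qed
  then show ?thesis by (simp only: measure_of_of_measure)
qed

lemma measure_spectral_measure:
  "measure (spectral_measure A w) B = (norm (op_fun A (indicator B) w))\<^sup>2"
  by (simp add: measure_def spectral_measure_eq emeasure_spectral_distr)

text \<open>With \<open>measure_spectral_measure\<close>, this turns \<open>tail_condition\<close>
  into an inequality between norms of functions of \<open>A\<close>.\<close>

lemma set_integral_spectral_measure:
  assumes f: "spec_bounded f C"
  shows "(\<integral>t\<in>B. (f t)\<^sup>2 \<partial>spectral_measure A w) = (norm (op_fun A (\<lambda>t. indicator B t * f t) w))\<^sup>2"
proof -
  have f': "spec_bounded (\<lambda>t. indicator B t * f t) (max C 0)"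
    using f by (auto simp: spec_bounded_def indicator_def)
  have "(\<integral>t\<in>B. (f t)\<^sup>2 \<partial>spectral_measure A w) =
      enn2real (\<integral>\<^sup>+t. ennreal (indicator B t * (f t)\<^sup>2) \<partial>spectral_measure A w)"
    unfolding set_lebesgue_integral_def
    by (subst integral_eq_nn_integral) (auto simp: spectral_measure_eq spectral_distr_def)
  also have "(\<integral>\<^sup>+t. ennreal (indicator B t * (f t)\<^sup>2) \<partial>spectral_measure A w) =
      (\<integral>\<^sup>+e. ennreal ((w \<bullet> e)\<^sup>2) * ennreal (indicator B (lam e) * (f (lam e))\<^sup>2) \<partial>count_space E)"
    unfolding spectral_measure_eq spectral_distr_def by (simp add: nn_integral_distr nn_integral_density)
  also have "\<dots> = (\<integral>\<^sup>+e. ennreal ((indicator B (lam e) * f (lam e))\<^sup>2 * (w \<bullet> e)\<^sup>2) \<partial>count_space E)"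
    by (intro nn_integral_cong) (auto simp: indicator_def mult.commute simp flip: ennreal_mult)
  also have "\<dots> = ennreal ((norm (op_fun A (\<lambda>t. indicator B t * f t) w))\<^sup>2)"
    by (rule nn_integral_count_space_has_sum[OF op_fun_norm_has_sum[OF f']]) auto
  finally show ?thesis by simp
qed

end

section \<open>Exponential moments of white noise\<close>

lemma nn_integral_normal_density: "0 < \<sigma> \<Longrightarrow> (\<integral>\<^sup>+x. ennreal (normal_density \<mu> \<sigma> x) \<partial>lborel) = 1"
  by (subst nn_integral_eq_integral) auto

lemma nn_integral_normal_density_exp:
  assumes \<sigma>: "0 < \<sigma>"
  shows "(\<integral>\<^sup>+x. ennreal (normal_density 0 \<sigma> x * exp (c * x)) \<partial>lborel) = ennreal (exp (c\<^sup>2 * \<sigma>\<^sup>2 / 2))"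
proof -
  have "normal_density 0 \<sigma> x * exp (c * x) = exp (c\<^sup>2 * \<sigma>\<^sup>2 / 2) * normal_density (c * \<sigma>\<^sup>2) \<sigma> x" for x
  proof -
    have "- x\<^sup>2 / (2 * \<sigma>\<^sup>2) + c * x = c\<^sup>2 * \<sigma>\<^sup>2 / 2 + (- (x - c * \<sigma>\<^sup>2)\<^sup>2 / (2 * \<sigma>\<^sup>2))"
      using \<sigma> by (simp add: field_simps power2_eq_square)
    then have "exp (- x\<^sup>2 / (2 * \<sigma>\<^sup>2)) * exp (c * x) =
        exp (c\<^sup>2 * \<sigma>\<^sup>2 / 2) * exp (- (x - c * \<sigma>\<^sup>2)\<^sup>2 / (2 * \<sigma>\<^sup>2))"
      by (simp only: mult_exp_exp)
    then show ?thesis by (simp add: normal_density_def)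
  qed
  then show ?thesis
    by (simp add: ennreal_mult nn_integral_cmult nn_integral_normal_density \<sigma>)
qed

lemma nn_integral_std_normal_density_exp_square:
  assumes a: "0 \<le> a" "4 * a \<le> 1"
  shows "(\<integral>\<^sup>+x. ennreal (normal_density 0 1 x * exp (a * x\<^sup>2)) \<partial>lborel) \<le> ennreal (exp (2 * a))"
proof -
  define \<sigma> where "\<sigma> = 1 / sqrt (1 - 2 * a)"
  have pos: "0 < 1 - 2 * a" using a by simp
  then have \<sigma>: "0 < \<sigma>" "\<sigma>\<^sup>2 = 1 / (1 - 2 * a)" by (simp_all add: \<sigma>_def power_divide)
  have "normal_density 0 1 x * exp (a * x\<^sup>2) = \<sigma> * normal_density 0 \<sigma> x" for x
  proof -
    have "- x\<^sup>2 / 2 + a * x\<^sup>2 = - x\<^sup>2 / (2 * \<sigma>\<^sup>2)"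
      using pos by (simp add: \<sigma> field_simps)
    then have "exp (- x\<^sup>2 / 2) * exp (a * x\<^sup>2) = exp (- x\<^sup>2 / (2 * \<sigma>\<^sup>2))"
      by (simp only: mult_exp_exp)
    then show ?thesis using \<sigma>(1) by (simp add: normal_density_def real_sqrt_mult)
  qed
  then have "(\<integral>\<^sup>+x. ennreal (normal_density 0 1 x * exp (a * x\<^sup>2)) \<partial>lborel) = ennreal \<sigma>"
    using \<sigma>(1) by (simp add: ennreal_mult nn_integral_cmult nn_integral_normal_density)
  also have "\<sigma> \<le> exp (2 * a)"
  proof -
    \<comment> \<open>The right side equals 1 + 2 a (1 - 4 a), which is where 4 a <= 1 enters. It
      replaces the exact value (1 - 2 a)^(-1/2) by an exponential, so that later products become
      sums of exponents.\<close>
    have "1 \<le> (1 + 4 * a) * (1 - 2 * a)"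
      using mult_nonneg_nonneg[OF a(1), of "1 - 4 * a"] a(2) by (simp add: algebra_simps)
    also have "\<dots> \<le> exp (4 * a) * (1 - 2 * a)"
      using pos by (intro mult_right_mono exp_ge_add_one_self) auto
    finally have "\<sigma>\<^sup>2 \<le> exp (4 * a)" using pos by (simp add: \<sigma>(2) field_simps)
    also have "\<dots> = (exp (2 * a))\<^sup>2" by (simp flip: exp_double)
    finally show ?thesis by (rule power2_le_imp_le) simp
  qed
  then show ?thesis by (simp add: calculation ennreal_leI)
qed

lemma (in prob_space) centered_gaussian_mgf:
  assumes X: "centered_gaussian M X"
  shows "(\<integral>\<^sup>+\<omega>. ennreal (exp (X \<omega>)) \<partial>M) = ennreal (exp ((\<integral>\<omega>. (X \<omega>)\<^sup>2 \<partial>M) / 2))"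
proof -
  have meas: "X \<in> borel_measurable M" using X by (simp add: centered_gaussian_def)
  consider "AE \<omega> in M. X \<omega> = 0" |
    \<sigma> where "\<sigma> > 0" "distributed M lborel X (\<lambda>x. ennreal (normal_density 0 \<sigma> x))"
    using X by (auto simp: centered_gaussian_def)
  then show ?thesis
  proof cases
    case 1
    have "(\<integral>\<^sup>+\<omega>. ennreal (exp (X \<omega>)) \<partial>M) = (\<integral>\<^sup>+\<omega>. 1 \<partial>M)"
      by (rule nn_integral_cong_AE) (use 1 in auto)
    moreover have "(\<integral>\<omega>. (X \<omega>)\<^sup>2 \<partial>M) = (\<integral>\<omega>. 0 \<partial>M)"
      by (rule integral_cong_AE) (use 1 meas in auto)
    ultimately show ?thesis by (simp add: emeasure_space_1)
  next
    case 2
    have "(\<integral>x. normal_density 0 \<sigma> x * x\<^sup>2 \<partial>lborel) = (\<integral>\<omega>. (X \<omega>)\<^sup>2 \<partial>M)"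
      by (rule distributed_integral[OF 2(2)]) auto
    then have v: "(\<integral>\<omega>. (X \<omega>)\<^sup>2 \<partial>M) = \<sigma>\<^sup>2"
      using integral_normal_moment_even[OF 2(1), of 0 1] by (simp add: fact_numeral)
    have "(\<integral>\<^sup>+\<omega>. ennreal (exp (X \<omega>)) \<partial>M) =
        (\<integral>\<^sup>+x. ennreal (normal_density 0 \<sigma> x) * ennreal (exp x) \<partial>lborel)"
      by (rule distributed_nn_integral[OF 2(2), symmetric]) auto
    also have "\<dots> = ennreal (exp (\<sigma>\<^sup>2 / 2))"
      using nn_integral_normal_density_exp[OF 2(1), of 1] by (simp add: ennreal_mult)
    finally show ?thesis by (simp add: v)
  qed
qed

locale white_noise_space = prob_space M for M :: "'w measure" +
  fixes \<xi> :: "'b::real_inner \<Rightarrow> 'w \<Rightarrow> real"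
  assumes wn: "white_noise M \<xi>"
begin

lemma xi_measurable [measurable]: "\<xi> y \<in> borel_measurable M"
  using wn by (auto simp: white_noise_def centered_gaussian_def)

lemma xi_cov: "has_bochner_integral M (\<lambda>\<omega>. \<xi> y \<omega> * \<xi> y' \<omega>) (y \<bullet> y')"
proof -
  have sq: "integrable M (\<lambda>\<omega>. (\<xi> y \<omega>)\<^sup>2)" for y using wn by (auto simp: white_noise_def)
  have "integrable M (\<lambda>\<omega>. \<xi> y \<omega> * \<xi> y' \<omega>)"
  proof (rule Bochner_Integration.integrable_bound)
    show "integrable M (\<lambda>\<omega>. (\<xi> y \<omega>)\<^sup>2 + (\<xi> y' \<omega>)\<^sup>2)" by (intro Bochner_Integration.integrable_add sq)
    have "\<bar>a * b\<bar> \<le> \<bar>a\<^sup>2 + b\<^sup>2\<bar>" for a b :: real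
    proof -
      have "2 * \<bar>a * b\<bar> \<le> a\<^sup>2 + b\<^sup>2"
        using sum_squares_bound[of "\<bar>a\<bar>" "\<bar>b\<bar>"] by (simp add: abs_mult mult.assoc)
      then show ?thesis by linarith
    qed
    then show "AE \<omega> in M. norm (\<xi> y \<omega> * \<xi> y' \<omega>) \<le> norm ((\<xi> y \<omega>)\<^sup>2 + (\<xi> y' \<omega>)\<^sup>2)" by simp
  qed simp
  moreover have "(\<integral>\<omega>. \<xi> y \<omega> * \<xi> y' \<omega> \<partial>M) = y \<bullet> y'" using wn by (auto simp: white_noise_def)
  ultimately show ?thesis by (simp add: has_bochner_integral_iff)
qed

text \<open>\<open>white_noise\<close> does not state linearity; the covariances force it, because
  the second moment of the defect \<open>D\<close> is a combination of inner products that cancels.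
  The null set depends on \<open>y\<close>, \<open>c\<close> and \<open>u\<close>.\<close>

lemma xi_add_scaleR: "AE \<omega> in M. \<xi> (y + c *\<^sub>R u) \<omega> = \<xi> y \<omega> + c * \<xi> u \<omega>"
proof -
  let ?v = "y + c *\<^sub>R u"
  define D where "D \<omega> = \<xi> ?v \<omega> - \<xi> y \<omega> - c * \<xi> u \<omega>" for \<omega>
  have eq: "(D \<omega>)\<^sup>2 = \<xi> ?v \<omega> * \<xi> ?v \<omega> + \<xi> y \<omega> * \<xi> y \<omega> + c\<^sup>2 * (\<xi> u \<omega> * \<xi> u \<omega>)
      - 2 * (\<xi> ?v \<omega> * \<xi> y \<omega>) - 2 * c * (\<xi> ?v \<omega> * \<xi> u \<omega>) + 2 * c * (\<xi> y \<omega> * \<xi> u \<omega>)" for \<omega>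
    unfolding D_def by (simp add: power2_eq_square algebra_simps)
  have "has_bochner_integral M (\<lambda>\<omega>. (D \<omega>)\<^sup>2) (?v \<bullet> ?v + y \<bullet> y + c\<^sup>2 * (u \<bullet> u)
      - 2 * (?v \<bullet> y) - 2 * c * (?v \<bullet> u) + 2 * c * (y \<bullet> u))"
    unfolding eq
    by (intro has_bochner_integral_add has_bochner_integral_diff has_bochner_integral_mult_right xi_cov)
  also have "?v \<bullet> ?v + y \<bullet> y + c\<^sup>2 * (u \<bullet> u) - 2 * (?v \<bullet> y) - 2 * c * (?v \<bullet> u) + 2 * c * (y \<bullet> u) = 0"
    by (simp add: inner_simps inner_commute power2_eq_square algebra_simps)
  finally have "integrable M (\<lambda>\<omega>. (D \<omega>)\<^sup>2)" "(\<integral>\<omega>. (D \<omega>)\<^sup>2 \<partial>M) = 0"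
    by (simp_all add: has_bochner_integral_iff)
  then have "AE \<omega> in M. (D \<omega>)\<^sup>2 = 0"
    using integral_nonneg_eq_0_iff_AE[of M "\<lambda>\<omega>. (D \<omega>)\<^sup>2"] by auto
  then show ?thesis by eventually_elim (simp add: D_def)
qed

lemma xi_zero: "AE \<omega> in M. \<xi> 0 \<omega> = 0"
  using xi_add_scaleR[of 0 "-1" 0] by eventually_elim simp

lemma xi_mgf: "(\<integral>\<^sup>+\<omega>. ennreal (exp (\<xi> y \<omega>)) \<partial>M) = ennreal (exp ((norm y)\<^sup>2 / 2))"
proof -
  have "(\<integral>\<omega>. (\<xi> y \<omega>)\<^sup>2 \<partial>M) = (norm y)\<^sup>2"
    using has_bochner_integral_integral_eq[OF xi_cov[of y y]]
    by (simp add: power2_eq_square flip: power2_norm_eq_inner)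
  moreover have "centered_gaussian M (\<xi> y)" using wn by (auto simp: white_noise_def)
  ultimately show ?thesis using centered_gaussian_mgf[of "\<xi> y"] by simp
qed

text \<open>Linearizing one square at a time by \<open>exp (s z\<^sup>2) = \<E> exp (\<surd>(2 s) h z)\<close> with \<open>h\<close>
  standard normal reduces the claim to the moment generating function of a single \<open>\<xi> y\<close>;
  independence of the \<open>\<xi> (u i)\<close> need not be derived from the covariances.\<close>

lemma xi_exp_squares:
  assumes "finite I"
    and "\<And>i j. i \<in> I \<Longrightarrow> j \<in> I \<Longrightarrow> i \<noteq> j \<Longrightarrow> u i \<bullet> u j = 0"
    and "\<And>i. i \<in> I \<Longrightarrow> 0 \<le> s i" "\<And>i. i \<in> I \<Longrightarrow> 4 * (s i * (norm (u i))\<^sup>2) \<le> 1"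
    and "\<And>i. i \<in> I \<Longrightarrow> y \<bullet> u i = 0"
  shows "(\<integral>\<^sup>+\<omega>. ennreal (exp ((\<Sum>i\<in>I. s i * (\<xi> (u i) \<omega>)\<^sup>2) + \<xi> y \<omega>)) \<partial>M)
    \<le> ennreal (exp ((\<Sum>i\<in>I. 2 * (s i * (norm (u i))\<^sup>2)) + (norm y)\<^sup>2 / 2))"
  using assms
proof (induction I arbitrary: y rule: finite_induct)
  case empty
  then show ?case by (simp add: xi_mgf)
next
  case (insert i I)
  define R where "R y \<omega> = (\<Sum>i\<in>I. s i * (\<xi> (u i) \<omega>)\<^sup>2) + \<xi> y \<omega>" for y \<omega>
  have [measurable]: "R y \<in> borel_measurable M" for y unfolding R_def by measurable
  define B where "B = (\<Sum>i\<in>I. 2 * (s i * (norm (u i))\<^sup>2))"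
  define c where "c = sqrt (2 * s i)"
  have si: "0 \<le> s i" "4 * (s i * (norm (u i))\<^sup>2) \<le> 1" using insert.prems by auto
  have c2: "c\<^sup>2 = 2 * s i" using si by (simp add: c_def)
  interpret lb: sigma_finite_measure "lborel :: real measure" by (rule lborel.sigma_finite_measure_axioms)
  interpret pair_sigma_finite M "lborel :: real measure" ..
  have "(\<integral>\<^sup>+\<omega>. ennreal (exp (s i * (\<xi> (u i) \<omega>)\<^sup>2 + R y \<omega>)) \<partial>M) =
      (\<integral>\<^sup>+\<omega>. (\<integral>\<^sup>+h. ennreal (normal_density 0 1 h * exp (c * h * \<xi> (u i) \<omega> + R y \<omega>)) \<partial>lborel) \<partial>M)"
  proof (intro nn_integral_cong)
    fix \<omega>
    have "(\<integral>\<^sup>+h. ennreal (normal_density 0 1 h * exp (c * h * \<xi> (u i) \<omega> + R y \<omega>)) \<partial>lborel) =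
      (\<integral>\<^sup>+h. ennreal (normal_density 0 1 h * exp ((c * \<xi> (u i) \<omega>) * h)) * ennreal (exp (R y \<omega>)) \<partial>lborel)"
      by (intro nn_integral_cong) (simp add: exp_add mult_ac flip: ennreal_mult)
    also have "\<dots> = ennreal (exp ((c * \<xi> (u i) \<omega>)\<^sup>2 * 1\<^sup>2 / 2)) * ennreal (exp (R y \<omega>))"
      by (subst nn_integral_multc) (simp_all add: nn_integral_normal_density_exp)
    also have "\<dots> = ennreal (exp (s i * (\<xi> (u i) \<omega>)\<^sup>2 + R y \<omega>))"
      by (simp add: power_mult_distrib c2 exp_add flip: ennreal_mult)
    finally show "ennreal (exp (s i * (\<xi> (u i) \<omega>)\<^sup>2 + R y \<omega>)) =
      (\<integral>\<^sup>+h. ennreal (normal_density 0 1 h * exp (c * h * \<xi> (u i) \<omega> + R y \<omega>)) \<partial>lborel)" by simp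
  qed
  also have "\<dots> = (\<integral>\<^sup>+h. (\<integral>\<^sup>+\<omega>. ennreal (normal_density 0 1 h * exp (c * h * \<xi> (u i) \<omega> + R y \<omega>)) \<partial>M) \<partial>lborel)"
    by (rule Fubini'[symmetric]) measurable
  also have "\<dots> \<le> (\<integral>\<^sup>+h. ennreal (exp (B + (norm y)\<^sup>2 / 2)) *
      ennreal (normal_density 0 1 h * exp (s i * (norm (u i))\<^sup>2 * h\<^sup>2)) \<partial>lborel)"
  proof (rule nn_integral_mono)
    fix h :: real
    \<comment> \<open>For fixed \<open>h\<close> the linear terms merge into the noise at the
      shifted vector \<open>?y\<close>, still orthogonal to the remaining \<open>u j\<close>. To
      absorb this shift the claim carries \<open>\<xi> y\<close>, and the induction generalizes
      \<open>y\<close>.\<close>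
    let ?y = "y + (c * h) *\<^sub>R u i"
    have "(\<integral>\<^sup>+\<omega>. ennreal (normal_density 0 1 h * exp (c * h * \<xi> (u i) \<omega> + R y \<omega>)) \<partial>M) =
        (\<integral>\<^sup>+\<omega>. ennreal (normal_density 0 1 h) * ennreal (exp (R ?y \<omega>)) \<partial>M)"
    proof (rule nn_integral_cong_AE)
      show "AE \<omega> in M. ennreal (normal_density 0 1 h * exp (c * h * \<xi> (u i) \<omega> + R y \<omega>)) =
          ennreal (normal_density 0 1 h) * ennreal (exp (R ?y \<omega>))"
        using xi_add_scaleR[of y "c * h" "u i"]
        by eventually_elim (simp add: R_def add_ac flip: ennreal_mult)
    qed
    also have "\<dots> = ennreal (normal_density 0 1 h) * (\<integral>\<^sup>+\<omega>. ennreal (exp (R ?y \<omega>)) \<partial>M)"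
      by (rule nn_integral_cmult) measurable
    also have "\<dots> \<le> ennreal (normal_density 0 1 h) * ennreal (exp (B + (norm ?y)\<^sup>2 / 2))"
    proof (rule mult_left_mono)
      have "?y \<bullet> u j = 0" if "j \<in> I" for j
        using insert.prems(1)[of i j] insert.prems(4)[of j] insert.hyps(2) that by (auto simp: inner_simps)
      then show "(\<integral>\<^sup>+\<omega>. ennreal (exp (R ?y \<omega>)) \<partial>M) \<le> ennreal (exp (B + (norm ?y)\<^sup>2 / 2))"
        unfolding R_def B_def using insert.prems(1-3) by (intro insert.IH) auto
    qed simp
    also have "(norm ?y)\<^sup>2 = (norm y)\<^sup>2 + 2 * (s i * (norm (u i))\<^sup>2 * h\<^sup>2)"
    proof -
      have "(norm ?y)\<^sup>2 = (norm y)\<^sup>2 + 2 * (c * h) * (y \<bullet> u i) + (c * h)\<^sup>2 * (norm (u i))\<^sup>2"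
        unfolding power2_norm_eq_inner
        by (simp add: inner_simps inner_commute power2_eq_square algebra_simps)
      then show ?thesis using insert.prems(4)[of i] by (simp add: power_mult_distrib c2 mult_ac)
    qed
    also have "ennreal (normal_density 0 1 h) *
        ennreal (exp (B + ((norm y)\<^sup>2 + 2 * (s i * (norm (u i))\<^sup>2 * h\<^sup>2)) / 2)) =
        ennreal (exp (B + (norm y)\<^sup>2 / 2)) *
        ennreal (normal_density 0 1 h * exp (s i * (norm (u i))\<^sup>2 * h\<^sup>2))"
      by (simp add: exp_add add_divide_distrib mult_ac flip: ennreal_mult)
    finally show "(\<integral>\<^sup>+\<omega>. ennreal (normal_density 0 1 h * exp (c * h * \<xi> (u i) \<omega> + R y \<omega>)) \<partial>M) \<le>
        ennreal (exp (B + (norm y)\<^sup>2 / 2)) *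
        ennreal (normal_density 0 1 h * exp (s i * (norm (u i))\<^sup>2 * h\<^sup>2))" .
  qed
  also have "\<dots> = ennreal (exp (B + (norm y)\<^sup>2 / 2)) *
      (\<integral>\<^sup>+h. ennreal (normal_density 0 1 h * exp (s i * (norm (u i))\<^sup>2 * h\<^sup>2)) \<partial>lborel)"
    by (rule nn_integral_cmult) measurable
  also have "\<dots> \<le> ennreal (exp (B + (norm y)\<^sup>2 / 2)) * ennreal (exp (2 * (s i * (norm (u i))\<^sup>2)))"
    using si by (intro mult_left_mono nn_integral_std_normal_density_exp_square) auto
  also have "\<dots> = ennreal (exp ((\<Sum>i\<in>insert i I. 2 * (s i * (norm (u i))\<^sup>2)) + (norm y)\<^sup>2 / 2))"
    using insert.hyps by (simp add: B_def exp_add mult_ac flip: ennreal_mult)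
  finally show ?case using insert.hyps by (simp add: R_def add.assoc)
qed

end

locale noise_model = trace_class_operator A E + white_noise_space M \<xi>
  for A :: "'a::{real_inner, complete_space} \<Rightarrow> 'a" and E
    and M :: "'w measure" and \<xi> :: "'b::real_inner \<Rightarrow> 'w \<Rightarrow> real" +
  fixes T :: "'a \<Rightarrow> 'b" and \<zeta> :: "'w \<Rightarrow> 'a"
  assumes A_T: "A x \<bullet> y = T x \<bullet> T y"
    and zeta: "adjoint_noise M T \<xi> \<zeta>"
begin

lemma zeta_measurable [measurable]: "\<zeta> \<in> borel_measurable M"
  using zeta by (simp add: adjoint_noise_def)

lemma zeta_inner: "AE \<omega> in M. \<zeta> \<omega> \<bullet> w = \<xi> (T w) \<omega>"
  using zeta by (simp add: adjoint_noise_def)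

text \<open>If the kernel is not separable, then the exceptional null sets of its basis vectors cannot be united;
  here the countable set \<open>S\<close> from the definition of \<^const>\<open>adjoint_noise\<close> is needed.\<close>

lemma zeta_kernel: "AE \<omega> in M. \<forall>e\<in>E. lam e = 0 \<longrightarrow> \<zeta> \<omega> \<bullet> e = 0"
proof -
  obtain S where S: "countable S" "AE \<omega> in M. \<zeta> \<omega> \<in> closure S"
    using zeta by (auto simp: adjoint_noise_def)
  define P where "P = op_fun A (indicator {0})"
  have P: "P x \<bullet> e = (if lam e = 0 then x \<bullet> e else 0)" if "e \<in> E" for x e
    unfolding P_def using op_fun_inner[OF indicator_spec_bounded that] by simp
  have P_sym: "P x \<bullet> y = x \<bullet> P y" for x y
  proof -
    have "((\<lambda>e. (P x \<bullet> e) * (y \<bullet> e)) has_sum P x \<bullet> y) E" by (rule parseval_inner[OF basis])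
    also have "?this \<longleftrightarrow> ((\<lambda>e. (x \<bullet> e) * (P y \<bullet> e)) has_sum P x \<bullet> y) E"
      by (intro has_sum_cong) (simp add: P)
    finally show ?thesis by (rule has_sum_unique) (rule parseval_inner[OF basis])
  qed
  have TP: "T (P x) = 0" for x
  proof -
    have "A (P x) = 0" by (rule eqI) (simp add: A_inner P)
    then have "T (P x) \<bullet> T (P x) = 0" by (simp flip: A_T)
    then show ?thesis by simp
  qed
  \<comment> \<open>\<open>P s\<close> lies in the kernel of \<open>T\<close>, so the inner product
    is almost surely \<open>\<xi> 0\<close>. Passing to the closure of \<open>S\<close> makes
    \<open>P (\<zeta> \<omega>)\<close> orthogonal to \<open>\<zeta> \<omega>\<close>, hence zero,
    as \<open>P\<close> is a symmetric projection.\<close>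
  have "AE \<omega> in M. \<forall>s\<in>S. \<zeta> \<omega> \<bullet> P s = 0"
    unfolding AE_ball_countable[OF S(1)]
  proof
    fix s
    show "AE \<omega> in M. \<zeta> \<omega> \<bullet> P s = 0" using zeta_inner[of "P s"] xi_zero unfolding TP by eventually_elim simp
  qed
  with S(2) show ?thesis
  proof eventually_elim
    fix \<omega> assume cl: "\<zeta> \<omega> \<in> closure S" and orth: "\<forall>s\<in>S. \<zeta> \<omega> \<bullet> P s = 0"
    have "closed {s. P (\<zeta> \<omega>) \<bullet> s = 0}" by (intro closed_Collect_eq continuous_intros)
    moreover have "S \<subseteq> {s. P (\<zeta> \<omega>) \<bullet> s = 0}" using orth by (auto simp: P_sym)
    ultimately have "closure S \<subseteq> {s. P (\<zeta> \<omega>) \<bullet> s = 0}" by (rule closure_minimal[rotated])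
    then have "P (\<zeta> \<omega>) \<bullet> \<zeta> \<omega> = 0" using cl by blast
    moreover have "P (P x) = P x" for x by (rule eqI) (simp add: P)
    ultimately have "P (\<zeta> \<omega>) \<bullet> P (\<zeta> \<omega>) = 0" by (metis P_sym)
    then have "P (\<zeta> \<omega>) = 0" by simp
    then show "\<forall>e\<in>E. lam e = 0 \<longrightarrow> \<zeta> \<omega> \<bullet> e = 0" using P by (metis inner_zero_left)
  qed
qed

text \<open>The exponent is an infinite quadratic form in the values \<open>\<xi> (T e)\<close>.
  \<open>xi_exp_squares\<close> bounds its finite sections uniformly, and Fatou's lemma passes to
  the limit. Since \<open>T e\<close> has squared norm \<open>lam e\<close>, \<open>small\<close> is
  the smallness condition of that lemma.\<close>

lemma zeta_exp_moment:
  assumes f: "spec_bounded f C" and s: "0 \<le> s"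
    and small: "\<And>e. e \<in> E \<Longrightarrow> 4 * (s * ((f (lam e))\<^sup>2 * lam e)) \<le> 1"
    and S: "((\<lambda>e. (f (lam e))\<^sup>2 * lam e) has_sum S) E"
  shows "(\<integral>\<^sup>+\<omega>. ennreal (exp (s * (norm (op_fun A f (\<zeta> \<omega>)))\<^sup>2)) \<partial>M) \<le> ennreal (exp (2 * s * S))"
proof -
  define E1 where "E1 = {e\<in>E. 0 < lam e}"
  have E1: "countable E1" "E1 \<subseteq> E" "E1 \<noteq> {}"
    using countable_pos exists_lam_pos by (auto simp: E1_def)
  \<comment> \<open>Fatou's lemma needs a sequence, while unordered sums are limits along the filter
    of finite subsets. Images are used because the enumeration repeats values if \<open>E1\<close>
    is finite.\<close>
  define F where "F n = from_nat_into E1 ` {..<n::nat}" for n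
  have F: "finite (F n)" "F n \<subseteq> E1" for n
    using from_nat_into[OF E1(3)] by (auto simp: F_def)
  have Flim: "filterlim F (finite_subsets_at_top E1) sequentially"
    unfolding filterlim_def le_filter_def eventually_filtermap
  proof (intro allI impI)
    fix Q assume "eventually Q (finite_subsets_at_top E1)"
    then have "\<exists>G. finite G \<and> G \<subseteq> E1 \<and> (\<forall>H. finite H \<and> G \<subseteq> H \<and> H \<subseteq> E1 \<longrightarrow> Q H)"
      by (simp only: eventually_finite_subsets_at_top)
    then obtain G where G: "finite G" "G \<subseteq> E1" and QG: "\<forall>H. finite H \<and> G \<subseteq> H \<and> H \<subseteq> E1 \<longrightarrow> Q H"
      by (elim exE conjE)
    define n0 where "n0 = Suc (Max (insert 0 (to_nat_on E1 ` G)))"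
    have "Q (F n)" if "n \<ge> n0" for n
    proof (rule QG[rule_format], intro conjI F subsetI)
      fix e assume e: "e \<in> G"
      have "to_nat_on E1 e \<le> Max (insert 0 (to_nat_on E1 ` G))" using e G(1) by (intro Max_ge) auto
      then have "to_nat_on E1 e \<in> {..<n}" using that by (simp add: n0_def)
      then have "from_nat_into E1 (to_nat_on E1 e) \<in> F n" unfolding F_def by (rule imageI)
      moreover have "from_nat_into E1 (to_nat_on E1 e) = e" using e G(2) E1(1) by auto
      ultimately show "e \<in> F n" by simp
    qed
    then show "eventually (\<lambda>n. Q (F n)) sequentially" unfolding eventually_sequentially by blast
  qed
  define r where "r e = s * (f (lam e))\<^sup>2" for e
  define g where "g n \<omega> = ennreal (exp (\<Sum>e\<in>F n. r e * (\<xi> (T e) \<omega>)\<^sup>2))" for n \<omega>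
  have nT: "(norm (T e))\<^sup>2 = lam e" for e
    using A_T[of e e] by (simp add: lam_def power2_norm_eq_inner inner_commute)
  have "AE \<omega> in M. \<forall>e\<in>E1. \<zeta> \<omega> \<bullet> e = \<xi> (T e) \<omega>"
    unfolding AE_ball_countable[OF E1(1)] by (intro ballI zeta_inner)
  with zeta_kernel
  have "AE \<omega> in M. ennreal (exp (s * (norm (op_fun A f (\<zeta> \<omega>)))\<^sup>2)) \<le> liminf (\<lambda>n. g n \<omega>)"
  proof eventually_elim
    fix \<omega> assume ker: "\<forall>e\<in>E. lam e = 0 \<longrightarrow> \<zeta> \<omega> \<bullet> e = 0" and eq: "\<forall>e\<in>E1. \<zeta> \<omega> \<bullet> e = \<xi> (T e) \<omega>"
    let ?N = "(norm (op_fun A f (\<zeta> \<omega>)))\<^sup>2"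
    have "((\<lambda>e. (f (lam e))\<^sup>2 * (\<zeta> \<omega> \<bullet> e)\<^sup>2) has_sum ?N) E" by (rule op_fun_norm_has_sum[OF f])
    also have "?this \<longleftrightarrow> ((\<lambda>e. (f (lam e))\<^sup>2 * (\<xi> (T e) \<omega>)\<^sup>2) has_sum ?N) E1"
    proof (rule has_sum_cong_neutral)
      fix e assume "e \<in> E - E1"
      then have "lam e = 0" "e \<in> E" using lam_nonneg[of e] by (auto simp: E1_def)
      then show "(f (lam e))\<^sup>2 * (\<zeta> \<omega> \<bullet> e)\<^sup>2 = 0" using ker by simp
    qed (use E1 eq in auto)
    finally have "((\<lambda>e. s * ((f (lam e))\<^sup>2 * (\<xi> (T e) \<omega>)\<^sup>2)) has_sum (s * ?N)) E1"
      by (rule has_sum_cmult_right)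
    then have "((\<lambda>e. r e * (\<xi> (T e) \<omega>)\<^sup>2) has_sum (s * ?N)) E1" by (simp add: r_def mult.assoc)
    then have "(\<lambda>n. \<Sum>e\<in>F n. r e * (\<xi> (T e) \<omega>)\<^sup>2) \<longlonglongrightarrow> s * ?N"
      unfolding has_sum_def using filterlim_compose[OF _ Flim] by blast
    then have "(\<lambda>n. g n \<omega>) \<longlonglongrightarrow> ennreal (exp (s * ?N))"
      unfolding g_def by (intro tendsto_ennrealI tendsto_exp)
    then show "ennreal (exp (s * ?N)) \<le> liminf (\<lambda>n. g n \<omega>)"
      by (simp add: lim_imp_Liminf)
  qed
  then have "(\<integral>\<^sup>+\<omega>. ennreal (exp (s * (norm (op_fun A f (\<zeta> \<omega>)))\<^sup>2)) \<partial>M)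
      \<le> (\<integral>\<^sup>+\<omega>. liminf (\<lambda>n. g n \<omega>) \<partial>M)" by (rule nn_integral_mono_AE)
  also have "\<dots> \<le> liminf (\<lambda>n. \<integral>\<^sup>+\<omega>. g n \<omega> \<partial>M)"
    by (rule nn_integral_liminf) (simp add: g_def)
  also have "\<dots> \<le> ennreal (exp (2 * s * S))"
  proof (intro Liminf_le always_eventually allI)
    fix n
    have "(\<integral>\<^sup>+\<omega>. g n \<omega> \<partial>M) = (\<integral>\<^sup>+\<omega>. ennreal (exp ((\<Sum>e\<in>F n. r e * (\<xi> (T e) \<omega>)\<^sup>2) + \<xi> 0 \<omega>)) \<partial>M)"
      unfolding g_def by (rule nn_integral_cong_AE) (use xi_zero in eventually_elim, simp)
    also have "\<dots> \<le> ennreal (exp ((\<Sum>e\<in>F n. 2 * (r e * (norm (T e))\<^sup>2)) + (norm (0::'b))\<^sup>2 / 2))"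
    proof (rule xi_exp_squares[OF F(1)])
      show "T e \<bullet> T e' = 0" if "e \<in> F n" "e' \<in> F n" "e \<noteq> e'" for e e'
      proof -
        have "e \<in> E" "e' \<in> E" using that F(2) E1(2) by blast+
        then show ?thesis using that(3) by (simp add: A_basis inner_basis flip: A_T)
      qed
      show "0 \<le> r e" for e using s by (simp add: r_def)
      show "4 * (r e * (norm (T e))\<^sup>2) \<le> 1" if "e \<in> F n" for e
      proof -
        have "e \<in> E" using that F(2) E1(2) by blast
        from small[OF this] show ?thesis by (simp add: r_def nT mult.assoc)
      qed
    qed simp
    also have "(\<Sum>e\<in>F n. 2 * (r e * (norm (T e))\<^sup>2)) = 2 * s * (\<Sum>e\<in>F n. (f (lam e))\<^sup>2 * lam e)"
      by (simp add: nT r_def sum_distrib_left mult_ac)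
    also have "ennreal (exp (2 * s * (\<Sum>e\<in>F n. (f (lam e))\<^sup>2 * lam e) + (norm (0::'b))\<^sup>2 / 2))
        \<le> ennreal (exp (2 * s * S))"
    proof -
      have "(\<Sum>e\<in>F n. (f (lam e))\<^sup>2 * lam e) \<le> S"
        by (rule finite_sum_le_has_sum[OF S F(1)]) (use F(2) E1(2) lam_nonneg in auto)
      then show ?thesis using s by (simp add: ennreal_leI mult_left_mono)
    qed
    finally show "(\<integral>\<^sup>+\<omega>. g n \<omega> \<partial>M) \<le> ennreal (exp (2 * s * S))" .
  qed simp_all
  finally show ?thesis .
qed

end

section \<open>Analysis of the RG-rule for a fixed noise realization\<close>

lemma (in diagonal_operator) op_fun_norm_le_op_fun:
  assumes f: "spec_bounded f B" and h: "spec_bounded h B'" and C: "0 \<le> C"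
    and le: "\<And>t. 0 \<le> t \<Longrightarrow> t \<le> onorm A \<Longrightarrow> \<bar>f t\<bar> \<le> C * \<bar>h t\<bar>"
  shows "norm (op_fun A f x) \<le> C * norm (op_fun A h x)"
proof (rule norm_le_coord[OF C])
  fix e assume e: "e \<in> E"
  have "\<bar>f (lam e)\<bar> * \<bar>x \<bullet> e\<bar> \<le> C * \<bar>h (lam e)\<bar> * \<bar>x \<bullet> e\<bar>"
    by (intro mult_right_mono le lam_nonneg lam_le e) simp
  then show "\<bar>op_fun A f x \<bullet> e\<bar> \<le> C * \<bar>op_fun A h x \<bullet> e\<bar>"
    by (simp add: op_fun_inner[OF f e] op_fun_inner[OF h e] abs_mult mult.assoc)
qed

section \<open>Monotonicity of \<open>Theta\<close> and its balancing parameter\<close>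

context trace_class_operator
begin

lemma Theta_eq: "Theta A t = t / sqrt (t * eff_dim A t)"
  by (simp add: Theta_def rho_eff_def)

lemma sqrt_mult_eff_dim_pos: "0 < t \<Longrightarrow> 0 < sqrt (t * eff_dim A t)"
  using eff_dim_pos by simp

lemma Theta_pos: "0 < t \<Longrightarrow> 0 < Theta A t"
  unfolding Theta_eq using sqrt_mult_eff_dim_pos by simp

lemma Theta_sq: "0 < t \<Longrightarrow> (Theta A t)\<^sup>2 = t / eff_dim A t"
  using eff_dim_pos[of t] by (simp add: Theta_eq power_divide power2_eq_square field_simps)

lemma Theta_strict_mono:
  assumes "0 < s" "s < t"
  shows "Theta A s < Theta A t"
proof (rule power2_less_imp_less)
  have N: "0 < eff_dim A t" "eff_dim A t \<le> eff_dim A s"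
    using assms eff_dim_pos[of t] eff_dim_antimono[of s t] by auto
  have "s / eff_dim A s \<le> s / eff_dim A t" using N assms by (intro divide_left_mono) auto
  also have "\<dots> < t / eff_dim A t" using N assms by (intro divide_strict_right_mono) auto
  finally show "(Theta A s)\<^sup>2 < (Theta A t)\<^sup>2" using assms by (simp add: Theta_sq)
  show "0 \<le> Theta A t" using assms Theta_pos[of t] by simp
qed

lemma Theta_mono: "0 < s \<Longrightarrow> s \<le> t \<Longrightarrow> Theta A s \<le> Theta A t"
  using Theta_strict_mono[of s t] by (cases "s = t") auto

text \<open>\<open>Theta A t\<close> is t over the square root of t N(t), which does not increase
  when t decreases. With c = q: one grid step keeps at least the fraction q of
  \<open>Theta\<close>.\<close>

lemma Theta_scale:
  assumes "0 < t" "0 < c" "c \<le> 1"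
  shows "c * Theta A t \<le> Theta A (c * t)"
proof -
  have ct: "0 < c * t" "c * t \<le> t" using assms by (auto simp: mult_le_cancel_right1)
  have "(c * t) / sqrt (t * eff_dim A t) \<le> (c * t) / sqrt ((c * t) * eff_dim A (c * t))"
    by (rule divide_left_mono[OF real_sqrt_le_mono[OF mult_eff_dim_mono[OF ct]] less_imp_le[OF ct(1)]
          mult_pos_pos[OF sqrt_mult_eff_dim_pos[OF assms(1)] sqrt_mult_eff_dim_pos[OF ct(1)]]])
  then show ?thesis by (simp add: Theta_eq)
qed

lemma sqrt_eff_dim_divide: "0 < t \<Longrightarrow> sqrt (eff_dim A t) / sqrt t = 1 / Theta A t"
  by (simp add: Theta_eq real_sqrt_mult field_simps)

text \<open>As \<open>\<psi>\<close> may vanish near 0, \<open>Theta_psi\<close> is known to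
  increase strictly only where it is positive; uniqueness at a positive value \<open>s\<close>
  follows from that.\<close>

lemma Theta_psi_inv_eq:
  assumes t: "0 < t" "t \<le> onorm A" "Theta_psi A \<psi> t = s" and s: "0 < s"
    and \<psi>: "mono_on {0..onorm A} \<psi>"
  shows "Theta_psi_inv A \<psi> s = t"
  unfolding Theta_psi_inv_def
proof (rule the_equality)
  have less: "Theta_psi A \<psi> u < Theta_psi A \<psi> v"
    if "0 < u" "u < v" "v \<le> onorm A" "0 < Theta_psi A \<psi> u" for u v
  proof -
    have "0 < \<psi> u" using that Theta_pos[of u] by (simp add: Theta_psi_def zero_less_mult_iff)
    moreover have "\<psi> u \<le> \<psi> v" using \<psi> that by (intro mono_onD[OF \<psi>]) auto
    ultimately have "Theta A u * \<psi> u < Theta A v * \<psi> u" "Theta A v * \<psi> u \<le> Theta A v * \<psi> v"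
      using Theta_strict_mono[OF that(1,2)] Theta_pos[of v] that
      by (auto intro!: mult_strict_right_mono mult_left_mono)
    then show ?thesis by (simp add: Theta_psi_def)
  qed
  fix u assume u: "0 < u \<and> u \<le> onorm A \<and> Theta_psi A \<psi> u = s"
  then show "u = t" using less[of u t] less[of t u] t s by force
qed (use t in auto)

end

text \<open>The locale fixes what the final constant may depend on, but neither the noise level nor
  the solution nor the noise, so a constant defined inside it is independent of these by
  construction.\<close>

locale rg_setting = trace_class_operator A E
  for A :: "'a::{real_inner, complete_space} \<Rightarrow> 'a" and E +
  fixes x0 :: 'a and g :: "real \<Rightarrow> real \<Rightarrow> real" and \<psi> :: "real \<Rightarrow> real"
    and \<alpha>0 q \<tau> \<eta> c1 c2 t0 \<gamma> \<Gamma> :: real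
  assumes alpha0: "0 < \<alpha>0" and q: "0 < q" "q < 1" and tau: "1 < \<tau>" and eta: "0 < \<eta>"
    and psi_nonneg: "\<And>t. 0 \<le> t \<Longrightarrow> t \<le> onorm A \<Longrightarrow> 0 \<le> \<psi> t"
    and psi_mono: "mono_on {0..onorm A} \<psi>"
    and gamma: "1 \<le> \<gamma>"
      "\<And>\<alpha> t. 0 < \<alpha> \<Longrightarrow> 0 \<le> t \<Longrightarrow> t \<le> onorm A \<Longrightarrow> \<alpha> * \<bar>g \<alpha> t\<bar> \<le> \<gamma>"
    and residual_mono: "\<And>\<alpha> \<beta> t. 0 < \<alpha> \<Longrightarrow> \<alpha> \<le> \<beta> \<Longrightarrow> 0 \<le> t \<Longrightarrow> t \<le> onorm A \<Longrightarrow>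
      residual g \<alpha> t \<le> residual g \<beta> t"
    and residual_nonneg: "\<And>\<alpha> t. 0 < \<alpha> \<Longrightarrow> 0 \<le> t \<Longrightarrow> t \<le> onorm A \<Longrightarrow> 0 \<le> residual g \<alpha> t"
    and residual_le_1: "\<And>\<alpha> t. 0 < \<alpha> \<Longrightarrow> 0 \<le> t \<Longrightarrow> t \<le> onorm A \<Longrightarrow> residual g \<alpha> t \<le> 1"
    and Gamma: "1 \<le> \<Gamma>" "\<And>\<alpha> t. 0 < \<alpha> \<Longrightarrow> \<alpha> \<le> onorm A \<Longrightarrow> 0 \<le> t \<Longrightarrow> t \<le> onorm A \<Longrightarrow>
      residual g \<alpha> t * \<psi> t \<le> \<Gamma> * \<psi> \<alpha>"
    and c1: "1 < c1" and c2: "0 < c2" "c2 < 1" and t0: "0 < t0"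
begin

lemma psi_le: "0 \<le> s \<Longrightarrow> s \<le> t \<Longrightarrow> t \<le> onorm A \<Longrightarrow> \<psi> s \<le> \<psi> t"
  by (intro mono_onD[OF psi_mono]) auto

lemma psi_bounded: "spec_bounded \<psi> (\<psi> (onorm A))"
  by (rule spec_boundedI) (simp add: psi_nonneg psi_le)

lemma residual_bounded: "0 < \<alpha> \<Longrightarrow> spec_bounded (residual g \<alpha>) 1"
  by (rule spec_boundedI) (simp add: residual_nonneg residual_le_1)

lemma g_bounded: "0 < \<alpha> \<Longrightarrow> spec_bounded (g \<alpha>) (\<gamma> / \<alpha>)"
  by (rule spec_boundedI) (simp add: gamma pos_le_divide_eq mult.commute)

lemma shift_bounded: "0 < \<alpha> \<Longrightarrow> spec_bounded (\<lambda>t. \<alpha> / (t + \<alpha>)) 1"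
  by (rule spec_boundedI) simp

lemma inverse_sqrt_bounded: "0 < \<alpha> \<Longrightarrow> spec_bounded (\<lambda>t. 1 / sqrt (t + \<alpha>)) (1 / sqrt \<alpha>)"
  by (rule spec_boundedI) (auto intro!: divide_left_mono)

text \<open>For w = x - x0 this is, up to sign, the vector that the rule would test if the data were
  exact.\<close>

definition U :: "real \<Rightarrow> 'a \<Rightarrow> 'a" where
  "U \<alpha> = op_fun A (\<lambda>t. \<alpha> / (t + \<alpha>) * residual g \<alpha> t * t)"

lemma U_bounded:
  assumes "0 < \<alpha>"
  shows "spec_bounded (\<lambda>t. \<alpha> / (t + \<alpha>) * residual g \<alpha> t * t) (onorm A)"
proof (rule spec_boundedI)
  fix t assume t: "0 \<le> t" "t \<le> onorm A"
  have "\<alpha> / (t + \<alpha>) * residual g \<alpha> t * t \<le> 1 * 1 * t"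
    using assms t residual_nonneg[OF assms t] residual_le_1[OF assms t]
    by (intro mult_mono) auto
  then show "\<bar>\<alpha> / (t + \<alpha>) * residual g \<alpha> t * t\<bar> \<le> onorm A"
    using assms t residual_nonneg[OF assms t] by (simp add: abs_mult)
qed

abbreviation (input) "data x z \<delta> \<equiv> A x + \<delta> *\<^sub>R z"

lemma error_inner:
  assumes "0 < \<alpha>" "e \<in> E"
  shows "(x0 + w - reg_solution A g x0 (data (x0 + w) z \<delta>) \<alpha>) \<bullet> e =
    residual g \<alpha> (lam e) * (w \<bullet> e) - \<delta> * g \<alpha> (lam e) * (z \<bullet> e)"
  by (simp add: reg_solution_def inner_simps op_fun_inner[OF g_bounded[OF assms(1)] assms(2)]
      A.add A_inner[OF assms(2)] residual_def algebra_simps)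

lemma discrepancy_inner:
  assumes "0 < \<alpha>" "e \<in> E"
  shows "op_fun A (\<lambda>t. \<alpha> / (t + \<alpha>)) (A (reg_solution A g x0 (data (x0 + w) z \<delta>) \<alpha>) - data (x0 + w) z \<delta>) \<bullet> e =
    - (\<alpha> / (lam e + \<alpha>) * residual g \<alpha> (lam e) * (lam e * (w \<bullet> e) + \<delta> * (z \<bullet> e)))"
proof -
  have "(A (reg_solution A g x0 (data (x0 + w) z \<delta>) \<alpha>) - data (x0 + w) z \<delta>) \<bullet> e =
      - (residual g \<alpha> (lam e) * (lam e * (w \<bullet> e) + \<delta> * (z \<bullet> e)))"
    by (simp add: reg_solution_def inner_simps op_fun_inner[OF g_bounded[OF assms(1)] assms(2)]
        A.add A.diff A_inner[OF assms(2)] residual_def algebra_simps)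
  then show ?thesis by (simp add: op_fun_inner[OF shift_bounded[OF assms(1)] assms(2)])
qed

text \<open>The tested vector is minus \<open>U \<alpha> w\<close> minus the filtered noise damped
  by the residual, hence the plus sign; the residual is at most 1.\<close>

lemma discrepancy_near_U:
  assumes a: "0 < \<alpha>" and d: "0 < \<delta>"
  shows "norm (op_fun A (\<lambda>t. \<alpha> / (t + \<alpha>)) (A (reg_solution A g x0 (data (x0 + w) z \<delta>) \<alpha>) - data (x0 + w) z \<delta>) + U \<alpha> w)
    \<le> \<delta> * norm (op_fun A (\<lambda>t. \<alpha> / (t + \<alpha>)) z)"
proof (rule norm_le_coord)
  fix e assume e: "e \<in> E"
  let ?r = "residual g \<alpha> (lam e)" and ?s = "\<alpha> / (lam e + \<alpha>)"
  have r: "\<bar>?r\<bar> \<le> 1" by (rule spec_boundedD[OF residual_bounded[OF a] e])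
  have "\<bar>?r\<bar> * \<bar>?s * (\<delta> * (z \<bullet> e))\<bar> \<le> 1 * \<bar>?s * (\<delta> * (z \<bullet> e))\<bar>"
    by (intro mult_right_mono r) simp
  moreover have "(op_fun A (\<lambda>t. \<alpha> / (t + \<alpha>)) (A (reg_solution A g x0 (data (x0 + w) z \<delta>) \<alpha>) - data (x0 + w) z \<delta>) + U \<alpha> w) \<bullet> e
     = - (?r * (?s * (\<delta> * (z \<bullet> e))))"
    unfolding inner_add_left discrepancy_inner[OF a e] U_def op_fun_inner[OF U_bounded[OF a] e]
    by (simp add: algebra_simps add_divide_distrib)
  moreover have "\<delta> * \<bar>op_fun A (\<lambda>t. \<alpha> / (t + \<alpha>)) z \<bullet> e\<bar> = \<bar>?s * (\<delta> * (z \<bullet> e))\<bar>"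
    using d by (simp add: op_fun_inner[OF shift_bounded[OF a] e] abs_mult)
  ultimately show "\<bar>(op_fun A (\<lambda>t. \<alpha> / (t + \<alpha>)) (A (reg_solution A g x0 (data (x0 + w) z \<delta>) \<alpha>) - data (x0 + w) z \<delta>) + U \<alpha> w) \<bullet> e\<bar>
      \<le> \<delta> * \<bar>op_fun A (\<lambda>t. \<alpha> / (t + \<alpha>)) z \<bullet> e\<bar>"
    by (simp add: abs_mult)
qed (use d in simp)

lemma error_le_bias_noise:
  assumes a: "0 < \<alpha>" and d: "0 < \<delta>"
  shows "norm (x0 + w - reg_solution A g x0 (data (x0 + w) z \<delta>) \<alpha>) \<le>
    norm (op_fun A (residual g \<alpha>) w) + \<delta> * norm (op_fun A (g \<alpha>) z)"
proof -
  have "x0 + w - reg_solution A g x0 (data (x0 + w) z \<delta>) \<alpha> =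
      op_fun A (residual g \<alpha>) w - \<delta> *\<^sub>R op_fun A (g \<alpha>) z"
    by (rule eqI) (simp only: error_inner[OF a], simp add: inner_simps
        op_fun_inner[OF residual_bounded[OF a]] op_fun_inner[OF g_bounded[OF a]])
  then show ?thesis using norm_triangle_ineq4[of "op_fun A (residual g \<alpha>) w" "\<delta> *\<^sub>R op_fun A (g \<alpha>) z"] d
    by simp
qed

text \<open>Besides alpha |g| <= gamma, the bounds 0 <= r <= 1 give t |g| <= 1. Together, (t +
  alpha) alpha g^2 <= gamma + gamma^2 <= (2 gamma)^2. The norm on the right is one whose exponential
  moments are governed by N(alpha).\<close>

lemma noise_le:
  assumes a: "0 < \<alpha>"
  shows "norm (op_fun A (g \<alpha>) z) \<le> 2 * \<gamma> / sqrt \<alpha> * norm (op_fun A (\<lambda>t. 1 / sqrt (t + \<alpha>)) z)"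
proof (rule op_fun_norm_le_op_fun[OF g_bounded[OF a] inverse_sqrt_bounded[OF a]])
  fix t assume t: "0 \<le> t" "t \<le> onorm A"
  have 1: "\<alpha> * \<bar>g \<alpha> t\<bar> \<le> \<gamma>" by (rule gamma(2)[OF a t])
  have 2: "t * \<bar>g \<alpha> t\<bar> \<le> 1"
  proof -
    have "\<bar>t * g \<alpha> t\<bar> \<le> 1"
      using residual_nonneg[OF a t] residual_le_1[OF a t] by (simp add: residual_def)
    then show ?thesis using t by (simp add: abs_mult)
  qed
  have "(\<bar>g \<alpha> t\<bar> * sqrt (t + \<alpha>) * sqrt \<alpha>)\<^sup>2 = (\<alpha> * \<bar>g \<alpha> t\<bar>) * (t * \<bar>g \<alpha> t\<bar>) + (\<alpha> * \<bar>g \<alpha> t\<bar>) * (\<alpha> * \<bar>g \<alpha> t\<bar>)"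
    using a t by (simp add: power_mult_distrib) (simp add: power2_eq_square algebra_simps)
  also have "\<dots> \<le> \<gamma> * 1 + \<gamma> * \<gamma>"
    using 1 2 a t gamma(1) by (intro add_mono mult_mono) auto
  also have "\<dots> \<le> (2 * \<gamma>)\<^sup>2"
    using mult_left_mono[of 1 \<gamma> \<gamma>] gamma(1) by (simp add: power2_eq_square)
  finally have "\<bar>g \<alpha> t\<bar> * sqrt (t + \<alpha>) * sqrt \<alpha> \<le> 2 * \<gamma>"
    by (rule power2_le_imp_le) (use gamma(1) in simp)
  then show "\<bar>g \<alpha> t\<bar> \<le> 2 * \<gamma> / sqrt \<alpha> * \<bar>1 / sqrt (t + \<alpha>)\<bar>"
    using a t by (simp add: field_simps)
qed (use gamma(1) a in simp)

lemma crude_noise_le: "0 < \<alpha> \<Longrightarrow> norm (op_fun A (g \<alpha>) z) \<le> \<gamma> / \<alpha> * norm z"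
  using gamma(1) by (intro norm_op_fun_le g_bounded) auto

lemma bias_le_norm: "0 < \<alpha> \<Longrightarrow> norm (op_fun A (residual g \<alpha>) w) \<le> norm w"
  using norm_op_fun_le[OF residual_bounded, of \<alpha> w] by simp

lemma source_inner:
  assumes "w \<in> source_set A \<psi>"
  obtains v where "norm v \<le> 1" "\<And>e. e \<in> E \<Longrightarrow> w \<bullet> e = \<psi> (lam e) * (v \<bullet> e)"
  using assms by (auto simp: source_set_def op_fun_inner[OF psi_bounded])

lemma norm_op_fun_source_le:
  assumes w: "w \<in> source_set A \<psi>" and f: "spec_bounded f B" and C: "0 \<le> C"
    and le: "\<And>t. 0 \<le> t \<Longrightarrow> t \<le> onorm A \<Longrightarrow> \<bar>f t\<bar> * \<psi> t \<le> C"
  shows "norm (op_fun A f w) \<le> C"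
proof -
  obtain v where v: "norm v \<le> 1" "\<And>e. e \<in> E \<Longrightarrow> w \<bullet> e = \<psi> (lam e) * (v \<bullet> e)"
    using source_inner[OF w] by blast
  have "norm (op_fun A f w) \<le> C * norm v"
  proof (rule norm_le_coord[OF C])
    fix e assume e: "e \<in> E"
    have "(\<bar>f (lam e)\<bar> * \<psi> (lam e)) * \<bar>v \<bullet> e\<bar> \<le> C * \<bar>v \<bullet> e\<bar>"
      by (intro mult_right_mono le lam_nonneg lam_le e) simp
    then show "\<bar>op_fun A f w \<bullet> e\<bar> \<le> C * \<bar>v \<bullet> e\<bar>"
      using psi_nonneg[OF lam_nonneg lam_le[OF e]]
      by (simp add: op_fun_inner[OF f e] v(2)[OF e] abs_mult mult.assoc)
  qed
  also have "\<dots> \<le> C" using v(1) C by (simp add: mult_left_le)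
  finally show ?thesis .
qed

lemma psi_onorm_nonneg: "0 \<le> \<psi> (onorm A)"
  using onorm_pos by (intro psi_nonneg) auto

lemma norm_source_le:
  assumes w: "w \<in> source_set A \<psi>"
  shows "norm w \<le> \<psi> (onorm A)"
proof -
  have 1: "spec_bounded (\<lambda>_. 1) 1" by (rule spec_boundedI) simp
  have "op_fun A (\<lambda>_. 1) w = w" by (rule eqI) (simp add: op_fun_inner[OF 1])
  then show ?thesis
    using norm_op_fun_source_le[OF w 1 psi_onorm_nonneg] by (simp add: psi_le)
qed

text \<open>Residuals grow with the parameter, so the qualification at \<open>\<beta>\<close> also
  serves every smaller \<open>\<alpha>\<close>.\<close>

lemma bias_source_le:
  assumes w: "w \<in> source_set A \<psi>" and a: "0 < \<alpha>" "\<alpha> \<le> \<beta>" "\<beta> \<le> onorm A"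
  shows "norm (op_fun A (residual g \<alpha>) w) \<le> \<Gamma> * \<psi> \<beta>"
proof (rule norm_op_fun_source_le[OF w residual_bounded[OF a(1)]])
  show "0 \<le> \<Gamma> * \<psi> \<beta>" using Gamma(1) a psi_nonneg[of \<beta>] by simp
  fix t assume t: "0 \<le> t" "t \<le> onorm A"
  have "\<bar>residual g \<alpha> t\<bar> * \<psi> t \<le> residual g \<beta> t * \<psi> t"
    using residual_nonneg[OF a(1) t] residual_mono[OF a(1,2) t] psi_nonneg[OF t]
    by (simp add: mult_right_mono)
  also have "\<dots> \<le> \<Gamma> * \<psi> \<beta>" using a t by (intro Gamma(2)) auto
  finally show "\<bar>residual g \<alpha> t\<bar> * \<psi> t \<le> \<Gamma> * \<psi> \<beta>" .
qed

text \<open>The filter satisfies s(t) t <= beta, and the qualification bounds the rest. A grid that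
  starts above \<open>onorm A\<close> leaves the range of the qualification; there the residual is
  at most 1 and \<open>\<psi>\<close> is monotone, hence the \<open>min\<close>.\<close>

lemma U_source_le:
  assumes w: "w \<in> source_set A \<psi>" and b: "0 < \<beta>"
  shows "norm (U \<beta> w) \<le> \<beta> * (\<Gamma> * \<psi> (min \<beta> (onorm A)))"
  unfolding U_def
proof (rule norm_op_fun_source_le[OF w U_bounded[OF b]])
  have G0: "0 \<le> \<Gamma> * \<psi> (min \<beta> (onorm A))" using Gamma(1) b onorm_pos psi_nonneg by simp
  then show "0 \<le> \<beta> * (\<Gamma> * \<psi> (min \<beta> (onorm A)))" using b by simp
  fix t assume t: "0 \<le> t" "t \<le> onorm A"
  have r: "residual g \<beta> t * \<psi> t \<le> \<Gamma> * \<psi> (min \<beta> (onorm A))"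
  proof (cases "\<beta> \<le> onorm A")
    case True
    then show ?thesis using Gamma(2)[OF b True t] by (simp add: min_absorb1)
  next
    case False
    have "residual g \<beta> t * \<psi> t \<le> 1 * \<psi> t"
      using residual_le_1[OF b t] psi_nonneg[OF t] by (intro mult_right_mono) auto
    also have "\<dots> \<le> 1 * \<psi> (onorm A)" using psi_le[OF t] by simp
    also have "\<dots> \<le> \<Gamma> * \<psi> (onorm A)" using Gamma(1) psi_onorm_nonneg by (intro mult_right_mono)
    finally show ?thesis using False by simp
  qed
  have s: "\<beta> / (t + \<beta>) * t \<le> \<beta>" using b t by (simp add: pos_divide_le_eq mult_left_mono)
  have "\<bar>\<beta> / (t + \<beta>) * residual g \<beta> t * t\<bar> * \<psi> t = (\<beta> / (t + \<beta>) * t) * (residual g \<beta> t * \<psi> t)"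
    using b t residual_nonneg[OF b t] by (simp add: abs_mult)
  also have "\<dots> \<le> \<beta> * (\<Gamma> * \<psi> (min \<beta> (onorm A)))"
    by (rule mult_mono[OF s r]) (use b t residual_nonneg[OF b t] psi_nonneg[OF t] in auto)
  finally show "\<bar>\<beta> / (t + \<beta>) * residual g \<beta> t * t\<bar> * \<psi> t \<le> \<beta> * (\<Gamma> * \<psi> (min \<beta> (onorm A)))" .
qed

text \<open>Split the spectrum at b = min alpha t0, the minimum because the tail condition reaches
  only up to \<open>t0\<close>. Below b, the tail condition at b and r_b <= r_alpha, above b the
  residual itself, lead to the part \<open>V\<close> on t >= c2 b. There s(t) t is at least c2 b /
  (1 + c2), which is the price of passing to \<open>U\<close>.\<close>

lemma bias_tail_le:
  assumes tail: "tail_condition A g c1 c2 t0 w" and a: "0 < \<alpha>" "\<alpha> \<le> \<alpha>0"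
  shows "norm (op_fun A (residual g \<alpha>) w) \<le> (1 + c1) * ((1 + c2) / (c2 * min \<alpha> t0) * norm (U \<alpha> w))"
proof -
  define b where "b = min \<alpha> t0"
  have b: "0 < b" "b \<le> t0" "b \<le> \<alpha>" using a t0 by (auto simp: b_def)
  have bound: "spec_bounded (\<lambda>t. indicator B t * residual g \<beta> t) 1" if "0 < \<beta>" for B \<beta>
    using residual_bounded[OF that] by (auto simp: spec_bounded_def indicator_def)
  define V where "V = norm (op_fun A (\<lambda>t. indicator {c2 * b..} t * residual g \<alpha> t) w)"
  have "(norm (op_fun A (indicator {0..<b}) w))\<^sup>2 \<le>
      c1\<^sup>2 * (norm (op_fun A (\<lambda>t. indicator {c2 * b..} t * residual g b t) w))\<^sup>2"
    using tail[unfolded tail_condition_def, rule_format, of b] b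
    by (simp add: measure_spectral_measure set_integral_spectral_measure[OF residual_bounded[OF b(1)]])
  then have "(norm (op_fun A (indicator {0..<b}) w))\<^sup>2 \<le>
      (c1 * norm (op_fun A (\<lambda>t. indicator {c2 * b..} t * residual g b t) w))\<^sup>2"
    by (simp add: power_mult_distrib)
  then have "norm (op_fun A (indicator {0..<b}) w) \<le>
      c1 * norm (op_fun A (\<lambda>t. indicator {c2 * b..} t * residual g b t) w)"
    by (rule power2_le_imp_le) (use c1 in simp)
  also have "\<dots> \<le> c1 * (1 * V)"
    unfolding V_def
  proof (intro mult_left_mono op_fun_norm_le_op_fun[OF bound bound])
    show "\<bar>indicator {c2 * b..} t * residual g b t\<bar> \<le> 1 * \<bar>indicator {c2 * b..} t * residual g \<alpha> t\<bar>"
      if "0 \<le> t" "t \<le> onorm A" for t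
      using residual_mono[OF b(1,3) that] residual_nonneg[OF b(1) that] by (auto simp: indicator_def)
  qed (use a b c1 in auto)
  finally have low: "norm (op_fun A (indicator {0..<b}) w) \<le> c1 * V" by simp
  have split: "op_fun A (residual g \<alpha>) w =
      op_fun A (\<lambda>t. indicator {0..<b} t * residual g \<alpha> t) w + op_fun A (\<lambda>t. indicator {b..} t * residual g \<alpha> t) w"
  proof (rule eqI)
    fix e assume e: "e \<in> E"
    have "lam e \<in> {0..<b} \<or> lam e \<in> {b..}" using lam_nonneg[of e] by auto
    then show "op_fun A (residual g \<alpha>) w \<bullet> e = (op_fun A (\<lambda>t. indicator {0..<b} t * residual g \<alpha> t) w
        + op_fun A (\<lambda>t. indicator {b..} t * residual g \<alpha> t) w) \<bullet> e"
      by (auto simp: inner_simps op_fun_inner[OF bound[OF a(1)] e] op_fun_inner[OF residual_bounded[OF a(1)] e])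
  qed
  have "norm (op_fun A (\<lambda>t. indicator {0..<b} t * residual g \<alpha> t) w) \<le> 1 * norm (op_fun A (indicator {0..<b}) w)"
    by (rule op_fun_norm_le_op_fun[OF bound[OF a(1)] indicator_spec_bounded])
       (auto simp: indicator_def residual_nonneg residual_le_1 a)
  moreover have "norm (op_fun A (\<lambda>t. indicator {b..} t * residual g \<alpha> t) w) \<le> 1 * V"
    unfolding V_def
  proof (rule op_fun_norm_le_op_fun[OF bound[OF a(1)] bound[OF a(1)]])
    have "c2 * b \<le> b" using c2 b by simp
    then show "\<bar>indicator {b..} t * residual g \<alpha> t\<bar> \<le> 1 * \<bar>indicator {c2 * b..} t * residual g \<alpha> t\<bar>" for t
      by (auto simp: indicator_def)
  qed simp
  ultimately have "norm (op_fun A (residual g \<alpha>) w) \<le> (1 + c1) * V"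
    unfolding split using low
      norm_triangle_ineq[of "op_fun A (\<lambda>t. indicator {0..<b} t * residual g \<alpha> t) w"
        "op_fun A (\<lambda>t. indicator {b..} t * residual g \<alpha> t) w"]
    by (simp add: algebra_simps)
  also have "V \<le> (1 + c2) / (c2 * b) * norm (U \<alpha> w)"
    unfolding V_def U_def
  proof (rule op_fun_norm_le_op_fun[OF bound[OF a(1)] U_bounded[OF a(1)]])
    fix t assume t: "0 \<le> t" "t \<le> onorm A"
    show "\<bar>indicator {c2 * b..} t * residual g \<alpha> t\<bar> \<le>
        (1 + c2) / (c2 * b) * \<bar>\<alpha> / (t + \<alpha>) * residual g \<alpha> t * t\<bar>"
    proof (cases "c2 * b \<le> t")
      case True
      have "c2 * b * (t + \<alpha>) = c2 * (b * t) + \<alpha> * (c2 * b)" by (simp add: algebra_simps)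
      also have "\<dots> \<le> c2 * (\<alpha> * t) + \<alpha> * t"
        using True b a c2 t by (intro add_mono mult_left_mono mult_right_mono) auto
      finally have "c2 * b * (t + \<alpha>) \<le> (1 + c2) * (\<alpha> * t)" by (simp add: algebra_simps)
      moreover have pos: "0 < c2 * b * (t + \<alpha>)" using c2 b a t by simp
      ultimately have "1 \<le> (1 + c2) * (\<alpha> * t) / (c2 * b * (t + \<alpha>))" by (simp add: pos_le_divide_eq)
      then have "residual g \<alpha> t * 1 \<le> residual g \<alpha> t * ((1 + c2) * (\<alpha> * t) / (c2 * b * (t + \<alpha>)))"
        by (rule mult_left_mono) (rule residual_nonneg[OF a(1) t])
      also have "\<dots> = (1 + c2) / (c2 * b) * (\<alpha> / (t + \<alpha>) * residual g \<alpha> t * t)"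
        by simp
      finally show ?thesis using True a t residual_nonneg[OF a(1) t] by (simp add: abs_mult)
    qed (use c2 b in simp)
  qed (use c2 b in simp)
  finally show ?thesis using c1 unfolding b_def by (simp add: mult_left_mono)
qed

end

section \<open>Stopping and continuing at good grid points\<close>

context rg_setting
begin

abbreviation (input) "scaled_noise_ok \<kappa> z \<alpha> \<equiv>
  norm (op_fun A (\<lambda>t. \<alpha> / (t + \<alpha>)) z) \<le> (1 + \<kappa>) * sqrt (\<alpha> * eff_dim A \<alpha>)"

lemma stop_U_le:
  assumes a: "0 < \<alpha>" and d: "0 < \<delta>" and ok: "scaled_noise_ok \<kappa> z \<alpha>"
    and stop: "norm (op_fun A (\<lambda>t. \<alpha> / (t + \<alpha>)) (A (reg_solution A g x0 (data (x0 + w) z \<delta>) \<alpha>) - data (x0 + w) z \<delta>))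
      \<le> \<tau> * (1 + \<kappa>) * (\<delta> / rho_eff A \<alpha>)" (is "norm ?d \<le> _")
  shows "norm (U \<alpha> w) \<le> (\<tau> + 1) * ((1 + \<kappa>) * \<delta>) * sqrt (\<alpha> * eff_dim A \<alpha>)"
proof -
  have "norm (U \<alpha> w) \<le> norm (?d + U \<alpha> w) + norm ?d"
    using norm_triangle_ineq4[of "?d + U \<alpha> w" ?d] by simp
  also have "norm (?d + U \<alpha> w) \<le> \<delta> * ((1 + \<kappa>) * sqrt (\<alpha> * eff_dim A \<alpha>))"
    using discrepancy_near_U[OF a d, of w z] mult_left_mono[OF ok less_imp_le[OF d]] by linarith
  also have "norm ?d \<le> \<tau> * (1 + \<kappa>) * (\<delta> * sqrt (\<alpha> * eff_dim A \<alpha>))"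
    using stop by (simp add: rho_eff_def)
  finally show ?thesis by (simp add: algebra_simps)
qed

text \<open>The threshold exceeds the admissible noise by the factor \<open>\<tau>\<close>, so a
  failed test certifies a contribution of the signal; \<open>\<tau> > 1\<close> makes this bound
  nontrivial.\<close>

lemma not_stop_U_ge:
  assumes a: "0 < \<alpha>" and d: "0 < \<delta>" and ok: "scaled_noise_ok \<kappa> z \<alpha>"
    and stop: "\<not> norm (op_fun A (\<lambda>t. \<alpha> / (t + \<alpha>)) (A (reg_solution A g x0 (data (x0 + w) z \<delta>) \<alpha>) - data (x0 + w) z \<delta>))
      \<le> \<tau> * (1 + \<kappa>) * (\<delta> / rho_eff A \<alpha>)" (is "\<not> norm ?d \<le> _")
  shows "(\<tau> - 1) * ((1 + \<kappa>) * \<delta>) * sqrt (\<alpha> * eff_dim A \<alpha>) \<le> norm (U \<alpha> w)"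
proof -
  have "\<tau> * (1 + \<kappa>) * (\<delta> * sqrt (\<alpha> * eff_dim A \<alpha>)) \<le> norm ?d"
    using stop by (simp add: rho_eff_def)
  also have "norm ?d \<le> norm (?d + U \<alpha> w) + norm (U \<alpha> w)"
    using norm_triangle_ineq4[of "?d + U \<alpha> w" "U \<alpha> w"] by simp
  also have "norm (?d + U \<alpha> w) \<le> \<delta> * ((1 + \<kappa>) * sqrt (\<alpha> * eff_dim A \<alpha>))"
    using discrepancy_near_U[OF a d, of w z] mult_left_mono[OF ok less_imp_le[OF d]] by linarith
  finally show ?thesis by (simp add: algebra_simps)
qed

lemma not_stop_Theta_psi_ge:
  assumes w: "w \<in> source_set A \<psi>" and b: "0 < \<beta>" and d: "0 < \<delta>" and ok: "scaled_noise_ok \<kappa> z \<beta>"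
    and stop: "\<not> rg_stop A g x0 \<tau> \<eta> \<kappa> \<delta> (data (x0 + w) z \<delta>) \<beta>"
  shows "(\<tau> - 1) * ((1 + \<kappa>) * \<delta>) \<le> \<Gamma> * (Theta A \<beta> * \<psi> (min \<beta> (onorm A)))"
proof -
  let ?R = "sqrt (\<beta> * eff_dim A \<beta>)"
  have R: "0 < ?R" by (rule sqrt_mult_eff_dim_pos[OF b])
  have "(\<tau> - 1) * ((1 + \<kappa>) * \<delta>) * ?R \<le> norm (U \<beta> w)"
    by (rule not_stop_U_ge[OF b d ok]) (use stop in \<open>simp add: rg_stop_def\<close>)
  also have "\<dots> \<le> \<beta> * (\<Gamma> * \<psi> (min \<beta> (onorm A)))" by (rule U_source_le[OF w b])
  finally have "(\<tau> - 1) * ((1 + \<kappa>) * \<delta>) \<le> \<beta> * (\<Gamma> * \<psi> (min \<beta> (onorm A))) / ?R"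
    by (subst pos_le_divide_eq[OF R])
  then show ?thesis by (simp add: Theta_eq mult_ac)
qed

text \<open>\<open>D\<close> stands for (1 + kappa) delta. Above \<open>\<alpha>s\<close>
  monotonicity of \<open>Theta\<close> is enough; below it \<open>\<psi>\<close> is at most
  \<open>\<psi> \<alpha>s\<close>, and this positive factor cancels.\<close>

lemma Theta_lower:
  assumes as: "0 < \<alpha>s" "\<alpha>s \<le> onorm A" "0 < \<psi> \<alpha>s" and b: "0 < \<beta>"
    and K: "0 < K" "Theta A \<alpha>s * \<psi> \<alpha>s \<le> K * D"
    and D: "(\<tau> - 1) * D \<le> \<Gamma> * (Theta A \<beta> * \<psi> (min \<beta> (onorm A)))"
  shows "min 1 ((\<tau> - 1) / (K * \<Gamma>)) * Theta A \<alpha>s \<le> Theta A \<beta>"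
proof (cases "\<alpha>s \<le> \<beta>")
  case True
  have "min 1 ((\<tau> - 1) / (K * \<Gamma>)) * Theta A \<alpha>s \<le> 1 * Theta A \<alpha>s"
    using Theta_pos[OF as(1)] by (intro mult_right_mono) auto
  then show ?thesis using Theta_mono[OF as(1) True] by simp
next
  case False
  have KG: "0 < K * \<Gamma>" using K(1) Gamma(1) by simp
  have "(\<tau> - 1) * (Theta A \<alpha>s * \<psi> \<alpha>s) \<le> (\<tau> - 1) * (K * D)"
    using K(2) tau by (intro mult_left_mono) auto
  also have "\<dots> = K * ((\<tau> - 1) * D)" by simp
  also have "\<dots> \<le> K * (\<Gamma> * (Theta A \<beta> * \<psi> (min \<beta> (onorm A))))"
    by (rule mult_left_mono[OF D]) (use K in simp)
  also have "\<psi> (min \<beta> (onorm A)) \<le> \<psi> \<alpha>s" using False as b by (intro psi_le) auto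
  then have "K * (\<Gamma> * (Theta A \<beta> * \<psi> (min \<beta> (onorm A)))) \<le> K * (\<Gamma> * (Theta A \<beta> * \<psi> \<alpha>s))"
    using K(1) Gamma(1) Theta_pos[OF b] by (intro mult_left_mono) auto
  finally have "((\<tau> - 1) * Theta A \<alpha>s) * \<psi> \<alpha>s \<le> (K * \<Gamma> * Theta A \<beta>) * \<psi> \<alpha>s" by (simp add: mult_ac)
  then have "(\<tau> - 1) * Theta A \<alpha>s \<le> K * \<Gamma> * Theta A \<beta>"
    using as(3) by (simp add: mult_le_cancel_right)
  then have "(\<tau> - 1) / (K * \<Gamma>) * Theta A \<alpha>s \<le> Theta A \<beta>"
    using KG by (simp add: pos_divide_le_eq mult.commute)
  moreover have "min 1 ((\<tau> - 1) / (K * \<Gamma>)) * Theta A \<alpha>s \<le> (\<tau> - 1) / (K * \<Gamma>) * Theta A \<alpha>s"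
    using Theta_pos[OF as(1)] by (intro mult_right_mono) auto
  ultimately show ?thesis by linarith
qed

text \<open>The first entry serves a rule that stops at once at \<open>\<alpha>0\<close>; the second
  combines \<open>Theta_lower\<close> at the previous grid point with the factor q of one
  step.\<close>

definition theta_const :: "real \<Rightarrow> real" where
  "theta_const K = min (Theta A \<alpha>0 / Theta A (onorm A)) (q * min 1 ((\<tau> - 1) / (K * \<Gamma>)))"

lemma theta_const_pos: "0 < K \<Longrightarrow> 0 < theta_const K"
  using Theta_pos[OF alpha0] Theta_pos[OF onorm_pos] q tau Gamma(1) by (simp add: theta_const_def)

text \<open>One summand for each way to stop: not above \<open>\<alpha>s\<close>, above it by the
  second alternative, above it by the discrepancy.\<close>

definition bias_const :: "real \<Rightarrow> real" where
  "bias_const K' = \<Gamma> + \<psi> (onorm A) * \<eta> * K' +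
     (1 + c1) * ((1 + c2) / c2 * max 1 (\<alpha>0 / t0) * (\<tau> + 1) * K')"

lemma bias_stopped_le:
  assumes w: "w \<in> source_set A \<psi>" and tail: "tail_condition A g c1 c2 t0 w"
    and d: "0 < \<delta>" and a: "0 < \<alpha>" "\<alpha> \<le> \<alpha>0"
    and stop: "rg_stop A g x0 \<tau> \<eta> \<kappa> \<delta> (data (x0 + w) z \<delta>) \<alpha>" and ok: "scaled_noise_ok \<kappa> z \<alpha>"
    and as: "0 < \<alpha>s" "\<alpha>s \<le> onorm A" "0 < \<psi> \<alpha>s"
    and \<kappa>: "0 \<le> \<kappa>" and K': "0 \<le> K'" "(1 + \<kappa>) * \<delta> \<le> K' * (Theta A \<alpha>s * \<psi> \<alpha>s)"
  shows "norm (op_fun A (residual g \<alpha>) w) \<le> bias_const K' * \<psi> \<alpha>s"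
proof -
  define T1 T2 T3 where "T1 = \<Gamma>" and "T2 = \<psi> (onorm A) * \<eta> * K'"
    and "T3 = (1 + c1) * ((1 + c2) / c2 * max 1 (\<alpha>0 / t0) * (\<tau> + 1) * K')"
  have nn: "0 \<le> T1" "0 \<le> T2" "0 \<le> T3"
    using Gamma(1) psi_onorm_nonneg eta K'(1) c1 c2 tau by (auto simp: T1_def T2_def T3_def)
  have C: "bias_const K' * \<psi> \<alpha>s = T1 * \<psi> \<alpha>s + T2 * \<psi> \<alpha>s + T3 * \<psi> \<alpha>s"
    by (simp add: bias_const_def T1_def T2_def T3_def algebra_simps)
  have nn': "0 \<le> T1 * \<psi> \<alpha>s" "0 \<le> T2 * \<psi> \<alpha>s" "0 \<le> T3 * \<psi> \<alpha>s" using nn as(3) by auto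
  have Th: "0 < Theta A \<alpha>s" by (rule Theta_pos[OF as(1)])
  let ?b = "norm (op_fun A (residual g \<alpha>) w)"
  consider "\<alpha> \<le> \<alpha>s" | "\<alpha>s < \<alpha>" "Theta A \<alpha> \<le> \<eta> * (1 + \<kappa>) * \<delta>" |
    "\<alpha>s < \<alpha>" "norm (op_fun A (\<lambda>t. \<alpha> / (t + \<alpha>)) (A (reg_solution A g x0 (data (x0 + w) z \<delta>) \<alpha>) - data (x0 + w) z \<delta>))
      \<le> \<tau> * (1 + \<kappa>) * (\<delta> / rho_eff A \<alpha>)"
    using stop unfolding rg_stop_def by (metis not_le)
  then show ?thesis
  proof cases
    case 1
    then have "?b \<le> T1 * \<psi> \<alpha>s" unfolding T1_def by (rule bias_source_le[OF w a(1) _ as(2)])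
    then show ?thesis using nn' C by linarith
  next
    case 2
    \<comment> \<open>This case forces 1 <= eta K' psi at \<open>\<alpha>s\<close>, so the trivial
      bias bound \<open>norm w \<le> \<psi> (onorm A)\<close> is already of the right order.\<close>
    have "1 * Theta A \<alpha>s \<le> \<eta> * ((1 + \<kappa>) * \<delta>)" using Theta_mono[OF as(1), of \<alpha>] 2 by simp
    also have "\<dots> \<le> \<eta> * (K' * (Theta A \<alpha>s * \<psi> \<alpha>s))" by (rule mult_left_mono[OF K'(2)]) (use eta in simp)
    also have "\<dots> = (\<eta> * K' * \<psi> \<alpha>s) * Theta A \<alpha>s" by simp
    finally have "1 \<le> \<eta> * K' * \<psi> \<alpha>s" using Th by (simp add: mult_le_cancel_right)
    then have "\<psi> (onorm A) * 1 \<le> \<psi> (onorm A) * (\<eta> * K' * \<psi> \<alpha>s)"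
      by (rule mult_left_mono) (rule psi_onorm_nonneg)
    then have "?b \<le> T2 * \<psi> \<alpha>s"
      using bias_le_norm[OF a(1), of w] norm_source_le[OF w] by (simp add: T2_def mult_ac)
    then show ?thesis using nn' C by linarith
  next
    case 3
    let ?R = "sqrt (\<alpha> * eff_dim A \<alpha>)"
    define m where "m = max 1 (\<alpha>0 / t0)"
    have R: "0 < ?R" by (rule sqrt_mult_eff_dim_pos[OF a(1)])
    have mt: "0 < min \<alpha> t0" using a t0 by simp
    have "\<alpha> \<le> m * min \<alpha> t0"
    proof (cases "\<alpha> \<le> t0")
      case True
      then show ?thesis using a by (simp add: m_def mult_le_cancel_right1)
    next
      case False
      have "\<alpha> \<le> \<alpha>0 / t0 * t0" using a t0 by simp
      also have "\<dots> \<le> m * t0" using t0 by (intro mult_right_mono) (auto simp: m_def)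
      finally show ?thesis using False by simp
    qed
    then have ratio: "\<alpha> / min \<alpha> t0 \<le> m" using mt by (simp add: pos_divide_le_eq)
    have "(1 + \<kappa>) * \<delta> \<le> K' * \<psi> \<alpha>s * Theta A \<alpha>s" using K'(2) by (simp add: mult_ac)
    also have "\<dots> \<le> K' * \<psi> \<alpha>s * Theta A \<alpha>" using K'(1) as 3(1) by (intro mult_left_mono Theta_mono) auto
    also have "\<dots> = K' * \<psi> \<alpha>s * \<alpha> / ?R" by (simp add: Theta_eq)
    finally have D: "(1 + \<kappa>) * \<delta> * ?R \<le> K' * \<psi> \<alpha>s * \<alpha>"
      using R by (simp add: pos_le_divide_eq)
    have "norm (U \<alpha> w) \<le> (\<tau> + 1) * ((1 + \<kappa>) * \<delta>) * ?R"
      by (rule stop_U_le[OF a(1) d ok 3(2)])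
    also have "\<dots> = (\<tau> + 1) * ((1 + \<kappa>) * \<delta> * ?R)" by simp
    also have "\<dots> \<le> (\<tau> + 1) * (K' * \<psi> \<alpha>s * \<alpha>)"
      by (rule mult_left_mono[OF D]) (use tau in simp)
    finally have U: "norm (U \<alpha> w) \<le> (\<tau> + 1) * (K' * \<psi> \<alpha>s * \<alpha>)" .
    have "?b \<le> (1 + c1) * ((1 + c2) / (c2 * min \<alpha> t0) * norm (U \<alpha> w))" by (rule bias_tail_le[OF tail a])
    also have "\<dots> \<le> (1 + c1) * ((1 + c2) / (c2 * min \<alpha> t0) * ((\<tau> + 1) * (K' * \<psi> \<alpha>s * \<alpha>)))"
      by (intro mult_left_mono U divide_nonneg_pos mult_pos_pos mt) (use c1 c2 in auto)
    also have "\<dots> = (1 + c1) * ((1 + c2) / c2 * (\<alpha> / min \<alpha> t0) * (\<tau> + 1) * K') * \<psi> \<alpha>s"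
      by simp
    also have "\<dots> \<le> T3 * \<psi> \<alpha>s"
      unfolding T3_def m_def[symmetric]
      by (intro mult_right_mono mult_left_mono ratio) (use c1 c2 tau K'(1) as in auto)
    finally show ?thesis using nn' C by linarith
  qed
qed

text \<open>The 8 is the 2 of \<open>noise_le\<close> times the 4 in the bound that defines good
  noise.\<close>

definition good_const :: "real \<Rightarrow> real \<Rightarrow> real" where
  "good_const K K' = bias_const K' + 8 * \<gamma> * K' / theta_const K"

lemma good_error_le:
  assumes w: "w \<in> source_set A \<psi>" and tail: "tail_condition A g c1 c2 t0 w"
    and d: "0 < \<delta>" and a: "0 < \<alpha>" "\<alpha> \<le> \<alpha>0"
    and stop: "rg_stop A g x0 \<tau> \<eta> \<kappa> \<delta> (data (x0 + w) z \<delta>) \<alpha>" and ok: "scaled_noise_ok \<kappa> z \<alpha>"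
    and prev: "\<alpha> = \<alpha>0 \<or>
      \<not> rg_stop A g x0 \<tau> \<eta> \<kappa> \<delta> (data (x0 + w) z \<delta>) (\<alpha> / q) \<and> scaled_noise_ok \<kappa> z (\<alpha> / q)"
    and ok2: "norm (op_fun A (\<lambda>t. 1 / sqrt (t + \<alpha>)) z) \<le> 4 * (1 + \<kappa>) * sqrt (eff_dim A \<alpha>)"
    and as: "0 < \<alpha>s" "\<alpha>s \<le> onorm A" "0 < \<psi> \<alpha>s"
    and \<kappa>: "0 \<le> \<kappa>" and K: "0 < K" "Theta A \<alpha>s * \<psi> \<alpha>s \<le> K * ((1 + \<kappa>) * \<delta>)"
    and K': "0 \<le> K'" "(1 + \<kappa>) * \<delta> \<le> K' * (Theta A \<alpha>s * \<psi> \<alpha>s)"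
  shows "norm (x0 + w - reg_solution A g x0 (data (x0 + w) z \<delta>) \<alpha>) \<le> good_const K K' * \<psi> \<alpha>s"
proof -
  let ?c = "theta_const K"
  have c: "0 < ?c" by (rule theta_const_pos[OF K(1)])
  have Th: "0 < Theta A \<alpha>" "0 < Theta A \<alpha>s" using Theta_pos a as by auto
  have lower: "?c * Theta A \<alpha>s \<le> Theta A \<alpha>"
  proof (cases "\<alpha> = \<alpha>0")
    case True
    have "?c * Theta A \<alpha>s \<le> Theta A \<alpha>0 / Theta A (onorm A) * Theta A (onorm A)"
      by (intro mult_mono Theta_mono as less_imp_le[OF Theta_pos] divide_nonneg_nonneg alpha0 onorm_pos)
         (auto simp: theta_const_def)
    then show ?thesis using True Theta_pos[OF onorm_pos] by simp
  next
    case False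
    define b where "b = \<alpha> / q"
    have b: "0 < b" "\<alpha> = q * b" using a q by (auto simp: b_def)
    have "min 1 ((\<tau> - 1) / (K * \<Gamma>)) * Theta A \<alpha>s \<le> Theta A b"
      using prev False by (intro Theta_lower[OF as b(1) K] not_stop_Theta_psi_ge[OF w b(1) d]) (auto simp: b_def)
    then have "q * (min 1 ((\<tau> - 1) / (K * \<Gamma>)) * Theta A \<alpha>s) \<le> q * Theta A b"
      by (rule mult_left_mono) (use q in simp)
    also have "\<dots> \<le> Theta A \<alpha>" unfolding b(2) using q b by (intro Theta_scale) auto
    finally have "q * min 1 ((\<tau> - 1) / (K * \<Gamma>)) * Theta A \<alpha>s \<le> Theta A \<alpha>" by (simp add: mult.assoc)
    moreover have "?c * Theta A \<alpha>s \<le> q * min 1 ((\<tau> - 1) / (K * \<Gamma>)) * Theta A \<alpha>s"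
      by (rule mult_right_mono) (use Th in \<open>auto simp: theta_const_def\<close>)
    ultimately show ?thesis by linarith
  qed
  have "norm (op_fun A (g \<alpha>) z) \<le> 2 * \<gamma> / sqrt \<alpha> * (4 * (1 + \<kappa>) * sqrt (eff_dim A \<alpha>))"
    using noise_le[OF a(1), of z] mult_left_mono[OF ok2, of "2 * \<gamma> / sqrt \<alpha>"] gamma(1) a by auto
  then have "\<delta> * norm (op_fun A (g \<alpha>) z) \<le> \<delta> * (2 * \<gamma> / sqrt \<alpha> * (4 * (1 + \<kappa>) * sqrt (eff_dim A \<alpha>)))"
    by (rule mult_left_mono) (use d in simp)
  also have "\<dots> = 8 * \<gamma> * ((1 + \<kappa>) * \<delta>) * (sqrt (eff_dim A \<alpha>) / sqrt \<alpha>)" by simp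
  also have "\<dots> = 8 * \<gamma> * ((1 + \<kappa>) * \<delta>) / Theta A \<alpha>" by (simp add: sqrt_eff_dim_divide[OF a(1)])
  also have "\<dots> \<le> 8 * \<gamma> * (K' * (Theta A \<alpha>s * \<psi> \<alpha>s)) / Theta A \<alpha>"
    by (intro divide_right_mono mult_left_mono K'(2)) (use gamma(1) Th in auto)
  also have "\<dots> \<le> 8 * \<gamma> * (K' * (Theta A \<alpha>s * \<psi> \<alpha>s)) / (?c * Theta A \<alpha>s)"
    by (intro divide_left_mono lower mult_pos_pos c Th) (use gamma(1) K'(1) Th as in auto)
  also have "\<dots> = 8 * \<gamma> * K' / ?c * \<psi> \<alpha>s" using Th by simp
  finally have "\<delta> * norm (op_fun A (g \<alpha>) z) \<le> 8 * \<gamma> * K' / ?c * \<psi> \<alpha>s" .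
  moreover have "norm (op_fun A (residual g \<alpha>) w) \<le> bias_const K' * \<psi> \<alpha>s"
    by (rule bias_stopped_le[OF w tail d a stop ok as \<kappa> K'])
  ultimately show ?thesis
    using error_le_bias_noise[OF a(1) d, of w z] by (simp add: good_const_def distrib_right)
qed

section \<open>Length of the search\<close>

lemma grid_le: "q ^ k * \<alpha>0 \<le> \<alpha>0"
  using q alpha0 power_le_one[of q k] by (simp add: mult_le_cancel_right1)

text \<open>The square of \<open>Theta A \<alpha>\<close> is alpha / N(alpha), at most alpha /
  N(alpha0) on the grid. Below this threshold the second alternative holds whatever the data are, so
  the search ends uniformly in the noise.\<close>

lemma stop_if_small:
  assumes "0 < \<alpha>" "\<alpha> \<le> \<alpha>0" "0 < \<delta>" "0 \<le> \<kappa>" "\<alpha> \<le> eff_dim A \<alpha>0 * \<eta>\<^sup>2 * \<delta>\<^sup>2"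
  shows "rg_stop A g x0 \<tau> \<eta> \<kappa> \<delta> z \<alpha>"
proof -
  have N: "0 < eff_dim A \<alpha>0" "eff_dim A \<alpha>0 \<le> eff_dim A \<alpha>"
    using eff_dim_pos[OF alpha0] eff_dim_antimono assms by auto
  have "(Theta A \<alpha>)\<^sup>2 = \<alpha> / eff_dim A \<alpha>" by (rule Theta_sq[OF assms(1)])
  also have "\<dots> \<le> \<alpha> / eff_dim A \<alpha>0" using N assms(1) by (intro divide_left_mono) auto
  also have "\<dots> \<le> (\<eta> * \<delta>)\<^sup>2"
    using N assms(5) by (simp add: pos_divide_le_eq power_mult_distrib mult_ac)
  finally have "Theta A \<alpha> \<le> \<eta> * \<delta>" by (rule power2_le_imp_le) (use eta assms in simp)
  also have "\<dots> \<le> \<eta> * (1 + \<kappa>) * \<delta>" using eta assms by (simp add: algebra_simps)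
  finally show ?thesis by (simp add: rg_stop_def)
qed

text \<open>The largest grid point is the one with the least exponent, and \<open>GREATEST\<close>
  is attained because the rule must stop. That the previous point lies above the forced-stop
  threshold is recorded to bound \<open>k\<close>.\<close>

lemma rg_alpha_cases:
  assumes d: "0 < \<delta>" and \<kappa>: "0 \<le> \<kappa>"
  obtains k where "rg_alpha A g x0 q \<alpha>0 \<tau> \<eta> \<kappa> \<delta> z = q ^ k * \<alpha>0"
    and "rg_stop A g x0 \<tau> \<eta> \<kappa> \<delta> z (q ^ k * \<alpha>0)"
    and "k = 0 \<or> \<not> rg_stop A g x0 \<tau> \<eta> \<kappa> \<delta> z (q ^ (k - 1) * \<alpha>0)
      \<and> eff_dim A \<alpha>0 * \<eta>\<^sup>2 * \<delta>\<^sup>2 < q ^ (k - 1) * \<alpha>0"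
proof -
  define P where "P k \<longleftrightarrow> rg_stop A g x0 \<tau> \<eta> \<kappa> \<delta> z (q ^ k * \<alpha>0)" for k
  have small: "P k" if "q ^ k * \<alpha>0 \<le> eff_dim A \<alpha>0 * \<eta>\<^sup>2 * \<delta>\<^sup>2" for k
    unfolding P_def using that q alpha0 by (intro stop_if_small grid_le d \<kappa>) auto
  have "0 < eff_dim A \<alpha>0 * \<eta>\<^sup>2 * \<delta>\<^sup>2 / \<alpha>0" using eff_dim_pos[OF alpha0] eta d alpha0 by simp
  then obtain n where "q ^ n < eff_dim A \<alpha>0 * \<eta>\<^sup>2 * \<delta>\<^sup>2 / \<alpha>0"
    using real_arch_pow_inv q(2) by blast
  then have "P n" using alpha0 by (intro small) (simp add: pos_less_divide_eq)
  define k where "k = (LEAST k. P k)"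
  have k: "P k" "\<And>j. j < k \<Longrightarrow> \<not> P j"
    unfolding k_def using LeastI[of P n] \<open>P n\<close> not_less_Least by auto
  have "rg_alpha A g x0 q \<alpha>0 \<tau> \<eta> \<kappa> \<delta> z = q ^ k * \<alpha>0"
    unfolding rg_alpha_def
  proof (rule Greatest_equality)
    show "q ^ k * \<alpha>0 \<in> rg_grid q \<alpha>0 \<and> rg_stop A g x0 \<tau> \<eta> \<kappa> \<delta> z (q ^ k * \<alpha>0)"
      using k(1) by (auto simp: rg_grid_def P_def)
    fix y assume "y \<in> rg_grid q \<alpha>0 \<and> rg_stop A g x0 \<tau> \<eta> \<kappa> \<delta> z y"
    then obtain j where j: "y = q ^ j * \<alpha>0" "P j" by (auto simp: rg_grid_def P_def)
    then have "k \<le> j" using k(2) by (meson not_le)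
    then show "y \<le> q ^ k * \<alpha>0" using j(1) q alpha0 by (simp add: power_decreasing)
  qed
  moreover have "k = 0 \<or> \<not> P (k - 1) \<and> eff_dim A \<alpha>0 * \<eta>\<^sup>2 * \<delta>\<^sup>2 < q ^ (k - 1) * \<alpha>0"
  proof (cases "k = 0")
    case False
    then have "\<not> P (k - 1)" using k(2) by simp
    then show ?thesis using small not_le by blast
  qed simp
  ultimately show ?thesis using that k(1) unfolding P_def by blast
qed

definition steps_const :: real where
  "steps_const = 2 + (\<bar>ln (\<alpha>0 / (eff_dim A \<alpha>0 * \<eta>\<^sup>2))\<bar> + 2) / ln (1 / q)"

lemma steps_const_ge: "2 \<le> steps_const"
  using q by (simp add: steps_const_def)

text \<open>Taking logarithms bounds k - 1; the leading 2 of \<open>steps_const\<close> pays for the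
  shift to k + 1, the number of grid points tested.\<close>

lemma steps_le:
  assumes d: "0 < \<delta>" and k: "k = 0 \<or> eff_dim A \<alpha>0 * \<eta>\<^sup>2 * \<delta>\<^sup>2 < q ^ (k - 1) * \<alpha>0"
  shows "real k + 1 \<le> steps_const * (1 + \<bar>ln (1 / \<delta>)\<bar>)"
proof (cases k)
  case 0
  have "1 * 1 \<le> steps_const * (1 + \<bar>ln (1 / \<delta>)\<bar>)"
    using steps_const_ge by (intro mult_mono) auto
  then show ?thesis using 0 by simp
next
  case (Suc j)
  define c where "c = \<bar>ln (\<alpha>0 / (eff_dim A \<alpha>0 * \<eta>\<^sup>2))\<bar>"
  define L where "L = \<bar>ln (1 / \<delta>)\<bar>"
  have lq: "0 < ln (1 / q)" using q by simp
  have N: "0 < eff_dim A \<alpha>0 * \<eta>\<^sup>2" using eff_dim_pos[OF alpha0] eta by simp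
  have "eff_dim A \<alpha>0 * \<eta>\<^sup>2 * \<delta>\<^sup>2 < q ^ j * \<alpha>0" using k Suc by simp
  then have "(1 / q) ^ j < \<alpha>0 / (eff_dim A \<alpha>0 * \<eta>\<^sup>2) * (1 / \<delta>)\<^sup>2"
  proof -
    have pos: "0 < eff_dim A \<alpha>0 * \<eta>\<^sup>2 * \<delta>\<^sup>2" using N d by simp
    have "1 / q ^ j < \<alpha>0 / (eff_dim A \<alpha>0 * \<eta>\<^sup>2 * \<delta>\<^sup>2)"
      unfolding pos_less_divide_eq[OF pos] using \<open>_ < q ^ j * \<alpha>0\<close> q
      by (simp add: pos_divide_less_eq mult.commute)
    then show ?thesis by (simp add: power_divide)
  qed
  then have "ln ((1 / q) ^ j) < ln (\<alpha>0 / (eff_dim A \<alpha>0 * \<eta>\<^sup>2) * (1 / \<delta>)\<^sup>2)"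
    using q by (subst ln_less_cancel_iff) (use N alpha0 d in auto)
  also have "\<dots> = ln (\<alpha>0 / (eff_dim A \<alpha>0 * \<eta>\<^sup>2)) + 2 * ln (1 / \<delta>)"
    using N alpha0 d by (subst ln_mult_pos) (auto simp: ln_realpow)
  also have "\<dots> \<le> c + 2 * L" unfolding c_def L_def by linarith
  also have "\<dots> \<le> (c + 2) * (1 + L)" unfolding c_def L_def by (simp add: algebra_simps)
  finally have "real j * ln (1 / q) \<le> (c + 2) * (1 + L)" using q by (simp add: ln_realpow)
  then have "real j \<le> (c + 2) / ln (1 / q) * (1 + L)" using lq by (simp add: pos_le_divide_eq)
  moreover have "2 * 1 \<le> 2 * (1 + L)" by (simp add: L_def)
  ultimately have "real j + 2 \<le> (2 + (c + 2) / ln (1 / q)) * (1 + L)" by (simp only: distrib_right)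
  then show ?thesis by (simp add: Suc steps_const_def c_def L_def)
qed

end

section \<open>Mean square error of the RG-rule\<close>

context noise_model
begin

lemma op_fun_zeta_measurable:
  assumes "spec_bounded f B"
  shows "(\<lambda>\<omega>. norm (op_fun A f (\<zeta> \<omega>))) \<in> borel_measurable M"
proof -
  have "(\<lambda>\<omega>. op_fun A f (\<zeta> \<omega>)) \<in> borel_measurable M"
    by (rule measurable_compose[OF zeta_measurable borel_measurable_continuous_onI[OF continuous_op_fun[OF assms]]])
  then show ?thesis by measurable
qed

text \<open>The parameter 1 / alpha is admissible because 4 alpha lam <= (lam + alpha)^2. As the
  filter is at most 1, the trace of the quadratic form is at most alpha N(alpha).\<close>

lemma exp_moment_shift:
  assumes a: "0 < \<alpha>"
  shows "(\<integral>\<^sup>+\<omega>. ennreal (exp ((norm (op_fun A (\<lambda>t. \<alpha> / (t + \<alpha>)) (\<zeta> \<omega>)))\<^sup>2 / \<alpha>)) \<partial>M)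
    \<le> ennreal (exp (2 * eff_dim A \<alpha>))"
proof -
  have b: "spec_bounded (\<lambda>t. \<alpha> / (t + \<alpha>)) 1" by (rule spec_boundedI) (use a in simp)
  have pos: "0 < lam e + \<alpha>" for e using a lam_nonneg[of e] by linarith
  have le: "(\<alpha> / (lam e + \<alpha>))\<^sup>2 * lam e \<le> \<alpha> * (lam e / (lam e + \<alpha>))" for e
  proof -
    have "\<alpha> / (lam e + \<alpha>) \<le> 1" "0 \<le> \<alpha> / (lam e + \<alpha>)" using a pos[of e] lam_nonneg[of e] by auto
    then have "(\<alpha> / (lam e + \<alpha>) * lam e) * (\<alpha> / (lam e + \<alpha>)) \<le> (\<alpha> / (lam e + \<alpha>) * lam e) * 1"
      by (intro mult_left_mono mult_nonneg_nonneg lam_nonneg)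
    then show ?thesis by (simp add: power2_eq_square mult_ac)
  qed
  have sum: "((\<lambda>e. \<alpha> * (lam e / (lam e + \<alpha>))) has_sum \<alpha> * eff_dim A \<alpha>) E"
    by (intro has_sum_cmult_right eff_dim_has_sum a)
  then have "(\<lambda>e. (\<alpha> / (lam e + \<alpha>))\<^sup>2 * lam e) summable_on E"
    by (rule summable_on_comparison_test[OF has_sum_imp_summable]) (rule le, simp add: lam_nonneg)
  then obtain S where S: "((\<lambda>e. (\<alpha> / (lam e + \<alpha>))\<^sup>2 * lam e) has_sum S) E" by (auto simp: summable_on_def)
  have "(\<integral>\<^sup>+\<omega>. ennreal (exp ((1 / \<alpha>) * (norm (op_fun A (\<lambda>t. \<alpha> / (t + \<alpha>)) (\<zeta> \<omega>)))\<^sup>2)) \<partial>M)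
      \<le> ennreal (exp (2 * (1 / \<alpha>) * S))"
  proof (rule zeta_exp_moment[OF b _ _ S])
    fix e
    have "4 * \<alpha> * lam e \<le> (lam e + \<alpha>)\<^sup>2"
      using sum_squares_bound[of "lam e" \<alpha>] by (simp add: power2_sum mult_ac)
    then show "4 * ((1 / \<alpha>) * ((\<alpha> / (lam e + \<alpha>))\<^sup>2 * lam e)) \<le> 1"
      using a pos[of e] by (simp add: power_divide power2_eq_square pos_divide_le_eq)
  qed (use a in simp)
  also have "\<dots> \<le> ennreal (exp (2 * eff_dim A \<alpha>))"
  proof -
    have "S \<le> \<alpha> * eff_dim A \<alpha>" by (rule has_sum_mono[OF S sum le])
    then have "2 * (1 / \<alpha>) * S \<le> 2 * eff_dim A \<alpha>" using a by (simp add: pos_divide_le_eq mult.commute)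
    then show ?thesis by (simp add: ennreal_leI)
  qed
  finally show ?thesis by simp
qed

text \<open>The quadratic form has eigenvalues lam / (lam + alpha) <= 1, which admits the parameter
  1/4, and trace exactly N(alpha).\<close>

lemma exp_moment_inverse_sqrt:
  assumes a: "0 < \<alpha>"
  shows "(\<integral>\<^sup>+\<omega>. ennreal (exp ((norm (op_fun A (\<lambda>t. 1 / sqrt (t + \<alpha>)) (\<zeta> \<omega>)))\<^sup>2 / 4)) \<partial>M)
    \<le> ennreal (exp (eff_dim A \<alpha> / 2))"
proof -
  have b: "spec_bounded (\<lambda>t. 1 / sqrt (t + \<alpha>)) (1 / sqrt \<alpha>)"
    by (rule spec_boundedI) (use a in \<open>auto intro!: divide_left_mono\<close>)
  have pos: "0 < lam e + \<alpha>" for e using a lam_nonneg[of e] by linarith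
  have eq: "(1 / sqrt (lam e + \<alpha>))\<^sup>2 * lam e = lam e / (lam e + \<alpha>)" for e
    using pos[of e] by (simp add: power_divide)
  have S: "((\<lambda>e. (1 / sqrt (lam e + \<alpha>))\<^sup>2 * lam e) has_sum eff_dim A \<alpha>) E"
    unfolding eq by (rule eff_dim_has_sum[OF a])
  have "(\<integral>\<^sup>+\<omega>. ennreal (exp ((1 / 4) * (norm (op_fun A (\<lambda>t. 1 / sqrt (t + \<alpha>)) (\<zeta> \<omega>)))\<^sup>2)) \<partial>M)
      \<le> ennreal (exp (2 * (1 / 4) * eff_dim A \<alpha>))"
  proof (rule zeta_exp_moment[OF b _ _ S])
    show "4 * ((1 / 4) * ((1 / sqrt (lam e + \<alpha>))\<^sup>2 * lam e)) \<le> 1" for e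
      unfolding eq using a pos[of e] by simp
  qed simp
  then show ?thesis by simp
qed

lemma exp_moment_zeta:
  "(\<integral>\<^sup>+\<omega>. ennreal (exp ((norm (\<zeta> \<omega>))\<^sup>2 / (4 * onorm A))) \<partial>M)
    \<le> ennreal (exp ((\<Sum>\<^sub>\<infinity>e\<in>E. lam e) / (2 * onorm A)))"
proof -
  have b: "spec_bounded (\<lambda>_. 1) 1" by (rule spec_boundedI) simp
  have id: "op_fun A (\<lambda>_. 1) x = x" for x by (rule eqI) (simp add: op_fun_inner[OF b])
  have S: "((\<lambda>e. 1\<^sup>2 * lam e) has_sum (\<Sum>\<^sub>\<infinity>e\<in>E. lam e)) E" using summable_lam by simp
  have "(\<integral>\<^sup>+\<omega>. ennreal (exp (1 / (4 * onorm A) * (norm (op_fun A (\<lambda>_. 1) (\<zeta> \<omega>)))\<^sup>2)) \<partial>M)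
      \<le> ennreal (exp (2 * (1 / (4 * onorm A)) * (\<Sum>\<^sub>\<infinity>e\<in>E. lam e)))"
  proof (rule zeta_exp_moment[OF b _ _ S])
    show "4 * (1 / (4 * onorm A) * (1\<^sup>2 * lam e)) \<le> 1" if "e \<in> E" for e
      using onorm_pos lam_le[OF that] by simp
  qed (use onorm_pos in simp)
  then show ?thesis by (simp add: id)
qed

end

text \<open>Reduces the fourth moment of the crude bound to \<open>exp_moment_zeta\<close>, with a
  the norm of \<open>A\<close>.\<close>

lemma power4_le_exp:
  fixes z a :: real
  assumes a: "0 < a"
  shows "(1 + z) ^ 4 \<le> 4 * (2 + 8 * a)\<^sup>2 * exp (z\<^sup>2 / (4 * a))"
proof -
  define u where "u = z\<^sup>2 / (4 * a)"
  have u: "0 \<le> u" "z\<^sup>2 = 4 * a * u" using a by (auto simp: u_def)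
  have "(1 + z)\<^sup>2 \<le> 2 + 2 * z\<^sup>2" using sum_squares_bound[of 1 z] by (simp add: power2_sum)
  also have "\<dots> \<le> (2 + 8 * a) * (1 + u)" using a u by (simp add: algebra_simps)
  also have "\<dots> \<le> (2 + 8 * a) * (2 * exp (u / 2))"
  proof (rule mult_left_mono)
    show "1 + u \<le> 2 * exp (u / 2)" using exp_ge_add_one_self[of "u / 2"] by linarith
  qed (use a in simp)
  finally have "((1 + z)\<^sup>2)\<^sup>2 \<le> ((2 + 8 * a) * (2 * exp (u / 2)))\<^sup>2" by (rule power_mono) simp
  also have "\<dots> = 4 * (2 + 8 * a)\<^sup>2 * exp u"
    by (simp add: power_mult_distrib flip: exp_double)
  finally show ?thesis by (simp add: u_def)
qed

lemma rms_norm_le: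
  assumes C: "0 \<le> C" and le: "(\<integral>\<^sup>+\<omega>. ennreal ((norm (F \<omega>))\<^sup>2) \<partial>M) \<le> ennreal (C\<^sup>2)"
  shows "rms_norm M F \<le> ennreal C"
proof -
  define e where "e = (\<integral>\<^sup>+\<omega>. ennreal ((norm (F \<omega>))\<^sup>2) \<partial>M)"
  have fin: "e \<noteq> \<infinity>" using le by (auto simp: e_def top_unique)
  have "enn2real e \<le> enn2real (ennreal (C\<^sup>2))" using le unfolding e_def by (rule enn2real_mono) simp
  then have "sqrt (enn2real e) \<le> C" using C by (intro real_le_lsqrt) auto
  then show ?thesis using fin by (simp add: rms_norm_def e_def[symmetric] ennreal_leI)
qed

locale rg_noise = noise_model A E M \<xi> T \<zeta> + rg_setting A E x0 g \<psi> \<alpha>0 q \<tau> \<eta> c1 c2 t0 \<gamma> \<Gamma>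
  for A :: "'a::{real_inner, complete_space} \<Rightarrow> 'a" and E and M :: "'w measure"
    and \<xi> :: "'b::real_inner \<Rightarrow> 'w \<Rightarrow> real" and T \<zeta> x0 g \<psi> \<alpha>0 q \<tau> \<eta> c1 c2 t0 \<gamma> \<Gamma>
begin

text \<open>Bounds delta times the crude error. The first summand covers delta times the bias; the
  bracket covers delta^2 / alpha where the rule stops, at \<open>\<alpha>0\<close> or one step below
  a point above the forced-stop threshold.\<close>

definition crude_const :: real where
  "crude_const = Theta A (onorm A) * \<psi> (onorm A) * \<psi> (onorm A) +
     \<gamma> * ((Theta A (onorm A) * \<psi> (onorm A))\<^sup>2 / \<alpha>0 + 1 / (q * (eff_dim A \<alpha>0 * \<eta>\<^sup>2)))"

definition moment_const :: real where
  "moment_const = crude_const ^ 4 * (4 * (2 + 8 * onorm A)\<^sup>2) *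
     exp ((\<Sum>\<^sub>\<infinity>e\<in>E. lam e) / (2 * onorm A))"

text \<open>The arguments of \<open>good_const\<close> compare kappa = sqrt (8 L / N(alpha0)) with
  sqrt L in both directions. The exponential serves the noise levels with kappa < 1/2, where 8 L <=
  N(alpha0) / 4.\<close>

definition mse_const :: real where
  "mse_const =
     (good_const (max 1 (sqrt (eff_dim A \<alpha>0 / 8))) (max 1 (sqrt (8 / eff_dim A \<alpha>0))))\<^sup>2 +
     (moment_const + 2 * steps_const + exp (eff_dim A \<alpha>0 / 4)) * (Theta A (onorm A))\<^sup>2"

lemma moment_const_nonneg: "0 \<le> moment_const" by (simp add: moment_const_def)

lemma mse_const_nonneg: "0 \<le> mse_const"
  using moment_const_nonneg steps_const_ge by (simp add: mse_const_def)

lemma mse_le: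
  assumes w: "w \<in> source_set A \<psi>" and tail: "tail_condition A g c1 c2 t0 w" and d: "0 < \<delta>"
    and as: "0 < \<alpha>s" "\<alpha>s \<le> onorm A" "0 < \<psi> \<alpha>s"
    and s: "Theta A \<alpha>s * \<psi> \<alpha>s = \<delta> * (1 + sqrt \<bar>ln (1 / \<delta>)\<bar>)"
  defines "err z \<equiv> x0 + w - reg_solution A g x0 (data (x0 + w) z \<delta>)
      (rg_alpha A g x0 q \<alpha>0 \<tau> \<eta> (rg_kappa A \<alpha>0 \<delta>) \<delta> (data (x0 + w) z \<delta>))"
  shows "(\<integral>\<^sup>+\<omega>. ennreal ((norm (err (\<zeta> \<omega>)))\<^sup>2) \<partial>M) \<le> ennreal (mse_const * (\<psi> \<alpha>s)\<^sup>2)"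
proof -
  define L where "L = \<bar>ln (1 / \<delta>)\<bar>"
  define N0 where "N0 = eff_dim A \<alpha>0"
  define \<kappa> where "\<kappa> = rg_kappa A \<alpha>0 \<delta>"
  define K where "K = max 1 (sqrt (N0 / 8))"
  define K' where "K' = max 1 (sqrt (8 / N0))"
  define S where "S = \<delta> * (1 + sqrt L)"
  have L: "0 \<le> L" by (simp add: L_def)
  have N0: "0 < N0" unfolding N0_def by (rule eff_dim_pos[OF alpha0])
  have kap_eq: "\<kappa> = sqrt (8 * L / N0)" by (simp add: \<kappa>_def rg_kappa_def L_def N0_def)
  have kap: "0 \<le> \<kappa>" "\<kappa>\<^sup>2 * N0 = 8 * L" using L N0 by (auto simp: kap_eq)
  have K: "0 < K" "sqrt L \<le> K * \<kappa>" "1 \<le> K"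
  proof -
    have "sqrt L = sqrt (N0 / 8) * \<kappa>" unfolding kap_eq using N0 by (simp flip: real_sqrt_mult)
    also have "\<dots> \<le> K * \<kappa>" using kap by (intro mult_right_mono) (auto simp: K_def)
    finally show "sqrt L \<le> K * \<kappa>" .
  qed (auto simp: K_def)
  have K': "0 \<le> K'" "\<kappa> \<le> K' * sqrt L" "1 \<le> K'"
  proof -
    have "\<kappa> = sqrt (8 / N0) * sqrt L" unfolding kap_eq by (simp flip: real_sqrt_mult)
    also have "\<dots> \<le> K' * sqrt L" using L by (intro mult_right_mono) (auto simp: K'_def)
    finally show "\<kappa> \<le> K' * sqrt L" .
  qed (auto simp: K'_def)
  have sS: "Theta A \<alpha>s * \<psi> \<alpha>s = S" using s by (simp add: S_def L_def)
  have SK: "Theta A \<alpha>s * \<psi> \<alpha>s \<le> K * ((1 + \<kappa>) * \<delta>)"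
  proof -
    have "1 + sqrt L \<le> K * (1 + \<kappa>)" using K by (simp add: algebra_simps)
    then have "\<delta> * (1 + sqrt L) \<le> \<delta> * (K * (1 + \<kappa>))" using d by (intro mult_left_mono) auto
    then show ?thesis unfolding sS S_def by (simp add: mult_ac)
  qed
  have SK': "(1 + \<kappa>) * \<delta> \<le> K' * (Theta A \<alpha>s * \<psi> \<alpha>s)"
  proof -
    have "1 + \<kappa> \<le> K' * (1 + sqrt L)" using K' by (simp add: algebra_simps)
    then have "(1 + \<kappa>) * \<delta> \<le> K' * (1 + sqrt L) * \<delta>" using d by (intro mult_right_mono) auto
    then show ?thesis unfolding sS S_def by (simp add: mult_ac)
  qed
  define Tm where "Tm = Theta A (onorm A)"
  have Tm: "0 < Tm" unfolding Tm_def by (rule Theta_pos[OF onorm_pos])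
  have S_le: "S \<le> Tm * \<psi> \<alpha>s"
    unfolding sS[symmetric] Tm_def using as by (intro mult_right_mono Theta_mono) auto
  \<comment> \<open>As delta (1 + sqrt L) is a value of \<open>Theta_psi\<close>, delta cannot
    exceed \<open>sm\<close>.\<close>
  define sm where "sm = Tm * \<psi> (onorm A)"
  have "\<delta> * 1 \<le> S" unfolding S_def using d L by (intro mult_left_mono) auto
  also have "S \<le> sm" using S_le psi_le[of \<alpha>s "onorm A"] as Tm unfolding sm_def
    by (meson less_imp_le mult_left_mono order_refl order_trans)
  finally have d_sm: "\<delta> \<le> sm" by simp
  define Z where "Z z = crude_const / \<delta> * (1 + norm z)" for z :: 'a
  have k_cases: "\<exists>k. rg_alpha A g x0 q \<alpha>0 \<tau> \<eta> \<kappa> \<delta> y = q ^ k * \<alpha>0 \<and>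
      rg_stop A g x0 \<tau> \<eta> \<kappa> \<delta> y (q ^ k * \<alpha>0) \<and>
      (k = 0 \<or> \<not> rg_stop A g x0 \<tau> \<eta> \<kappa> \<delta> y (q ^ (k - 1) * \<alpha>0) \<and> N0 * \<eta>\<^sup>2 * \<delta>\<^sup>2 < q ^ (k - 1) * \<alpha>0)" for y
    using rg_alpha_cases[OF d kap(1), of y] unfolding N0_def by metis
  have crude: "norm (err z) \<le> Z z" for z
  proof -
    obtain k where k: "rg_alpha A g x0 q \<alpha>0 \<tau> \<eta> \<kappa> \<delta> (data (x0 + w) z \<delta>) = q ^ k * \<alpha>0"
      "k = 0 \<or> N0 * \<eta>\<^sup>2 * \<delta>\<^sup>2 < q ^ (k - 1) * \<alpha>0"
      using k_cases by blast
    define \<alpha> where "\<alpha> = q ^ k * \<alpha>0"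
    have a: "0 < \<alpha>" using q alpha0 by (simp add: \<alpha>_def)
    have Nd: "0 < N0 * \<eta>\<^sup>2" using N0 eta by simp
    have "\<delta>\<^sup>2 / \<alpha> \<le> \<delta>\<^sup>2 / \<alpha>0 + 1 / (q * (N0 * \<eta>\<^sup>2))"
    proof (cases "k = 0")
      case True
      then show ?thesis using q Nd by (simp add: \<alpha>_def)
    next
      case False
      then have "N0 * \<eta>\<^sup>2 * \<delta>\<^sup>2 < q ^ (k - 1) * \<alpha>0" using k(2) by blast
      then have "q * (N0 * \<eta>\<^sup>2 * \<delta>\<^sup>2) \<le> q * (q ^ (k - 1) * \<alpha>0)" using q by (intro mult_left_mono) auto
      also have "\<dots> = \<alpha>" using False by (cases k) (auto simp: \<alpha>_def)
      finally have "\<delta>\<^sup>2 / \<alpha> \<le> \<delta>\<^sup>2 / (q * (N0 * \<eta>\<^sup>2 * \<delta>\<^sup>2))"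
        using a q Nd d by (intro divide_left_mono) auto
      also have "\<dots> = 1 / (q * (N0 * \<eta>\<^sup>2))" using d by simp
      finally show ?thesis using alpha0 by (simp add: add_increasing)
    qed
    also have "\<dots> \<le> sm\<^sup>2 / \<alpha>0 + 1 / (q * (N0 * \<eta>\<^sup>2))"
      using d_sm d alpha0 by (intro add_right_mono divide_right_mono power_mono) auto
    finally have r: "\<delta>\<^sup>2 / \<alpha> \<le> sm\<^sup>2 / \<alpha>0 + 1 / (q * (N0 * \<eta>\<^sup>2))" (is "_ \<le> ?Q") .
    have "norm (err z) \<le> norm (op_fun A (residual g \<alpha>) w) + \<delta> * norm (op_fun A (g \<alpha>) z)"
      unfolding err_def k(1)[unfolded \<kappa>_def] \<alpha>_def[symmetric] by (rule error_le_bias_noise[OF a d])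
    also have "\<dots> \<le> \<psi> (onorm A) + \<delta> * (\<gamma> / \<alpha> * norm z)"
      using bias_le_norm[OF a, of w] norm_source_le[OF w] crude_noise_le[OF a, of z] d
      by (intro add_mono mult_left_mono) auto
    finally have "\<delta> * norm (err z) \<le> \<delta> * (\<psi> (onorm A) + \<delta> * (\<gamma> / \<alpha> * norm z))"
      using d by (intro mult_left_mono) auto
    also have "\<dots> = \<delta> * \<psi> (onorm A) + \<gamma> * (\<delta>\<^sup>2 / \<alpha>) * norm z"
      by (simp add: algebra_simps power2_eq_square)
    also have "\<dots> \<le> sm * \<psi> (onorm A) + \<gamma> * ?Q * norm z"
      using d_sm r gamma(1) psi_onorm_nonneg by (intro add_mono mult_right_mono mult_left_mono) auto
    also have "\<dots> \<le> (sm * \<psi> (onorm A) + \<gamma> * ?Q) * (1 + norm z)"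
    proof -
      have expand: "p + r * n \<le> (p + r) * (1 + n)" if "0 \<le> p" "0 \<le> r" "0 \<le> n" for p r n :: real
        using that mult_nonneg_nonneg[of p n] by (simp add: algebra_simps)
      have "0 \<le> sm * \<psi> (onorm A)" "0 \<le> \<gamma> * ?Q"
        using d_sm d psi_onorm_nonneg gamma(1) q Nd alpha0 by auto
      then show ?thesis by (rule expand) simp
    qed
    also have "sm * \<psi> (onorm A) + \<gamma> * ?Q = crude_const" by (simp add: crude_const_def sm_def Tm_def N0_def)
    finally show ?thesis using d by (simp add: Z_def pos_le_divide_eq mult.commute)
  qed
  define e0 where "e0 z = exp ((norm z)\<^sup>2 / (4 * onorm A))" for z :: 'a
  define c0 where "c0 = \<delta>\<^sup>2 * (crude_const ^ 4 * (4 * (2 + 8 * onorm A)\<^sup>2))"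
  have c0: "0 \<le> c0" by (simp add: c0_def)
  have split: "(norm (err z))\<^sup>2 \<le> c0 * e0 z + 1 / \<delta> ^ 6" for z
  proof -
    have "(norm (err z))\<^sup>2 \<le> (Z z)\<^sup>2" using crude[of z] by (rule power_mono) simp
    also have "\<dots> = (\<delta> ^ 3 * (Z z)\<^sup>2) * (1 / \<delta> ^ 3)" using d by simp
    also have "\<dots> \<le> (\<delta> ^ 3 * (Z z)\<^sup>2)\<^sup>2 + (1 / \<delta> ^ 3)\<^sup>2"
    proof -
      have "a * b \<le> a\<^sup>2 + b\<^sup>2" for a b :: real
        using sum_squares_bound[of a b] zero_le_power2[of a] zero_le_power2[of b] by linarith
      then show ?thesis .
    qed
    also have "(\<delta> ^ 3 * (Z z)\<^sup>2)\<^sup>2 = \<delta>\<^sup>2 * (crude_const ^ 4 * (1 + norm z) ^ 4)"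
    proof -
      have "(\<delta> ^ 3 * (Z z)\<^sup>2)\<^sup>2 = \<delta>\<^sup>2 * (\<delta> * Z z) ^ 4"
        by (simp add: power_mult_distrib mult.assoc[symmetric] flip: power_mult power_add)
      also have "\<delta> * Z z = crude_const * (1 + norm z)" using d by (simp add: Z_def)
      finally show ?thesis by (simp only: power_mult_distrib)
    qed
    also have "\<dots> \<le> \<delta>\<^sup>2 * (crude_const ^ 4 * (4 * (2 + 8 * onorm A)\<^sup>2 * exp ((norm z)\<^sup>2 / (4 * onorm A))))"
      by (intro mult_left_mono power4_le_exp onorm_pos) auto
    also have "\<dots> = c0 * e0 z" by (simp add: c0_def e0_def)
    finally show ?thesis by (simp add: power_divide flip: power_mult)
  qed
  have E0: "(\<integral>\<^sup>+\<omega>. ennreal (c0 * e0 (\<zeta> \<omega>)) \<partial>M) \<le> ennreal (\<delta>\<^sup>2 * moment_const)"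
  proof -
    have "(\<integral>\<^sup>+\<omega>. ennreal (c0 * e0 (\<zeta> \<omega>)) \<partial>M) = ennreal c0 * (\<integral>\<^sup>+\<omega>. ennreal (e0 (\<zeta> \<omega>)) \<partial>M)"
      by (subst nn_integral_cmult[symmetric]) (auto simp: e0_def c0 ennreal_mult)
    also have "\<dots> \<le> ennreal c0 * ennreal (exp ((\<Sum>\<^sub>\<infinity>e\<in>E. lam e) / (2 * onorm A)))"
      unfolding e0_def by (intro mult_left_mono exp_moment_zeta) simp
    also have "\<dots> = ennreal (\<delta>\<^sup>2 * moment_const)"
      by (simp add: c0 c0_def moment_const_def mult_ac flip: ennreal_mult)
    finally show ?thesis .
  qed
  have [measurable]: "(\<lambda>\<omega>. e0 (\<zeta> \<omega>)) \<in> borel_measurable M" unfolding e0_def by measurable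
  have ln_d: "exp (- (8 * L)) \<le> \<delta> ^ 8" "1 / \<delta> ^ 8 \<le> exp (8 * L)"
  proof -
    \<comment> \<open>Only an inequality, since delta may exceed 1 and L is an absolute
      value.\<close>
    have "- L \<le> ln \<delta>" using d by (simp add: L_def ln_div)
    then have "exp (8 * (- L)) \<le> exp (8 * ln \<delta>)" by simp
    also have "\<dots> = \<delta> ^ 8" using d exp_of_nat_mult[of 8 "ln \<delta>"] by simp
    finally show "exp (- (8 * L)) \<le> \<delta> ^ 8" by simp
    then have "1 / \<delta> ^ 8 \<le> 1 / exp (- (8 * L))" using d by (intro divide_left_mono) auto
    then show "1 / \<delta> ^ 8 \<le> exp (8 * L)" by (simp add: exp_minus field_simps)
  qed
  define Cg where "Cg = good_const K K'"
  define R where "R = moment_const + 2 * steps_const + exp (N0 / 4)"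
  have R0: "0 \<le> R" using moment_const_nonneg steps_const_ge by (simp add: R_def)
  have final: "(Cg * \<psi> \<alpha>s)\<^sup>2 + \<delta>\<^sup>2 * (1 + L) * R \<le> mse_const * (\<psi> \<alpha>s)\<^sup>2"
  proof -
    have "\<delta>\<^sup>2 * (1 + L) \<le> S\<^sup>2"
      using L d by (simp add: S_def power_mult_distrib power2_sum)
    also have "\<dots> \<le> (Tm * \<psi> \<alpha>s)\<^sup>2" using S_le by (rule power_mono) (use d L in \<open>simp add: S_def\<close>)
    finally have "\<delta>\<^sup>2 * (1 + L) * R \<le> (Tm * \<psi> \<alpha>s)\<^sup>2 * R" using R0 by (rule mult_right_mono)
    then show ?thesis
      by (simp add: mse_const_def Cg_def K_def K'_def N0_def R_def Tm_def power_mult_distrib algebra_simps)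
  qed
  show ?thesis
  proof (cases "\<kappa> < 1 / 2")
    case True
    txt \<open>The exponential moments say nothing for small \<open>\<kappa>\<close>, but then \<open>\<delta>\<close> is bounded away from \<open>0\<close>.\<close>
    have "1 / \<delta> ^ 6 = \<delta>\<^sup>2 * (1 / \<delta> ^ 8)" using d by (simp add: field_simps flip: power_add)
    also have "\<dots> \<le> \<delta>\<^sup>2 * exp (8 * L)" by (intro mult_left_mono ln_d) simp
    also have "\<dots> \<le> \<delta>\<^sup>2 * exp (N0 / 4)"
    proof -
      have "\<kappa>\<^sup>2 \<le> (1 / 2)\<^sup>2" using True kap(1) by (intro power_mono) auto
      then have "\<kappa>\<^sup>2 * N0 \<le> (1 / 2)\<^sup>2 * N0" using N0 by (intro mult_right_mono) auto
      then have "8 * L \<le> N0 / 4" unfolding kap(2) by (simp add: power2_eq_square)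
      then show ?thesis by (simp add: mult_left_mono)
    qed
    finally have d6: "1 / \<delta> ^ 6 \<le> \<delta>\<^sup>2 * exp (N0 / 4)" .
    have "(\<integral>\<^sup>+\<omega>. ennreal ((norm (err (\<zeta> \<omega>)))\<^sup>2) \<partial>M)
        \<le> (\<integral>\<^sup>+\<omega>. ennreal (c0 * e0 (\<zeta> \<omega>)) + ennreal (\<delta>\<^sup>2 * exp (N0 / 4)) \<partial>M)"
    proof (rule nn_integral_mono)
      fix \<omega>
      have "(norm (err (\<zeta> \<omega>)))\<^sup>2 \<le> c0 * e0 (\<zeta> \<omega>) + \<delta>\<^sup>2 * exp (N0 / 4)"
        using split[of "\<zeta> \<omega>"] d6 by linarith
      then show "ennreal ((norm (err (\<zeta> \<omega>)))\<^sup>2) \<le> ennreal (c0 * e0 (\<zeta> \<omega>)) + ennreal (\<delta>\<^sup>2 * exp (N0 / 4))"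
        using c0 by (simp add: e0_def ennreal_leI flip: ennreal_plus)
    qed
    also have "\<dots> = (\<integral>\<^sup>+\<omega>. ennreal (c0 * e0 (\<zeta> \<omega>)) \<partial>M) + ennreal (\<delta>\<^sup>2 * exp (N0 / 4))"
      by (subst nn_integral_add) (auto simp: emeasure_space_1)
    also have "\<dots> \<le> ennreal (\<delta>\<^sup>2 * moment_const) + ennreal (\<delta>\<^sup>2 * exp (N0 / 4))"
      by (intro add_mono E0) simp
    also have "\<dots> = ennreal (\<delta>\<^sup>2 * 1 * (moment_const + exp (N0 / 4)))"
      using moment_const_nonneg by (simp add: distrib_left flip: ennreal_plus)
    also have "\<dots> \<le> ennreal (\<delta>\<^sup>2 * (1 + L) * R)"
      using moment_const_nonneg steps_const_ge L
      by (intro ennreal_leI mult_mono) (auto simp: R_def)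
    also have "\<dots> \<le> ennreal (mse_const * (\<psi> \<alpha>s)\<^sup>2)"
      using final zero_le_power2[of "Cg * \<psi> \<alpha>s"] by (intro ennreal_leI) linarith
    finally show ?thesis .
  next
    case False
    define a where "a k = q ^ k * \<alpha>0" for k
    have a: "0 < a k" "a k \<le> \<alpha>0" for k using q alpha0 grid_le by (auto simp: a_def)
    define X where "X k z = norm (op_fun A (\<lambda>t. a k / (t + a k)) z)" for k z
    define Y where "Y k z = norm (op_fun A (\<lambda>t. 1 / sqrt (t + a k)) z)" for k z
    define N where "N k = eff_dim A (a k)" for k
    have N: "N0 \<le> N k" "0 < N k" for k
      using eff_dim_antimono[OF a] eff_dim_pos[OF a(1)] by (auto simp: N_def N0_def)
    define b1 where "b1 k z = exp ((X k z)\<^sup>2 / a k) * exp (- ((1 + \<kappa>)\<^sup>2 * N k))" for k z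
    define b2 where "b2 k z = exp ((Y k z)\<^sup>2 / 4) * exp (- (4 * (1 + \<kappa>)\<^sup>2 * N k))" for k z
    \<comment> \<open>\<open>m\<close> exceeds every exponent at which the rule can stop, whatever
      the noise, so the union bound runs over a fixed range.\<close>
    define m where "m = nat \<lfloor>steps_const * (1 + L)\<rfloor>"
    have m: "real m \<le> steps_const * (1 + L)" using steps_const_ge L by (simp add: m_def)
    txt \<open>Markov's inequality in pointwise form: \<open>b1 k z\<close> or \<open>b2 k z\<close> is at least \<open>1\<close> at a bad grid point.\<close>
    have bad: "(norm (err z))\<^sup>2 \<le> (Cg * \<psi> \<alpha>s)\<^sup>2 + c0 * e0 z + 1 / \<delta> ^ 6 * (\<Sum>k<m. b1 k z + b2 k z)" for z
    proof -
      obtain k where k: "rg_alpha A g x0 q \<alpha>0 \<tau> \<eta> \<kappa> \<delta> (data (x0 + w) z \<delta>) = a k"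
        "rg_stop A g x0 \<tau> \<eta> \<kappa> \<delta> (data (x0 + w) z \<delta>) (a k)"
        "k = 0 \<or> \<not> rg_stop A g x0 \<tau> \<eta> \<kappa> \<delta> (data (x0 + w) z \<delta>) (a (k - 1))"
        "k = 0 \<or> N0 * \<eta>\<^sup>2 * \<delta>\<^sup>2 < q ^ (k - 1) * \<alpha>0"
        using k_cases[of "data (x0 + w) z \<delta>"] unfolding a_def by blast
      have km: "k < m"
        using steps_le[OF d k(4)[unfolded N0_def]] by (simp add: m_def L_def) linarith
      have nn: "0 \<le> b1 j z + b2 j z" for j by (simp add: b1_def b2_def)
      \<comment> \<open>\<open>X\<close> must be controlled at the stopping point, for the bias, and
        at its predecessor, where the test failed; \<open>bad1\<close> covers both by ranging over
        \<open>j\<close>. \<open>Y\<close> enters only at the stopping point.\<close>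
      consider (good) "X k z \<le> (1 + \<kappa>) * sqrt (a k * N k)" "Y k z \<le> 4 * (1 + \<kappa>) * sqrt (N k)"
          "k = 0 \<or> X (k - 1) z \<le> (1 + \<kappa>) * sqrt (a (k - 1) * N (k - 1))"
        | (bad1) j where "j < m" "(1 + \<kappa>) * sqrt (a j * N j) < X j z"
        | (bad2) "4 * (1 + \<kappa>) * sqrt (N k) < Y k z"
        using km by (metis less_imp_diff_less not_le)
      then have "norm (err z) \<le> Cg * \<psi> \<alpha>s \<or> 1 \<le> (\<Sum>k<m. b1 k z + b2 k z)"
      proof cases
        case good
        have "a k = \<alpha>0 \<or> \<not> rg_stop A g x0 \<tau> \<eta> \<kappa> \<delta> (data (x0 + w) z \<delta>) (a k / q)
            \<and> norm (op_fun A (\<lambda>t. a k / q / (t + a k / q)) z) \<le> (1 + \<kappa>) * sqrt (a k / q * eff_dim A (a k / q))"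
        proof (cases k)
          case (Suc j)
          then have "a k / q = a (k - 1)" using q by (simp add: a_def)
          then show ?thesis using good(3) k(3) Suc by (simp add: X_def N_def)
        qed (simp add: a_def)
        then have "norm (x0 + w - reg_solution A g x0 (data (x0 + w) z \<delta>) (a k)) \<le> Cg * \<psi> \<alpha>s"
          unfolding Cg_def
          by (intro good_error_le[OF w tail d a k(2) _ _ _ as kap(1) K(1) SK K'(1) SK'])
             (use good in \<open>auto simp: X_def Y_def N_def\<close>)
        then show ?thesis by (simp add: err_def k(1)[unfolded \<kappa>_def])
      next
        case bad1
        have "((1 + \<kappa>) * sqrt (a j * N j))\<^sup>2 \<le> (X j z)\<^sup>2"
          using bad1(2) kap(1) a N by (intro power_mono) (auto intro!: mult_nonneg_nonneg less_imp_le)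
        then have "a j * ((1 + \<kappa>)\<^sup>2 * N j) \<le> (X j z)\<^sup>2"
          using a[of j] N[of j] by (simp add: power_mult_distrib mult_ac)
        then have "(1 + \<kappa>)\<^sup>2 * N j \<le> (X j z)\<^sup>2 / a j"
          using a[of j] by (simp add: pos_le_divide_eq mult.commute)
        then have "1 \<le> b1 j z" by (simp add: b1_def flip: exp_add)
        moreover have "0 \<le> b2 j z" by (simp add: b2_def)
        moreover have "b1 j z + b2 j z \<le> (\<Sum>k<m. b1 k z + b2 k z)"
          using bad1(1) nn by (intro member_le_sum) auto
        ultimately show ?thesis by linarith
      next
        case bad2
        have "(4 * (1 + \<kappa>) * sqrt (N k))\<^sup>2 \<le> (Y k z)\<^sup>2"
          using bad2 kap(1) N[of k] by (intro power_mono) (auto intro!: mult_nonneg_nonneg less_imp_le)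
        moreover have "(4 * (1 + \<kappa>) * sqrt (N k))\<^sup>2 = 16 * ((1 + \<kappa>)\<^sup>2 * N k)"
          unfolding power_mult_distrib using N[of k] by simp
        ultimately have "4 * (1 + \<kappa>)\<^sup>2 * N k \<le> (Y k z)\<^sup>2 / 4" by simp
        then have "1 \<le> b2 k z" by (simp add: b2_def flip: exp_add)
        moreover have "0 \<le> b1 k z" by (simp add: b1_def)
        moreover have "b1 k z + b2 k z \<le> (\<Sum>k<m. b1 k z + b2 k z)"
          using km nn by (intro member_le_sum) auto
        ultimately show ?thesis by linarith
      qed
      then show ?thesis
      proof
        assume "norm (err z) \<le> Cg * \<psi> \<alpha>s"
        then have "(norm (err z))\<^sup>2 \<le> (Cg * \<psi> \<alpha>s)\<^sup>2" by (rule power_mono) simp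
        moreover have "0 \<le> c0 * e0 z" using c0 by (simp add: e0_def)
        moreover have "0 \<le> 1 / \<delta> ^ 6 * (\<Sum>k<m. b1 k z + b2 k z)"
          using d nn by (intro mult_nonneg_nonneg sum_nonneg) auto
        ultimately show ?thesis by linarith
      next
        assume "1 \<le> (\<Sum>k<m. b1 k z + b2 k z)"
        then have "1 / \<delta> ^ 6 * 1 \<le> 1 / \<delta> ^ 6 * (\<Sum>k<m. b1 k z + b2 k z)"
          using d by (intro mult_left_mono) auto
        then show ?thesis using split[of z] zero_le_power2[of "Cg * \<psi> \<alpha>s"] by linarith
      qed
    qed
    have bX: "spec_bounded (\<lambda>t. a k / (t + a k)) 1" and bY: "spec_bounded (\<lambda>t. 1 / sqrt (t + a k)) (1 / sqrt (a k))" for k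
      using shift_bounded[OF a(1)] inverse_sqrt_bounded[OF a(1)] by auto
    have [measurable]: "(\<lambda>\<omega>. X k (\<zeta> \<omega>)) \<in> borel_measurable M" "(\<lambda>\<omega>. Y k (\<zeta> \<omega>)) \<in> borel_measurable M" for k
      unfolding X_def Y_def by (rule op_fun_zeta_measurable[OF bX] op_fun_zeta_measurable[OF bY])+
    have [measurable]: "(\<lambda>\<omega>. b1 k (\<zeta> \<omega>)) \<in> borel_measurable M" "(\<lambda>\<omega>. b2 k (\<zeta> \<omega>)) \<in> borel_measurable M" for k
      unfolding b1_def b2_def by measurable
    have small: "8 * L \<le> \<kappa>\<^sup>2 * N k" for k
      unfolding kap(2)[symmetric] using N(1)[of k] by (intro mult_left_mono) auto
    have E1: "(\<integral>\<^sup>+\<omega>. ennreal (b1 k (\<zeta> \<omega>)) \<partial>M) \<le> ennreal (\<delta> ^ 8)" for k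
    proof -
      have "(\<integral>\<^sup>+\<omega>. ennreal (b1 k (\<zeta> \<omega>)) \<partial>M) =
          (\<integral>\<^sup>+\<omega>. ennreal (exp ((X k (\<zeta> \<omega>))\<^sup>2 / a k)) \<partial>M) * ennreal (exp (- ((1 + \<kappa>)\<^sup>2 * N k)))"
        by (subst nn_integral_multc[symmetric]) (auto simp: b1_def ennreal_mult)
      also have "\<dots> \<le> ennreal (exp (2 * N k)) * ennreal (exp (- ((1 + \<kappa>)\<^sup>2 * N k)))"
        unfolding X_def N_def by (intro mult_right_mono exp_moment_shift a) simp
      also have "\<dots> = ennreal (exp (2 * N k - (1 + \<kappa>)\<^sup>2 * N k))"
        by (simp add: mult_exp_exp flip: ennreal_mult)
      also have "\<dots> \<le> ennreal (exp (- (8 * L)))"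
      proof -
        \<comment> \<open>The exponent is (1 - 2 kappa - kappa^2) N; kappa >= 1/2 absorbs the 1 and
          leaves - kappa^2 N.\<close>
        have "1 * N k \<le> (2 * \<kappa>) * N k" using False N(2)[of k] by (intro mult_right_mono) auto
        then have "2 * N k - (1 + \<kappa>)\<^sup>2 * N k \<le> - (8 * L)"
          using small[of k] by (simp add: power2_sum algebra_simps)
        then show ?thesis by (simp add: ennreal_leI)
      qed
      also have "\<dots> \<le> ennreal (\<delta> ^ 8)" by (intro ennreal_leI ln_d)
      finally show ?thesis .
    qed
    have E2: "(\<integral>\<^sup>+\<omega>. ennreal (b2 k (\<zeta> \<omega>)) \<partial>M) \<le> ennreal (\<delta> ^ 8)" for k
    proof -
      have "(\<integral>\<^sup>+\<omega>. ennreal (b2 k (\<zeta> \<omega>)) \<partial>M) =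
          (\<integral>\<^sup>+\<omega>. ennreal (exp ((Y k (\<zeta> \<omega>))\<^sup>2 / 4)) \<partial>M) * ennreal (exp (- (4 * (1 + \<kappa>)\<^sup>2 * N k)))"
        by (subst nn_integral_multc[symmetric]) (auto simp: b2_def ennreal_mult)
      also have "\<dots> \<le> ennreal (exp (N k / 2)) * ennreal (exp (- (4 * (1 + \<kappa>)\<^sup>2 * N k)))"
        unfolding Y_def N_def by (intro mult_right_mono exp_moment_inverse_sqrt a) simp
      also have "\<dots> = ennreal (exp (N k / 2 - 4 * (1 + \<kappa>)\<^sup>2 * N k))"
        by (simp add: mult_exp_exp flip: ennreal_mult)
      also have "\<dots> \<le> ennreal (exp (- (8 * L)))"
      proof -
        have "0 \<le> \<kappa> * N k" "0 \<le> \<kappa>\<^sup>2 * N k" using kap(1) N(2)[of k] by auto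
        moreover have "4 * (1 + \<kappa>)\<^sup>2 * N k = 4 * N k + 8 * (\<kappa> * N k) + 4 * (\<kappa>\<^sup>2 * N k)"
          by (simp add: power2_sum algebra_simps)
        ultimately have "N k / 2 - 4 * (1 + \<kappa>)\<^sup>2 * N k \<le> - (8 * L)"
          using small[of k] N(2)[of k] by linarith
        then show ?thesis by (simp add: ennreal_leI)
      qed
      also have "\<dots> \<le> ennreal (\<delta> ^ 8)" by (intro ennreal_leI ln_d)
      finally show ?thesis .
    qed
    have "(\<integral>\<^sup>+\<omega>. ennreal ((norm (err (\<zeta> \<omega>)))\<^sup>2) \<partial>M) \<le>
        (\<integral>\<^sup>+\<omega>. ennreal ((Cg * \<psi> \<alpha>s)\<^sup>2) + (ennreal (c0 * e0 (\<zeta> \<omega>)) +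
          ennreal (1 / \<delta> ^ 6) * (\<Sum>k<m. ennreal (b1 k (\<zeta> \<omega>)) + ennreal (b2 k (\<zeta> \<omega>)))) \<partial>M)"
    proof (rule nn_integral_mono)
      fix \<omega>
      have nn: "0 \<le> b1 k (\<zeta> \<omega>)" "0 \<le> b2 k (\<zeta> \<omega>)" for k by (simp_all add: b1_def b2_def)
      have "(\<Sum>k<m. ennreal (b1 k (\<zeta> \<omega>)) + ennreal (b2 k (\<zeta> \<omega>))) = ennreal (\<Sum>k<m. b1 k (\<zeta> \<omega>) + b2 k (\<zeta> \<omega>))"
        using nn by (simp flip: ennreal_plus)
      moreover have "0 \<le> (\<Sum>k<m. b1 k (\<zeta> \<omega>) + b2 k (\<zeta> \<omega>))" using nn by (intro sum_nonneg) simp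
      moreover have "0 \<le> c0 * e0 (\<zeta> \<omega>)" using c0 by (simp add: e0_def)
      ultimately show "ennreal ((norm (err (\<zeta> \<omega>)))\<^sup>2) \<le> ennreal ((Cg * \<psi> \<alpha>s)\<^sup>2) + (ennreal (c0 * e0 (\<zeta> \<omega>)) +
          ennreal (1 / \<delta> ^ 6) * (\<Sum>k<m. ennreal (b1 k (\<zeta> \<omega>)) + ennreal (b2 k (\<zeta> \<omega>))))"
        using bad[of "\<zeta> \<omega>"] d
        by (simp add: ennreal_leI add.assoc flip: ennreal_plus ennreal_mult)
    qed
    also have "\<dots> = ennreal ((Cg * \<psi> \<alpha>s)\<^sup>2) + ((\<integral>\<^sup>+\<omega>. ennreal (c0 * e0 (\<zeta> \<omega>)) \<partial>M) +
        ennreal (1 / \<delta> ^ 6) * (\<Sum>k<m. (\<integral>\<^sup>+\<omega>. ennreal (b1 k (\<zeta> \<omega>)) \<partial>M) + (\<integral>\<^sup>+\<omega>. ennreal (b2 k (\<zeta> \<omega>)) \<partial>M)))"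
      by (simp add: nn_integral_add nn_integral_cmult nn_integral_sum emeasure_space_1)
    also have "\<dots> \<le> ennreal ((Cg * \<psi> \<alpha>s)\<^sup>2) + (ennreal (\<delta>\<^sup>2 * moment_const) +
        ennreal (1 / \<delta> ^ 6) * (\<Sum>k<m. ennreal (\<delta> ^ 8) + ennreal (\<delta> ^ 8)))"
      by (intro add_mono mult_left_mono sum_mono E0 E1 E2 order_refl) simp
    also have "\<dots> = ennreal ((Cg * \<psi> \<alpha>s)\<^sup>2 + (\<delta>\<^sup>2 * moment_const + 1 / \<delta> ^ 6 * (real m * (2 * \<delta> ^ 8))))"
    proof -
      have "(\<Sum>k<m. ennreal (\<delta> ^ 8) + ennreal (\<delta> ^ 8)) = ennreal (real m * (2 * \<delta> ^ 8))"
        using d by (simp add: ennreal_of_nat_eq_real_of_nat flip: ennreal_plus ennreal_mult)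
      then show ?thesis
        using d moment_const_nonneg by (simp flip: ennreal_plus ennreal_mult)
    qed
    also have "\<dots> \<le> ennreal (mse_const * (\<psi> \<alpha>s)\<^sup>2)"
    proof (rule ennreal_leI)
      have "1 / \<delta> ^ 6 * (real m * (2 * \<delta> ^ 8)) = \<delta>\<^sup>2 * (2 * real m)"
        using d by (simp add: field_simps flip: power_add)
      then have "\<delta>\<^sup>2 * moment_const + 1 / \<delta> ^ 6 * (real m * (2 * \<delta> ^ 8)) = \<delta>\<^sup>2 * (moment_const + 2 * real m)"
        by (simp add: distrib_left)
      also have "\<dots> \<le> \<delta>\<^sup>2 * ((1 + L) * R)"
      proof (rule mult_left_mono)
        have "moment_const * 1 \<le> moment_const * (1 + L)"
          using moment_const_nonneg L by (intro mult_left_mono) auto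
        moreover have "0 \<le> exp (N0 / 4) * (1 + L)" using L by simp
        ultimately show "moment_const + 2 * real m \<le> (1 + L) * R"
          using m by (simp add: R_def algebra_simps)
      qed simp
      finally show "(Cg * \<psi> \<alpha>s)\<^sup>2 + (\<delta>\<^sup>2 * moment_const + 1 / \<delta> ^ 6 * (real m * (2 * \<delta> ^ 8))) \<le> mse_const * (\<psi> \<alpha>s)\<^sup>2"
        using final by (simp add: mult.assoc)
    qed
    finally show ?thesis .
  qed
qed

end

theorem corollary2p1:
  fixes T :: "'a::{real_inner, complete_space} \<Rightarrow> 'b::{real_inner, complete_space}"
    and A :: "'a \<Rightarrow> 'a"
    and M :: "'w measure"
    and \<xi> :: "'b \<Rightarrow> 'w \<Rightarrow> real"
    and \<zeta> :: "'w \<Rightarrow> 'a"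
    and x0 :: 'a
    and g :: "real \<Rightarrow> real \<Rightarrow> real"
    and \<psi> :: "real \<Rightarrow> real"
    and \<alpha>0 q \<tau> \<eta> c1 c2 t0 :: real
  assumes T: "compact_op T" "T \<noteq> (\<lambda>x. 0)"
    and A: "A = adjoint T \<circ> T"
    and trace: "op_trace A < \<infinity>"
    and M: "prob_space M" "complete_measure M"
    and \<xi>: "white_noise M \<xi>"
    and \<zeta>: "adjoint_noise M T \<xi> \<zeta>"
    and params: "\<alpha>0 > 0" "0 < q" "q < 1" "\<tau> > 1" "\<eta> > 0"
    and \<psi>: "\<psi> \<in> {0..onorm A} \<rightarrow> {0..}" "continuous_on {0..onorm A} \<psi>"
      "mono_on {0..onorm A} \<psi>" "\<psi> 0 = 0"
    and g: "regularization (onorm A) g" "qualification (onorm A) g \<psi>"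
    and constants: "c1 > 1" "0 < c2" "c2 < 1" "0 < t0" "t0 < onorm A"
  shows "\<exists>C::real. \<forall>\<delta>>0.
    \<delta> * (1 + sqrt \<bar>ln (1 / \<delta>)\<bar>) \<in> Theta_psi A \<psi> ` {0<..onorm A} \<longrightarrow>
    (SUP x\<in>{x. x - x0 \<in> source_set A \<psi> \<and> tail_condition A g c1 c2 t0 (x - x0)}.
       rms_norm M (\<lambda>\<omega>.
         let z = noisy_data A \<zeta> \<delta> x \<omega>
         in x - reg_solution A g x0 z
                  (rg_alpha A g x0 q \<alpha>0 \<tau> \<eta> (rg_kappa A \<alpha>0 \<delta>) \<delta> z)))
    \<le> ennreal (C * \<psi> (Theta_psi_inv A \<psi> (\<delta> * (1 + sqrt \<bar>ln (1 / \<delta>)\<bar>))))"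
proof -
  have bT: "bounded_linear T" using T by (simp add: compact_op_def)
  have AT: "A x \<bullet> y = T x \<bullet> T y" for x y unfolding A by (rule inner_adjoint_comp[OF bT])
  obtain E where E: "orthonormal_basis E" "\<And>e. e \<in> E \<Longrightarrow> A e = (e \<bullet> A e) *\<^sub>R e"
    using exists_eigenbasis[OF T(1) A] by blast
  have nz: "A \<noteq> (\<lambda>x. 0)"
  proof
    assume "A = (\<lambda>x. 0)"
    then have "T x \<bullet> T x = 0" for x by (simp flip: AT)
    then show False using T(2) by auto
  qed
  obtain \<gamma> where \<gamma>: "1 \<le> \<gamma>" "\<And>\<alpha> t. 0 < \<alpha> \<Longrightarrow> t \<in> {0..onorm A} \<Longrightarrow> \<alpha> * \<bar>g \<alpha> t\<bar> \<le> \<gamma>"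
    using g(1) unfolding regularization_def by metis
  obtain \<Gamma> where \<Gamma>: "\<And>\<alpha> t. t \<in> {0..onorm A} \<Longrightarrow> \<alpha> \<in> {0<..onorm A} \<Longrightarrow>
      \<bar>residual g \<alpha> t\<bar> * \<psi> t \<le> \<Gamma> * \<psi> \<alpha>"
    using g(2) unfolding qualification_def by metis
  have \<psi>0: "0 \<le> \<psi> t" if "0 \<le> t" "t \<le> onorm A" for t using \<psi>(1) that by auto
  interpret bounded_linear A
    unfolding A o_def by (rule bounded_linear_compose[OF bounded_linear_adjoint[OF bT] bT])
  interpret prob_space M by (rule M(1))
  \<comment> \<open>The qualification constant is raised to at least 1, as
    \<open>U_source_le\<close> requires above \<open>onorm A\<close>; this keeps the qualification
    valid because \<open>\<psi>\<close> is nonnegative.\<close>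
  interpret rg_noise A E M \<xi> T \<zeta> x0 g \<psi> \<alpha>0 q \<tau> \<eta> c1 c2 t0 \<gamma> "max 1 \<Gamma>"
  proof unfold_locales
    show "A x \<bullet> y = x \<bullet> A y" for x y using AT[of x y] AT[of y x] by (simp add: inner_commute)
    show "0 \<le> x \<bullet> A x" for x using AT[of x x] by (simp add: inner_commute)
    show "residual g \<alpha> t * \<psi> t \<le> max 1 \<Gamma> * \<psi> \<alpha>"
      if "0 < \<alpha>" "\<alpha> \<le> onorm A" "0 \<le> t" "t \<le> onorm A" for \<alpha> t
    proof -
      have "residual g \<alpha> t * \<psi> t \<le> \<bar>residual g \<alpha> t\<bar> * \<psi> t"
        using \<psi>0[OF that(3,4)] by (intro mult_right_mono) auto
      also have "\<dots> \<le> \<Gamma> * \<psi> \<alpha>" using that by (intro \<Gamma>) auto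
      also have "\<dots> \<le> max 1 \<Gamma> * \<psi> \<alpha>" using \<psi>0[of \<alpha>] that by (intro mult_right_mono) auto
      finally show ?thesis .
    qed
    show "residual g \<alpha> t \<le> residual g \<beta> t"
      if "0 < \<alpha>" "\<alpha> \<le> \<beta>" "0 \<le> t" "t \<le> onorm A" for \<alpha> \<beta> t
      using g(1) that unfolding regularization_def by auto
    show "0 \<le> residual g \<alpha> t" "residual g \<alpha> t \<le> 1"
      if "0 < \<alpha>" "0 \<le> t" "t \<le> onorm A" for \<alpha> t
      using g(1) that unfolding regularization_def by auto
  qed (use E nz trace \<xi> \<zeta> AT params \<psi>(3) \<psi>0 \<gamma> constants in auto)
  show ?thesis
  proof (intro exI[of _ "sqrt mse_const"] allI impI SUP_least)
    fix \<delta> x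
    assume d: "0 < \<delta>"
      and range: "\<delta> * (1 + sqrt \<bar>ln (1 / \<delta>)\<bar>) \<in> Theta_psi A \<psi> ` {0<..onorm A}"
      and x: "x \<in> {x. x - x0 \<in> source_set A \<psi> \<and> tail_condition A g c1 c2 t0 (x - x0)}"
    let ?s = "\<delta> * (1 + sqrt \<bar>ln (1 / \<delta>)\<bar>)"
    obtain \<alpha>s where as: "0 < \<alpha>s" "\<alpha>s \<le> onorm A" "Theta_psi A \<psi> \<alpha>s = ?s" using range by auto
    have s: "0 < ?s" using d by (intro mult_pos_pos add_pos_nonneg) auto
    have inv: "Theta_psi_inv A \<psi> ?s = \<alpha>s" by (rule Theta_psi_inv_eq[OF as s \<psi>(3)])
    have psi_pos: "0 < \<psi> \<alpha>s"
      using as(3) s Theta_pos[OF as(1)] by (simp add: Theta_psi_def zero_less_mult_iff flip: as(3))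
    define w where "w = x - x0"
    have w: "w \<in> source_set A \<psi>" "tail_condition A g c1 c2 t0 w" and xw: "x = x0 + w"
      using x by (auto simp: w_def)
    show "rms_norm M (\<lambda>\<omega>. let z = noisy_data A \<zeta> \<delta> x \<omega>
         in x - reg_solution A g x0 z (rg_alpha A g x0 q \<alpha>0 \<tau> \<eta> (rg_kappa A \<alpha>0 \<delta>) \<delta> z))
      \<le> ennreal (sqrt mse_const * \<psi> (Theta_psi_inv A \<psi> ?s))"
      unfolding inv Let_def noisy_data_def xw
    proof (rule rms_norm_le)
      show "0 \<le> sqrt mse_const * \<psi> \<alpha>s" using mse_const_nonneg psi_pos by simp
      show "(\<integral>\<^sup>+\<omega>. ennreal ((norm (x0 + w - reg_solution A g x0 (A (x0 + w) + \<delta> *\<^sub>R \<zeta> \<omega>)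
          (rg_alpha A g x0 q \<alpha>0 \<tau> \<eta> (rg_kappa A \<alpha>0 \<delta>) \<delta> (A (x0 + w) + \<delta> *\<^sub>R \<zeta> \<omega>))))\<^sup>2) \<partial>M)
        \<le> ennreal ((sqrt mse_const * \<psi> \<alpha>s)\<^sup>2)"
        using mse_le[OF w d as(1,2) psi_pos as(3)[unfolded Theta_psi_def]] mse_const_nonneg
        by (simp add: power_mult_distrib)
    qed
  qed
qed

end
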